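(* Suppose that $\mu,\sigma:[0,\infty)^2\to[0,\infty)$ are such that $\mu$ and $\sigma^2$ are globally Lipschitz continuous on $[0,\infty)^2$ and $\{x\in\mathbb{R}^2_+:\mu(x)=0\}\supset\{x\in\mathbb{R}^2_+:\sigma(x)=0\}$, and let $\mu_s:\partial\mathbb{R}^2_+\to[0,\infty)$ be bounded and upper semicontinuous with a locally finite set of discontinuities. For $h>0$ let $U^h_{i,j}$ be the solution of the scheme (S) in the context, and let $U^h(x)=U^h_{\lfloor h^{-1}x_1\rfloor,\lfloor h^{-1}x_2\rfloor}$ be its extension to $[0,\infty)^2$. Then $$U^h\longrightarrow U\quad\text{locally uniformly on }[0,\infty)^2\text{ as }h\to0,$$ where $U$ is the unique monotone viscosity solution of $$(U_{x_1}-\mu)_+(U_{x_2}-\mu)_+=\sigma^2\ \text{ on }\mathbb{R}^2_+,\qquad U=\varphi\ \text{ on }\partial\mathbb{R}^2_+,$$ with $\varphi(x)=(x_1+x_2)\int_0^1\big(\mu(tx)+\mu_s(tx)\big)\,dt$.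
   Context: Notation: $\mathbb{R}_+=(0,\infty)$, $\mathbb{N}_0=\{0,1,2,\dots\}$, $t_+=\max(t,0)$; monotone means non-decreasing in each variable. $\mu_s$ is extended to $[0,\infty)^2$ by $\mu_s=0$ on $\mathbb{R}^2_+$. Scheme (S): with $\mu_{i,j}=\mu(hi,hj)+\mu_s(hi,hj)$ and $\sigma_{i,j}=\sigma(hi,hj)$, $$U^h_{i,j}=\tfrac12\big(U^h_{i-1,j}+U^h_{i,j-1}\big)+h\mu_{i,j}+\tfrac12\sqrt{\big(U^h_{i-1,j}-U^h_{i,j-1}\big)^2+4h^2\sigma_{i,j}^2}\quad\text{if }(i,j)\in\mathbb{N}_0^2,$$ and $U^h_{i,j}=0$ if $(i,j)\notin\mathbb{N}_0^2$. Viscosity solutions (continuous coefficients): $D^+u(x)$ (resp. $D^-u(x)$) is the set of $p$ with $u(y)\le$ (resp. $\ge$) $u(x)+\langle p,y-x\rangle+o(|x-y|)$ as $y\to x$. $U\in C([0,\infty)^2)$ is a viscosity solution of the equation on $\mathbb{R}^2_+$ if, for all $x\in\mathbb{R}^2_+$, $(p_1-\mu(x))_+(p_2-\mu(x))_+\le\sigma^2(x)$ for all $p\in D^+U(x)$, and $(p_1-\mu(x))_+(p_2-\mu(x))_+\ge\sigma^2(x)$ for all $p\in D^-U(x)$. *)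

theory Defs
  imports "HOL-Analysis.Analysis" "HOL-Library.Landau_Symbols"
begin

definition quadrant :: "(real \<times> real) set" where
  "quadrant = {0..} \<times> {0..}"

definition open_quadrant :: "(real \<times> real) set" where
  "open_quadrant = {0<..} \<times> {0<..}"

abbreviation quadrant_boundary :: "(real \<times> real) set" where
  "quadrant_boundary \<equiv> frontier open_quadrant"

lemma quadrant_boundary_eq:
  "quadrant_boundary = {x \<in> quadrant. fst x = 0 \<or> snd x = 0}"
proof -
  have "closure open_quadrant = quadrant" "open open_quadrant"
    by (auto simp: open_quadrant_def quadrant_def closure_Times closure_greaterThan open_Times)
  then show ?thesis
    by (auto simp: frontier_def interior_open open_quadrant_def quadrant_def)
qed

lemma quadrant_eq_union: "quadrant = open_quadrant \<union> quadrant_boundary"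
  unfolding quadrant_boundary_eq by (auto simp: open_quadrant_def quadrant_def)

definition upper_semicontinuous_on ::
    "'a::topological_space set \<Rightarrow> ('a \<Rightarrow> real) \<Rightarrow> bool" where
  "upper_semicontinuous_on S f \<longleftrightarrow>
     (\<forall>x\<in>S. \<forall>a>f x. \<forall>\<^sub>F y in at x within S. f y < a)"

text \<open>Discontinuity is meant relative to \<open>S\<close>, i.e. of the restriction of \<open>f\<close> to \<open>S\<close>.\<close>

definition discontinuities_on ::
    "'a::t2_space set \<Rightarrow> ('a \<Rightarrow> real) \<Rightarrow> 'a set" where
  "discontinuities_on S f = {x \<in> S. \<not> continuous (at x within S) f}"

definition locally_finite_set :: "'a::metric_space set \<Rightarrow> bool" where
  "locally_finite_set D \<longleftrightarrow> (\<forall>x. \<exists>r>0. finite (D \<inter> ball x r))"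

text \<open>\<open>\<mu>\<^sub>s\<close> is only meaningful on the boundary; its values elsewhere are discarded.\<close>

definition boundary_ext :: "(real \<times> real \<Rightarrow> real) \<Rightarrow> real \<times> real \<Rightarrow> real" where
  "boundary_ext \<mu>\<^sub>s x = (if x \<in> quadrant_boundary then \<mu>\<^sub>s x else 0)"

function scheme ::
    "(real \<times> real \<Rightarrow> real) \<Rightarrow> (real \<times> real \<Rightarrow> real) \<Rightarrow> (real \<times> real \<Rightarrow> real) \<Rightarrow>
     real \<Rightarrow> int \<Rightarrow> int \<Rightarrow> real" where
  "scheme \<mu> \<mu>\<^sub>s \<sigma> h i j =
     (if 0 \<le> i \<and> 0 \<le> j then
        (scheme \<mu> \<mu>\<^sub>s \<sigma> h (i - 1) j + scheme \<mu> \<mu>\<^sub>s \<sigma> h i (j - 1)) / 2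
        + h * (\<mu> (h * of_int i, h * of_int j) + boundary_ext \<mu>\<^sub>s (h * of_int i, h * of_int j))
        + sqrt ((scheme \<mu> \<mu>\<^sub>s \<sigma> h (i - 1) j - scheme \<mu> \<mu>\<^sub>s \<sigma> h i (j - 1))\<^sup>2
                + 4 * h\<^sup>2 * (\<sigma> (h * of_int i, h * of_int j))\<^sup>2) / 2
      else 0)"
  by auto
termination
  by (relation "Wellfounded.measure (\<lambda>(_, _, _, _, i, j). nat (i + j + 2))") auto

declare scheme.simps [simp del]

definition scheme_ext ::
    "(real \<times> real \<Rightarrow> real) \<Rightarrow> (real \<times> real \<Rightarrow> real) \<Rightarrow> (real \<times> real \<Rightarrow> real) \<Rightarrow>
     real \<Rightarrow> real \<times> real \<Rightarrow> real" where
  "scheme_ext \<mu> \<mu>\<^sub>s \<sigma> h x = scheme \<mu> \<mu>\<^sub>s \<sigma> h \<lfloor>inverse h * fst x\<rfloor> \<lfloor>inverse h * snd x\<rfloor>"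

definition superdifferential ::
    "('a::real_inner \<Rightarrow> real) \<Rightarrow> 'a \<Rightarrow> 'a set" where
  "superdifferential u x =
     {p. \<exists>r. r \<in> o[at x](\<lambda>y. norm (x - y)) \<and>
             (\<forall>\<^sub>F y in at x. u y \<le> u x + p \<bullet> (y - x) + r y)}"

definition subdifferential ::
    "('a::real_inner \<Rightarrow> real) \<Rightarrow> 'a \<Rightarrow> 'a set" where
  "subdifferential u x =
     {p. \<exists>r. r \<in> o[at x](\<lambda>y. norm (x - y)) \<and>
             (\<forall>\<^sub>F y in at x. u y \<ge> u x + p \<bullet> (y - x) + r y)}"

definition hamiltonian ::
    "(real \<times> real \<Rightarrow> real) \<Rightarrow> real \<times> real \<Rightarrow> real \<times> real \<Rightarrow> real" where
  "hamiltonian \<mu> x p = max (fst p - \<mu> x) 0 * max (snd p - \<mu> x) 0"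

definition viscosity_solution ::
    "(real \<times> real \<Rightarrow> real) \<Rightarrow> (real \<times> real \<Rightarrow> real) \<Rightarrow> (real \<times> real \<Rightarrow> real) \<Rightarrow> bool" where
  "viscosity_solution \<mu> \<sigma> U \<longleftrightarrow>
     continuous_on quadrant U \<and>
     (\<forall>x\<in>open_quadrant.
        (\<forall>p\<in>superdifferential U x. hamiltonian \<mu> x p \<le> (\<sigma> x)\<^sup>2) \<and>
        (\<forall>p\<in>subdifferential U x. hamiltonian \<mu> x p \<ge> (\<sigma> x)\<^sup>2))"

definition monotone_on_quadrant :: "(real \<times> real \<Rightarrow> real) \<Rightarrow> bool" where
  "monotone_on_quadrant U \<longleftrightarrow>
     (\<forall>b\<ge>0. mono_on {0..} (\<lambda>a. U (a, b))) \<and> (\<forall>a\<ge>0. mono_on {0..} (\<lambda>b. U (a, b)))"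

definition boundary_value ::
    "(real \<times> real \<Rightarrow> real) \<Rightarrow> (real \<times> real \<Rightarrow> real) \<Rightarrow> real \<times> real \<Rightarrow> real" where
  "boundary_value \<mu> \<mu>\<^sub>s x =
     (fst x + snd x) * integral {0..1} (\<lambda>t. \<mu> (t *\<^sub>R x) + boundary_ext \<mu>\<^sub>s (t *\<^sub>R x))"

definition monotone_solution ::
    "(real \<times> real \<Rightarrow> real) \<Rightarrow> (real \<times> real \<Rightarrow> real) \<Rightarrow> (real \<times> real \<Rightarrow> real) \<Rightarrow>
     (real \<times> real \<Rightarrow> real) \<Rightarrow> bool" where
  "monotone_solution \<mu> \<sigma> \<phi> U \<longleftrightarrow>
     monotone_on_quadrant U \<and> viscosity_solution \<mu> \<sigma> U \<and> (\<forall>x\<in>quadrant_boundary. U x = \<phi> x)"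

definition locally_uniform_limit ::
    "'a::topological_space set \<Rightarrow> ('i \<Rightarrow> 'a \<Rightarrow> real) \<Rightarrow> ('a \<Rightarrow> real) \<Rightarrow> 'i filter \<Rightarrow> bool" where
  "locally_uniform_limit S f g F \<longleftrightarrow> (\<forall>K. compact K \<and> K \<subseteq> S \<longrightarrow> uniform_limit K f g F)"

end

theory Submission
  imports Defs
begin

text \<open>
  Why the theorem is true. At an interior grid point the recursion picks the larger root of
  \<open>(D\<^sub>1U - \<mu>) (D\<^sub>2U - \<mu>) = \<sigma>\<^sup>2\<close>, where \<open>D\<^sub>1U\<close> and \<open>D\<^sub>2U\<close> are the backward difference quotients, and for
  this root both of them are at least \<open>\<mu>\<close>. If the quadratic
  \<open>U(x) + p \<bullet> (y - x) + \<kappa> |y - x|\<^sup>2\<close> touches the scheme from above at \<open>x\<close>, then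
  \<open>D\<^sub>iU \<ge> p\<^sub>i - \<kappa> h\<close>, so the Hamiltonian inequality of a subsolution holds with \<open>p\<close> lowered by \<open>\<kappa> h\<close>;
  touching from below is symmetric. A viscosity solution satisfies the same inequalities with
  error 0. One comparison estimate for functions on compact sets, \<open>doubling_estimate\<close>, therefore
  covers both situations: on two grids of mesh sizes \<open>h\<close> and \<open>k\<close> it shows that the schemes are
  Cauchy as the mesh shrinks and that their limit is continuous, and on a square it shows that two
  monotone viscosity solutions with the same boundary values agree.

  The comparison maximises \<open>u(x) - v(y) - \<epsilon> (y\<^sub>1 + y\<^sub>2) - \<alpha> |x - y|\<^sup>2\<close>. The term in \<open>\<epsilon>\<close> raises both
  components of the test gradient of \<open>v\<close> by \<open>\<epsilon>\<close>, and this must increase the Hamiltonian by a fixed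
  amount. Where \<open>\<sigma> > 0\<close>, the two factors are positive and their product grows by at least
  \<open>\<epsilon>\<^sup>2\<close>. Where \<open>\<sigma> = 0\<close>, the hypothesis on the zero sets gives \<open>\<mu> = 0\<close>, monotonicity of \<open>v\<close> gives
  \<open>p\<^sub>i \<ge> 0\<close>, and again the product is at least \<open>\<epsilon>\<^sup>2\<close>. The Lipschitz bounds make the remaining errors
  small once \<open>\<alpha> |x - y|\<^sup>2\<close> is small, which holds for one of the values \<open>\<alpha> = 2, 4, ..., 2\<^sup>N\<close> because
  the maxima decrease in \<open>\<alpha>\<close> and, as long as they are positive, cannot drop by a fixed amount at
  every doubling.

  The estimate needs control where one of the two points lies on the boundary. Along an axis the
  recursion is a Riemann sum of \<open>\<mu> + \<mu>\<^sub>s\<close> up to an error of order \<open>\<surd>h\<close> (\<open>axis_sum_estimate\<close>), and the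
  Riemann sums converge uniformly because \<open>\<mu>\<^sub>s\<close> has only finitely many discontinuities on a bounded
  piece of the axis (\<open>riemann_sum_uniform\<close>). Off the axis the scheme is bounded below by its axis
  value, since it is monotone, and above by a linear barrier (\<open>U_near_axis\<close>).

  Finally, the limit inherits the Hamiltonian inequalities: a test function touching the limit at
  \<open>x\<close>, made strict by a small cone, touches the scheme at a grid point near \<open>x\<close>
  (\<open>scheme_touching\<close>).
\<close>

section \<open>Touching inequalities on a compact set\<close>

definition square :: "real \<Rightarrow> (real \<times> real) set" where
  "square R = {0..R} \<times> {0..R}"

text \<open>The definition requires the subsolution inequality only where a paraboloid of opening \<open>\<kappa>\<close> touches
\<open>u\<close> from above relative to \<open>X\<close>, and lets the gradient be lowered by \<open>\<eta>\<close>. With \<open>X\<close> a square and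
\<open>\<eta> = 0\<close> it follows from the viscosity inequality, with \<open>X\<close> a grid of mesh \<open>h\<close> and
\<open>\<eta> = \<kappa> h\<close> it holds for the scheme. Points with a coordinate equal to \<open>R\<close> are exempt because a
maximum over a square may lie on its outer sides, where a touching paraboloid says nothing.\<close>

definition subsolution_on ::
    "(real \<times> real \<Rightarrow> real) \<Rightarrow> (real \<times> real \<Rightarrow> real) \<Rightarrow> real \<Rightarrow> real \<Rightarrow> real \<Rightarrow>
     (real \<times> real) set \<Rightarrow> (real \<times> real \<Rightarrow> real) \<Rightarrow> bool" where
  "subsolution_on \<mu> \<sigma> R \<kappa> \<eta> X u \<longleftrightarrow>
     (\<forall>x\<in>X. \<forall>p. 0 < fst x \<and> fst x < R \<and> 0 < snd x \<and> snd x < R \<and>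
        (\<forall>y\<in>X. u y \<le> u x + p \<bullet> (y - x) + \<kappa> * (dist y x)\<^sup>2) \<longrightarrow>
        hamiltonian \<mu> x (p - (\<eta>, \<eta>)) \<le> (\<sigma> x)\<^sup>2)"

text \<open>The bounds \<open>- \<eta> \<le> fst p\<close> and \<open>- \<eta> \<le> snd p\<close> record monotonicity of \<open>v\<close>. They carry the information
where \<open>\<sigma>\<close> vanishes, since there the inequality for the Hamiltonian is void.\<close>

definition supersolution_on ::
    "(real \<times> real \<Rightarrow> real) \<Rightarrow> (real \<times> real \<Rightarrow> real) \<Rightarrow> real \<Rightarrow> real \<Rightarrow> real \<Rightarrow>
     (real \<times> real) set \<Rightarrow> (real \<times> real \<Rightarrow> real) \<Rightarrow> bool" where
  "supersolution_on \<mu> \<sigma> R \<kappa> \<eta> X v \<longleftrightarrow>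
     (\<forall>x\<in>X. \<forall>p. 0 < fst x \<and> fst x < R \<and> 0 < snd x \<and> snd x < R \<and>
        (\<forall>y\<in>X. v y \<ge> v x + p \<bullet> (y - x) - \<kappa> * (dist y x)\<^sup>2) \<longrightarrow>
        - \<eta> \<le> fst p \<and> - \<eta> \<le> snd p \<and> (\<sigma> x)\<^sup>2 \<le> hamiltonian \<mu> x (p + (\<eta>, \<eta>)))"

lemma subsolution_onD:
  assumes "subsolution_on \<mu> \<sigma> R \<kappa> \<eta> X u" "x \<in> X" "0 < fst x" "fst x < R" "0 < snd x" "snd x < R"
    and "\<And>y. y \<in> X \<Longrightarrow> u y \<le> u x + p \<bullet> (y - x) + \<kappa> * (dist y x)\<^sup>2"
  shows "hamiltonian \<mu> x (p - (\<eta>, \<eta>)) \<le> (\<sigma> x)\<^sup>2"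
  using assms unfolding subsolution_on_def by blast

lemma supersolution_onD:
  assumes "supersolution_on \<mu> \<sigma> R \<kappa> \<eta> X v" "x \<in> X" "0 < fst x" "fst x < R" "0 < snd x" "snd x < R"
    and "\<And>y. y \<in> X \<Longrightarrow> v y \<ge> v x + p \<bullet> (y - x) - \<kappa> * (dist y x)\<^sup>2"
  shows "- \<eta> \<le> fst p \<and> - \<eta> \<le> snd p \<and> (\<sigma> x)\<^sup>2 \<le> hamiltonian \<mu> x (p + (\<eta>, \<eta>))"
  using assms unfolding supersolution_on_def by blast

lemma dist_sq_prod: "(dist x y)\<^sup>2 = (fst x - fst y)\<^sup>2 + (snd x - snd y)\<^sup>2"
  for x y :: "real \<times> real"
  by (simp add: dist_prod_def dist_real_def)

lemma coord_le_dist: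
  "\<bar>fst x - fst y\<bar> \<le> dist x y" "\<bar>snd x - snd y\<bar> \<le> dist x y" for x y :: "real \<times> real"
  using dist_fst_le[of x y] dist_snd_le[of x y] by (auto simp: dist_real_def)

text \<open>Raising both components of a supersolution gradient by \<open>\<epsilon>\<close> gains \<open>\<epsilon>\<^sup>2\<close>. If \<open>\<sigma> \<noteq> 0\<close>, the product is
positive, hence so are both factors \<open>a\<close> and \<open>b\<close>, and \<open>(a + \<epsilon>) (b + \<epsilon>) \<ge> a b + \<epsilon>\<^sup>2\<close>. If \<open>\<sigma> = 0\<close>, then
\<open>\<mu> = 0\<close>, and the bounds on \<open>q\<close> make each raised factor at least \<open>\<epsilon>\<close>.\<close>

lemma hamiltonian_strict:
  assumes "fst q \<le> fst p - \<epsilon>" "snd q \<le> snd p - \<epsilon>" "- \<eta> \<le> fst q" "- \<eta> \<le> snd q"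
    and H: "(\<sigma> y)\<^sup>2 \<le> hamiltonian \<mu> y (q + (\<eta>, \<eta>))"
    and zero: "\<sigma> y = 0 \<Longrightarrow> \<mu> y = 0" and "0 < \<epsilon>"
  shows "(\<sigma> y)\<^sup>2 + \<epsilon>\<^sup>2 \<le> hamiltonian \<mu> y (p + (\<eta>, \<eta>))"
proof (cases "\<sigma> y = 0")
  case True
  have "\<epsilon> * \<epsilon> \<le> max (fst p + \<eta>) 0 * max (snd p + \<eta>) 0"
    using assms by (intro mult_mono) auto
  then show ?thesis using True zero by (simp add: hamiltonian_def power2_eq_square)
next
  case False
  define a b where "a = fst q + \<eta> - \<mu> y" and "b = snd q + \<eta> - \<mu> y"
  have *: "0 < (\<sigma> y)\<^sup>2" "(\<sigma> y)\<^sup>2 \<le> max a 0 * max b 0"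
    using False H by (auto simp: hamiltonian_def a_def b_def)
  then have ab: "0 < a" "0 < b" by (auto simp: max_def split: if_splits)
  have "(\<sigma> y)\<^sup>2 + \<epsilon>\<^sup>2 \<le> a * b + \<epsilon> * \<epsilon>" using * ab by (simp add: power2_eq_square)
  also have "\<dots> \<le> (a + \<epsilon>) * (b + \<epsilon>)"
    using ab \<open>0 < \<epsilon>\<close> by (simp add: algebra_simps)
  also have "\<dots> \<le> max (fst p + \<eta> - \<mu> y) 0 * max (snd p + \<eta> - \<mu> y) 0"
    using ab assms by (intro mult_mono) (auto simp: a_def b_def)
  finally show ?thesis by (simp add: hamiltonian_def)
qed

text \<open>The difference grows linearly in \<open>p\<close>, with a factor of the size of \<open>\<eta>\<close> and the change of \<open>\<mu>\<close>. In the
doubling argument \<open>p\<close> is of size \<open>\<alpha> |x - y|\<close> and \<open>l\<close> of size \<open>|x - y|\<close>, so the product is controlled by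
\<open>\<alpha> |x - y|\<^sup>2\<close>.\<close>

lemma hamiltonian_diff:
  assumes "0 \<le> \<mu> x" "0 \<le> \<mu> y" "0 \<le> \<eta>" "\<bar>\<mu> x - \<mu> y\<bar> \<le> l"
  shows "hamiltonian \<mu> y (p + (\<eta>, \<eta>)) - hamiltonian \<mu> x (p - (\<eta>, \<eta>))
    \<le> (2 * \<eta> + l) * (\<bar>fst p\<bar> + \<bar>snd p\<bar> + \<eta>)"
proof -
  define a b c d where "a = max (fst p + \<eta> - \<mu> y) 0" and "b = max (snd p + \<eta> - \<mu> y) 0"
    and "c = max (fst p - \<eta> - \<mu> x) 0" and "d = max (snd p - \<eta> - \<mu> x) 0"
  have "(a - c) * b \<le> (2 * \<eta> + l) * (\<bar>snd p\<bar> + \<eta>)"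
    using assms by (intro mult_mono) (auto simp: a_def b_def c_def)
  moreover have "(b - d) * c \<le> (2 * \<eta> + l) * \<bar>fst p\<bar>"
    using assms by (intro mult_mono) (auto simp: d_def b_def c_def)
  ultimately show ?thesis
    unfolding hamiltonian_def
    by (simp flip: a_def b_def c_def d_def) (simp add: algebra_simps)
qed

lemma pos_part_quadratic: "(max (t + s) 0)\<^sup>2 \<le> (max t 0)\<^sup>2 + 2 * max t 0 * s + s\<^sup>2" for t s :: real
proof -
  have "(max (t + s) 0)\<^sup>2 \<le> (max t 0 + s)\<^sup>2"
    by (cases "t + s \<le> 0") (auto simp: max_def intro!: power_mono)
  then show ?thesis by (simp add: power2_sum algebra_simps)
qed

section \<open>Doubling of variables\<close>

text \<open>The quadratic terms with factor \<open>C\<close> vanish on the square of side \<open>T\<close> and reach \<open>C\<close>, an upper bound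
for \<open>u x - v y\<close>, once a coordinate of \<open>y\<close> reaches \<open>T + 1\<close>. They keep maximisers away from the outer sides
of the square of side \<open>T + 2\<close>, and since they increase in \<open>y\<close> they only help the supersolution.\<close>

definition doubled where
  "doubled \<epsilon> C T u v \<alpha> x y = u x - v y - \<epsilon> * (fst y + snd y)
     - C * ((max (fst y - T) 0)\<^sup>2 + (max (snd y - T) 0)\<^sup>2) - \<alpha> * (dist x y)\<^sup>2"

text \<open>At a maximiser \<open>(x0, y0)\<close> off the boundary, \<open>x \<mapsto> u x - \<alpha> |x - y0|\<^sup>2\<close> is maximal at \<open>x0\<close> and
\<open>y \<mapsto> v y + ... + \<alpha> |x0 - y|\<^sup>2\<close> minimal at \<open>y0\<close>. Both tests have the same gradient
\<open>p = 2 \<alpha> (x0 - y0)\<close> up to the increasing penalty, and the two Hamiltonian inequalities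
then contradict each other when \<open>\<alpha> |x0 - y0|\<^sup>2\<close> and \<open>\<eta>\<close> are small: the gain \<open>\<epsilon>\<^sup>2\<close> exceeds all errors.
Otherwise one of the points lies on the boundary and the bound \<open>\<delta>\<close> applies.\<close>

lemma doubled_maximum_le:
  assumes lip: "L-lipschitz_on quadrant \<mu>" "L'-lipschitz_on quadrant (\<lambda>x. (\<sigma> x)\<^sup>2)"
    and \<mu>: "\<forall>x\<in>quadrant. 0 \<le> \<mu> x"
    and zero: "\<forall>x\<in>open_quadrant. \<sigma> x = 0 \<longrightarrow> \<mu> x = 0"
    and pos: "0 \<le> T" "0 < C" "0 < \<epsilon>" "0 \<le> \<delta>" "0 \<le> \<eta>" "1 \<le> \<alpha>" "\<alpha> \<le> A" "\<alpha> + C \<le> K" "0 < s"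
    and XY: "X \<subseteq> square (T + 2)" "Y \<subseteq> square (T + 2)"
    and uv: "\<And>x y. x \<in> X \<Longrightarrow> y \<in> Y \<Longrightarrow> u x - v y \<le> C"
    and sub: "subsolution_on \<mu> \<sigma> (T + 2) K \<eta> X u"
    and super: "supersolution_on \<mu> \<sigma> (T + 2) K \<eta> Y v"
    and bdry: "\<And>x y. x \<in> X \<Longrightarrow> y \<in> Y \<Longrightarrow> dist x y \<le> s \<Longrightarrow>
       x \<in> quadrant_boundary \<or> y \<in> quadrant_boundary \<Longrightarrow> u x - v y \<le> \<delta>"
    and x0: "x0 \<in> X" and y0: "y0 \<in> Y"
    and max: "\<And>x y. x \<in> X \<Longrightarrow> y \<in> Y \<Longrightarrow>
       doubled \<epsilon> C T u v \<alpha> x y \<le> doubled \<epsilon> C T u v \<alpha> x0 y0"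
    and small: "\<alpha> * (dist x0 y0)\<^sup>2 \<le> s\<^sup>2" "s \<le> 1" "(L' + 4 * L) * s \<le> \<epsilon>\<^sup>2 / 4"
      "\<eta> \<le> 1" "\<eta> * (8 * A + 4 + 2 * L) \<le> \<epsilon>\<^sup>2 / 4"
  shows "doubled \<epsilon> C T u v \<alpha> x0 y0 \<le> \<delta>"
proof (rule ccontr)
  assume neg: "\<not> ?thesis"
  have L: "0 \<le> L" "0 \<le> L'" using lip by (auto simp: lipschitz_on_def)
  define D where "D = dist x0 y0"
  define P where "P = (max (fst y0 - T) 0)\<^sup>2 + (max (snd y0 - T) 0)\<^sup>2"
  have "0 \<le> D" by (simp add: D_def)
  have "D\<^sup>2 \<le> \<alpha> * D\<^sup>2" using pos by (simp add: mult_right_le_one_le mult_le_cancel_right1)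
  then have "D\<^sup>2 \<le> s\<^sup>2" using small by (simp add: D_def)
  then have Ds: "D \<le> s" using pos power2_le_imp_le by fastforce
  have q: "x0 \<in> quadrant" "y0 \<in> quadrant" using x0 y0 XY by (auto simp: square_def quadrant_def)
  have nn: "0 \<le> fst y0" "0 \<le> snd y0" using q by (auto simp: quadrant_def)
  have "0 \<le> P" by (simp add: P_def)
  have val: "doubled \<epsilon> C T u v \<alpha> x0 y0 = u x0 - v y0 - \<epsilon> * (fst y0 + snd y0) - C * P - \<alpha> * D\<^sup>2"
    by (simp add: doubled_def P_def D_def)
  have nn2: "0 \<le> \<epsilon> * (fst y0 + snd y0)" "0 \<le> C * P" "0 \<le> \<alpha> * D\<^sup>2"
    using pos nn \<open>0 \<le> P\<close> by auto
  have "P < 1"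
  proof (rule ccontr)
    assume "\<not> P < 1"
    then have "C * 1 \<le> C * P" using pos by (intro mult_left_mono) auto
    then show False using neg val nn2 uv[OF x0 y0] pos by linarith
  qed
  then have "(max (fst y0 - T) 0)\<^sup>2 < 1" "(max (snd y0 - T) 0)\<^sup>2 < 1"
    by (auto simp: P_def intro: le_less_trans[rotated])
  then have yT: "fst y0 < T + 1" "snd y0 < T + 1"
    by (auto simp: power2_less_1_iff abs_square_less_1)
  then have xT: "fst x0 < T + 2" "snd x0 < T + 2"
    using coord_le_dist[of x0 y0] Ds small(2) by (auto simp: D_def)
  have "x0 \<notin> quadrant_boundary \<and> y0 \<notin> quadrant_boundary"
  proof (rule ccontr)
    assume "\<not> ?thesis"
    then have "u x0 - v y0 \<le> \<delta>" using bdry[OF x0 y0] Ds by (auto simp: D_def)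
    then show False using neg val nn2 by linarith
  qed
  then have int: "x0 \<in> open_quadrant" "y0 \<in> open_quadrant"
    using q quadrant_eq_union by auto
  define p where "p = (2 * \<alpha>) *\<^sub>R (x0 - y0)"
  define c1 where "c1 = \<epsilon> + 2 * C * max (fst y0 - T) 0"
  define c2 where "c2 = \<epsilon> + 2 * C * max (snd y0 - T) 0"
  define q where "q = p - (c1, c2)"
  have "hamiltonian \<mu> x0 (p - (\<eta>, \<eta>)) \<le> (\<sigma> x0)\<^sup>2"
  proof -
    have "u x \<le> u x0 + p \<bullet> (x - x0) + K * (dist x x0)\<^sup>2" if "x \<in> X" for x
    proof -
      have "u x - \<alpha> * (dist x y0)\<^sup>2 \<le> u x0 - \<alpha> * (dist x0 y0)\<^sup>2"
        using max[OF that y0] by (simp add: doubled_def)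
      moreover have "\<alpha> * (dist x y0)\<^sup>2 - \<alpha> * (dist x0 y0)\<^sup>2 = p \<bullet> (x - x0) + \<alpha> * (dist x x0)\<^sup>2"
        unfolding dist_sq_prod p_def inner_prod_def by (simp add: power2_eq_square algebra_simps)
      moreover have "\<alpha> * (dist x x0)\<^sup>2 \<le> K * (dist x x0)\<^sup>2"
        using pos by (intro mult_right_mono) auto
      ultimately show ?thesis by linarith
    qed
    then show ?thesis
      using subsolution_onD[OF sub x0] int xT by (simp add: open_quadrant_def mem_Times_iff)
  qed
  moreover have "- \<eta> \<le> fst q \<and> - \<eta> \<le> snd q \<and> (\<sigma> y0)\<^sup>2 \<le> hamiltonian \<mu> y0 (q + (\<eta>, \<eta>))"
  proof -
    have "v y \<ge> v y0 + q \<bullet> (y - y0) - K * (dist y y0)\<^sup>2" if "y \<in> Y" for y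
    proof -
      have a: "v y \<ge> v y0 + \<epsilon> * (fst y0 + snd y0) - \<epsilon> * (fst y + snd y) + C * P
          - C * ((max (fst y - T) 0)\<^sup>2 + (max (snd y - T) 0)\<^sup>2) - \<alpha> * (dist x0 y)\<^sup>2 + \<alpha> * (dist x0 y0)\<^sup>2"
        using max[OF x0 that] by (simp add: doubled_def P_def)
      have "(max (fst y - T) 0)\<^sup>2 \<le> (max (fst y0 - T) 0)\<^sup>2
          + 2 * max (fst y0 - T) 0 * (fst y - fst y0) + (fst y - fst y0)\<^sup>2"
        "(max (snd y - T) 0)\<^sup>2 \<le> (max (snd y0 - T) 0)\<^sup>2
          + 2 * max (snd y0 - T) 0 * (snd y - snd y0) + (snd y - snd y0)\<^sup>2"
        using pos_part_quadratic[of "fst y0 - T" "fst y - fst y0"]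
          pos_part_quadratic[of "snd y0 - T" "snd y - snd y0"] by simp_all
      then have "(max (fst y - T) 0)\<^sup>2 + (max (snd y - T) 0)\<^sup>2 \<le> P + (2 * max (fst y0 - T) 0 * (fst y - fst y0)
          + 2 * max (snd y0 - T) 0 * (snd y - snd y0) + (dist y y0)\<^sup>2)"
        by (simp add: P_def dist_sq_prod)
      then have "C * ((max (fst y - T) 0)\<^sup>2 + (max (snd y - T) 0)\<^sup>2) \<le> C * (P + (2 * max (fst y0 - T) 0 * (fst y - fst y0)
          + 2 * max (snd y0 - T) 0 * (snd y - snd y0) + (dist y y0)\<^sup>2))"
        using pos by (intro mult_left_mono) auto
      moreover have "- \<alpha> * (dist x0 y)\<^sup>2 + \<alpha> * (dist x0 y0)\<^sup>2 = p \<bullet> (y - y0) - \<alpha> * (dist y y0)\<^sup>2"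
        unfolding dist_sq_prod p_def inner_prod_def by (simp add: power2_eq_square algebra_simps)
      moreover have "(\<alpha> + C) * (dist y y0)\<^sup>2 \<le> K * (dist y y0)\<^sup>2"
        using pos by (intro mult_right_mono) auto
      ultimately show ?thesis using a
        by (simp add: q_def c1_def c2_def inner_prod_def algebra_simps)
    qed
    then show ?thesis
      using supersolution_onD[OF super y0, of q] int yT by (simp add: open_quadrant_def mem_Times_iff)
  qed
  moreover have "fst q \<le> fst p - \<epsilon>" "snd q \<le> snd p - \<epsilon>"
    using pos by (auto simp: q_def c1_def c2_def)
  moreover have "\<sigma> y0 = 0 \<Longrightarrow> \<mu> y0 = 0" using zero int by auto
  ultimately have H: "hamiltonian \<mu> x0 (p - (\<eta>, \<eta>)) \<le> (\<sigma> x0)\<^sup>2"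
      "(\<sigma> y0)\<^sup>2 + \<epsilon>\<^sup>2 \<le> hamiltonian \<mu> y0 (p + (\<eta>, \<eta>))"
    using hamiltonian_strict[of q p \<epsilon> \<eta> \<sigma> y0 \<mu>] pos by auto
  have xyq: "x0 \<in> quadrant" "y0 \<in> quadrant" using int by (auto simp: open_quadrant_def quadrant_def)
  have l1: "\<bar>\<mu> x0 - \<mu> y0\<bar> \<le> L * D" and l2: "\<bar>(\<sigma> x0)\<^sup>2 - (\<sigma> y0)\<^sup>2\<bar> \<le> L' * D"
    using lipschitz_onD[OF lip(1) xyq] lipschitz_onD[OF lip(2) xyq] by (auto simp: dist_real_def D_def)
  have pD: "\<bar>fst p\<bar> \<le> 2 * \<alpha> * D" "\<bar>snd p\<bar> \<le> 2 * \<alpha> * D"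
    using coord_le_dist[of x0 y0] pos by (auto simp: p_def D_def abs_mult)
  have "\<epsilon>\<^sup>2 \<le> (\<sigma> x0)\<^sup>2 - (\<sigma> y0)\<^sup>2 + (2 * \<eta> + L * D) * (\<bar>fst p\<bar> + \<bar>snd p\<bar> + \<eta>)"
    using H hamiltonian_diff[of \<mu> x0 y0 \<eta> "L * D" p] l1 \<mu> xyq pos by auto
  also have "\<dots> \<le> L' * D + (2 * \<eta> + L * D) * (4 * \<alpha> * D + \<eta>)"
  proof (intro add_mono mult_left_mono)
    show "(\<sigma> x0)\<^sup>2 - (\<sigma> y0)\<^sup>2 \<le> L' * D" using l2 by linarith
    show "\<bar>fst p\<bar> + \<bar>snd p\<bar> \<le> 4 * \<alpha> * D" using pD by linarith
    have "0 \<le> L * D" using L \<open>0 \<le> D\<close> by (intro mult_nonneg_nonneg)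
    then show "0 \<le> 2 * \<eta> + L * D" using \<open>0 \<le> \<eta>\<close> by linarith
  qed (rule order_refl)
  also have "\<dots> = L' * D + 4 * L * (\<alpha> * D\<^sup>2) + \<eta> * (8 * \<alpha> * D + 2 * \<eta> + L * D)"
    by (simp add: algebra_simps power2_eq_square)
  also have "\<dots> \<le> L' * s + 4 * L * s + \<eta> * (8 * A * 1 + 2 * 1 + L * 1)"
  proof -
    have "s\<^sup>2 \<le> s" using small(2) pos by (simp add: power2_eq_square mult_left_le)
    then have "\<alpha> * D\<^sup>2 \<le> s" using small(1) by (simp add: D_def)
    then have "4 * L * (\<alpha> * D\<^sup>2) \<le> 4 * L * s" using L by (intro mult_left_mono) auto
    moreover have "L' * D \<le> L' * s" using Ds L by (intro mult_left_mono) auto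
    moreover have "D \<le> 1" using Ds small by simp
    then have "8 * \<alpha> * D \<le> 8 * A * 1" using pos \<open>0 \<le> D\<close> by (intro mult_mono) auto
    moreover have "L * D \<le> L * 1" using L \<open>D \<le> 1\<close> by (intro mult_left_mono) auto
    ultimately have e1: "8 * \<alpha> * D + 2 * \<eta> + L * D \<le> 8 * A * 1 + 2 * 1 + L * 1"
        and e2: "L' * D + 4 * L * (\<alpha> * D\<^sup>2) \<le> L' * s + 4 * L * s"
      using \<open>\<eta> \<le> 1\<close> by linarith+
    show ?thesis by (rule add_mono[OF e2 mult_left_mono[OF e1 \<open>0 \<le> \<eta>\<close>]])
  qed
  also have "\<dots> \<le> (L' + 4 * L) * s + \<eta> * (8 * A + 4 + 2 * L)"
  proof -
    have "\<eta> * (8 * A * 1 + 2 * 1 + L * 1) \<le> \<eta> * (8 * A + 4 + 2 * L)"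
      using \<open>0 \<le> \<eta>\<close> L by (intro mult_left_mono) linarith+
    then show ?thesis by (simp add: distrib_right)
  qed
  also have "\<dots> \<le> \<epsilon>\<^sup>2 / 4 + \<epsilon>\<^sup>2 / 4" using small by (intro add_mono) auto
  also have "\<dots> < \<epsilon>\<^sup>2" using pos by simp
  finally show False by simp
qed

text \<open>The maxima \<open>m n\<close> of the doubled function for \<open>\<alpha> = 2\<^sup>n\<close> satisfy
\<open>m (n + 1) \<le> m n - 2\<^sup>n d\<close>, where \<open>d\<close> is the squared distance of the maximising pair for \<open>2\<^sup>n\<^sup>+\<^sup>1\<close>.
Since \<open>m 0 \<le> C\<close> and \<open>N\<close> is large, either \<open>m N \<le> 0\<close> or some pair satisfies
\<open>\<alpha> d \<le> s\<^sup>2\<close>; in the latter case the preceding lemma bounds \<open>m (n + 1)\<close>, hence \<open>m N\<close>. The constants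
depend on \<open>u\<close> and \<open>v\<close> only through \<open>C\<close>, hence they are uniform in the mesh size on grids.\<close>

lemma doubling_estimate:
  assumes lip: "L-lipschitz_on quadrant \<mu>" "L'-lipschitz_on quadrant (\<lambda>x. (\<sigma> x)\<^sup>2)"
    and \<mu>: "\<forall>x\<in>quadrant. 0 \<le> \<mu> x"
    and zero: "\<forall>x\<in>open_quadrant. \<sigma> x = 0 \<longrightarrow> \<mu> x = 0"
    and pos: "0 \<le> T" "0 < C" "0 < \<epsilon>" "0 \<le> \<delta>" "0 \<le> \<eta>" "2 ^ N + C \<le> K" "0 < s"
    and XY: "X \<subseteq> square (T + 2)" "Y \<subseteq> square (T + 2)" "compact X" "compact Y"
    and cont: "continuous_on X u" "continuous_on Y v"
    and uv: "\<And>x y. x \<in> X \<Longrightarrow> y \<in> Y \<Longrightarrow> u x - v y \<le> C"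
    and sub: "subsolution_on \<mu> \<sigma> (T + 2) K \<eta> X u"
    and super: "supersolution_on \<mu> \<sigma> (T + 2) K \<eta> Y v"
    and bdry: "\<And>x y. x \<in> X \<Longrightarrow> y \<in> Y \<Longrightarrow> dist x y \<le> s \<Longrightarrow>
       x \<in> quadrant_boundary \<or> y \<in> quadrant_boundary \<Longrightarrow> u x - v y \<le> \<delta>"
    and small: "2 * C \<le> real N * s\<^sup>2" "s \<le> 1" "(L' + 4 * L) * s \<le> \<epsilon>\<^sup>2 / 4"
      "\<eta> \<le> 1" "\<eta> * (8 * 2 ^ N + 4 + 2 * L) \<le> \<epsilon>\<^sup>2 / 4"
    and xy: "x \<in> X" "y \<in> Y" "y \<in> square T"
  shows "u x - v y \<le> \<delta> + 2 * \<epsilon> * T + 2 ^ N * (dist x y)\<^sup>2"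
proof -
  define F where "F n w = doubled \<epsilon> C T u v (2 ^ n) (fst w) (snd w)" for n w
  have "\<exists>z\<in>X \<times> Y. \<forall>w\<in>X \<times> Y. F n w \<le> F n z" for n
  proof (rule continuous_attains_sup)
    show "compact (X \<times> Y)" using XY by (intro compact_Times)
    show "X \<times> Y \<noteq> {}" using xy by auto
    have "continuous_on (X \<times> Y) (\<lambda>w. u (fst w))" "continuous_on (X \<times> Y) (\<lambda>w. v (snd w))"
      by (auto intro!: continuous_on_compose2[OF cont(1)] continuous_on_compose2[OF cont(2)] continuous_intros)
    then show "continuous_on (X \<times> Y) (F n)"
      unfolding F_def doubled_def by (intro continuous_intros)
  qed
  then obtain z where z: "\<And>n. z n \<in> X \<times> Y" "\<And>n w. w \<in> X \<times> Y \<Longrightarrow> F n w \<le> F n (z n)"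
    by metis
  define d where "d n = (dist (fst (z n)) (snd (z n)))\<^sup>2" for n
  define m where "m n = F n (z n)" for n
  have step: "m (Suc n) \<le> m n - 2 ^ n * d (Suc n)" for n
    using z(2)[OF z(1)[of "Suc n"], of n] by (simp add: m_def F_def doubled_def d_def)
  have m0: "m 0 \<le> C"
  proof -
    have "snd (z 0) \<in> square (T + 2)" "fst (z 0) \<in> X" "snd (z 0) \<in> Y" using z(1)[of 0] XY by auto
    then have "0 \<le> \<epsilon> * (fst (snd (z 0)) + snd (snd (z 0)))"
      "u (fst (z 0)) - v (snd (z 0)) \<le> C"
      using pos uv by (auto simp: square_def)
    moreover have "0 \<le> C * ((max (fst (snd (z 0)) - T) 0)\<^sup>2 + (max (snd (snd (z 0)) - T) 0)\<^sup>2)"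
      using pos by auto
    moreover have "0 \<le> (dist (fst (z 0)) (snd (z 0)))\<^sup>2" by simp
    ultimately show ?thesis unfolding m_def F_def doubled_def power_0 by linarith
  qed
  have d0: "0 \<le> d n" for n by (simp add: d_def)
  have anti: "m (Suc n) \<le> m n" for n
    using step[of n] d0[of "Suc n"] by (smt (verit) mult_nonneg_nonneg zero_le_power)
  have "m N \<le> \<delta>"
  proof (cases "\<exists>n<N. 2 ^ Suc n * d (Suc n) \<le> s\<^sup>2")
    case True
    then obtain n where n: "n < N" "2 ^ Suc n * d (Suc n) \<le> s\<^sup>2" by blast
    have le: "(2::real) ^ Suc n \<le> 2 ^ N" using n by (intro power_increasing) auto
    have "m (Suc n) \<le> \<delta>"
      unfolding m_def F_def
    proof (rule doubled_maximum_le[OF lip \<mu> zero, where A = "2 ^ N" and K = K and s = s and X = X and Y = Y and \<eta> = \<eta>])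
      show "(1::real) \<le> 2 ^ Suc n" by (rule one_le_power) simp
      show "2 ^ Suc n + C \<le> K" using le pos by linarith
      show "fst (z (Suc n)) \<in> X" "snd (z (Suc n)) \<in> Y" using z(1)[of "Suc n"] by auto
      show "doubled \<epsilon> C T u v (2 ^ Suc n) x y
        \<le> doubled \<epsilon> C T u v (2 ^ Suc n) (fst (z (Suc n))) (snd (z (Suc n)))" if "x \<in> X" "y \<in> Y" for x y
        using z(2)[of "(x, y)" "Suc n"] that by (simp add: F_def)
      show "2 ^ Suc n * (dist (fst (z (Suc n))) (snd (z (Suc n))))\<^sup>2 \<le> s\<^sup>2" using n by (simp add: d_def)
    qed (fact pos XY sub super small le | (rule uv; assumption) | (rule bdry; assumption))+
    moreover have "m N \<le> m (Suc n)" by (rule lift_Suc_antimono_le[of m, OF anti]) (use n(1) in simp)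
    ultimately show ?thesis by simp
  next
    case False
    have "m n \<le> C - real n * s\<^sup>2 / 2" if "n \<le> N" for n
      using that
    proof (induction n)
      case 0 then show ?case using m0 by simp
    next
      case (Suc n)
      then have "s\<^sup>2 < 2 * (2 ^ n * d (Suc n))" using False by (auto simp: not_le mult.assoc)
      then show ?case using Suc step[of n] by (simp add: field_simps)
    qed
    from this[of N] show ?thesis using small(1) pos by (simp add: field_simps)
  qed
  moreover have "F N (x, y) \<le> m N" using z(2)[of "(x, y)" N] xy by (simp add: m_def)
  moreover have "\<epsilon> * (fst y + snd y) \<le> \<epsilon> * (2 * T)"
    using xy pos by (intro mult_left_mono) (auto simp: square_def)
  moreover have "max (fst y - T) 0 = 0" "max (snd y - T) 0 = 0" using xy by (auto simp: square_def)
  ultimately show ?thesis by (simp add: F_def doubled_def)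
qed

text \<open>The tilt \<open>e\<close> comes first, as it limits the final error; the strictness \<open>e\<^sup>2\<close> gained from it
determines the distance \<open>s\<close> allowed between the maximising points, and \<open>s\<close> the number \<open>N\<close> of doublings.\<close>

lemma doubling_constants:
  fixes L L' C T \<epsilon> \<rho> :: real
  assumes L_nonneg: "0 \<le> L" "0 \<le> L'" and T: "0 \<le> T" and C: "0 < C" and \<epsilon>: "0 < \<epsilon>" and \<rho>: "0 < \<rho>"
  obtains e s N where "0 < e" "2 * e * T \<le> \<epsilon> / 2" "0 < s" "s \<le> 1" "s \<le> \<rho>"
    "(L' + 4 * L) * s \<le> e\<^sup>2 / 4" "2 * C \<le> real N * s\<^sup>2"
proof -
  define e where "e = \<epsilon> / (4 * (T + 1))"
  have e: "0 < e" "2 * e * T \<le> \<epsilon> / 2" using T \<epsilon> by (auto simp: e_def field_simps)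
  define s where "s = min 1 (min \<rho> (e\<^sup>2 / (4 * (L' + 4 * L + 1))))"
  have LL: "0 < L' + 4 * L + 1" using L_nonneg by linarith
  have s: "0 < s" "s \<le> 1" "s \<le> \<rho>" "s \<le> e\<^sup>2 / (4 * (L' + 4 * L + 1))"
    using \<rho> e(1) LL by (simp_all add: s_def)
  have "(L' + 4 * L) * s \<le> (L' + 4 * L + 1) * s" using s(1) by (intro mult_right_mono) linarith+
  also have "\<dots> \<le> (L' + 4 * L + 1) * (e\<^sup>2 / (4 * (L' + 4 * L + 1)))" by (rule mult_left_mono[OF s(4) less_imp_le[OF LL]])
  also have "\<dots> = e\<^sup>2 / 4"
  proof -
    have "x * (y / (4 * x)) = y / 4" if "x \<noteq> 0" for x y :: real using that by simp
    from this[OF less_imp_neq[OF LL, symmetric]] show ?thesis .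
  qed
  finally have sL: "(L' + 4 * L) * s \<le> e\<^sup>2 / 4" .
  obtain N :: nat where "2 * C / s\<^sup>2 \<le> real N" using real_arch_simple by blast
  then have N: "2 * C \<le> real N * s\<^sup>2" using s by (simp add: field_simps)
  show thesis by (rule that[OF e s(1-3) sL N])
qed

section \<open>Viscosity solutions and quadratic tests\<close>

lemma finite_locally_finite_compact:
  assumes "locally_finite_set D" "compact K"
  shows "finite (D \<inter> K)"
proof (rule ccontr)
  assume "infinite (D \<inter> K)"
  then obtain x where x: "x islimpt (D \<inter> K)"
    using \<open>compact K\<close> unfolding compact_eq_Bolzano_Weierstrass by (meson Int_lower2)
  obtain r where "0 < r" "finite (D \<inter> ball x r)"
    using assms(1) unfolding locally_finite_set_def by blast
  moreover have "infinite (D \<inter> K \<inter> ball x r)" using x \<open>0 < r\<close> by (simp add: islimpt_eq_infinite_ball)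
  ultimately show False by (meson Int_lower1 Int_mono finite_subset order_refl)
qed

lemma compact_square: "compact (square R)"
  by (simp add: square_def compact_Times)

lemma square_subset_quadrant: "square R \<subseteq> quadrant"
  by (auto simp: square_def quadrant_def)

lemma quadratic_in_small_o: "(\<lambda>y. \<kappa> * (dist y x)\<^sup>2) \<in> o[at x](\<lambda>y. norm (x - y))"
  for x :: "'a::real_inner"
proof (rule landau_o.smallI)
  fix c :: real assume c: "0 < c"
  have "\<forall>\<^sub>F y in at x. dist y x < c / (\<bar>\<kappa>\<bar> + 1)"
    using c by (auto simp: eventually_at intro!: exI[of _ "c / (\<bar>\<kappa>\<bar> + 1)"])
  then show "\<forall>\<^sub>F y in at x. norm (\<kappa> * (dist y x)\<^sup>2) \<le> c * norm (norm (x - y))"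
  proof eventually_elim
    case (elim y)
    have "\<bar>\<kappa>\<bar> * dist y x \<le> (\<bar>\<kappa>\<bar> + 1) * dist y x" by (simp add: mult_right_mono)
    also have "\<dots> \<le> c" using elim by (simp add: field_simps)
    finally have "\<bar>\<kappa>\<bar> * dist y x * dist y x \<le> c * dist y x" by (intro mult_right_mono) auto
    then show ?case by (simp add: power2_eq_square abs_mult dist_norm norm_minus_commute mult.assoc)
  qed
qed

lemma eventually_in_square:
  assumes "0 < fst x" "fst x < R" "0 < snd x" "snd x < R"
  shows "\<forall>\<^sub>F y in at x. y \<in> square R"
proof -
  have "open ({0<..<R} \<times> {0<..<R})" by (intro open_Times) auto
  then have "\<forall>\<^sub>F y in at x. y \<in> {0<..<R} \<times> {0<..<R}"
    using assms by (intro eventually_at_in_open') (auto simp: mem_Times_iff)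
  then show ?thesis by eventually_elim (auto simp: square_def)
qed

lemma viscosity_subsolution_on:
  assumes "viscosity_solution \<mu> \<sigma> u"
  shows "subsolution_on \<mu> \<sigma> R \<kappa> 0 (square R) u"
  unfolding subsolution_on_def
proof (intro ballI allI impI, elim conjE)
  fix x p
  assume x: "0 < fst x" "fst x < R" "0 < snd x" "snd x < R"
    and test: "\<forall>y\<in>square R. u y \<le> u x + p \<bullet> (y - x) + \<kappa> * (dist y x)\<^sup>2"
  have "\<forall>\<^sub>F y in at x. u y \<le> u x + p \<bullet> (y - x) + \<kappa> * (dist y x)\<^sup>2"
    using eventually_in_square[OF x] by eventually_elim (use test in blast)
  then have "p \<in> superdifferential u x"
    unfolding superdifferential_def mem_Collect_eq
    by (intro exI[of _ "\<lambda>y. \<kappa> * (dist y x)\<^sup>2"] conjI quadratic_in_small_o)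
  moreover have "x \<in> open_quadrant" using x by (simp add: open_quadrant_def mem_Times_iff)
  ultimately show "hamiltonian \<mu> x (p - (0, 0)) \<le> (\<sigma> x)\<^sup>2"
    using assms by (simp add: viscosity_solution_def flip: zero_prod_def)
qed

text \<open>Going backwards from \<open>x\<close> along an axis, monotonicity bounds \<open>u\<close> from above by \<open>u x\<close> and the
test bounds it from below, which forces both components of \<open>p\<close> to be nonnegative.\<close>

lemma viscosity_supersolution_on:
  assumes visc: "viscosity_solution \<mu> \<sigma> u" and mono: "monotone_on_quadrant u" and \<kappa>: "0 \<le> \<kappa>"
  shows "supersolution_on \<mu> \<sigma> R \<kappa> 0 (square R) u"
  unfolding supersolution_on_def
proof (intro ballI allI impI, elim conjE)
  fix x p
  assume x: "0 < fst x" "fst x < R" "0 < snd x" "snd x < R"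
    and test: "\<forall>y\<in>square R. u y \<ge> u x + p \<bullet> (y - x) - \<kappa> * (dist y x)\<^sup>2"
  have "\<forall>\<^sub>F y in at x. u y \<ge> u x + p \<bullet> (y - x) + (- \<kappa>) * (dist y x)\<^sup>2"
    using eventually_in_square[OF x] by eventually_elim (use test in auto)
  then have "p \<in> subdifferential u x"
    unfolding subdifferential_def mem_Collect_eq
    by (intro exI[of _ "\<lambda>y. - \<kappa> * (dist y x)\<^sup>2"] conjI quadratic_in_small_o)
  moreover have "x \<in> open_quadrant" using x by (simp add: open_quadrant_def mem_Times_iff)
  ultimately have H: "(\<sigma> x)\<^sup>2 \<le> hamiltonian \<mu> x (p + (0, 0))"
    using visc by (simp add: viscosity_solution_def flip: zero_prod_def)
  have nonneg: "0 \<le> q" if d: "0 < d" and q: "\<And>t. 0 < t \<Longrightarrow> t \<le> d \<Longrightarrow> 0 \<le> t * q + \<kappa> * t\<^sup>2" for q d :: real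
  proof (rule ccontr)
    assume "\<not> 0 \<le> q"
    define t where "t = min d (- q / (2 * (\<kappa> + 1)))"
    have k: "0 < 2 * (\<kappa> + 1)" using \<kappa> by simp
    have "0 < - q / (2 * (\<kappa> + 1))" using \<open>\<not> 0 \<le> q\<close> by (intro divide_pos_pos k) simp
    then have t: "0 < t" "t \<le> d" "t \<le> - q / (2 * (\<kappa> + 1))"
      using d by (simp_all only: t_def min_less_iff_conj min.cobounded1 min.cobounded2 simp_thms)
    have "0 \<le> t * (q + \<kappa> * t)" using q[OF t(1,2)] by (simp add: power2_eq_square algebra_simps)
    then have "0 \<le> q + \<kappa> * t" using t(1) by (simp add: zero_le_mult_iff)
    moreover have "t * (2 * (\<kappa> + 1)) \<le> - q" using t(3) unfolding pos_le_divide_eq[OF k] .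
    then have "2 * (\<kappa> * t) + 2 * t \<le> - q" by (simp add: algebra_simps)
    ultimately show False using t(1) \<open>\<not> 0 \<le> q\<close> by linarith
  qed
  have "0 \<le> fst p"
  proof (rule nonneg[OF x(1)])
    fix t assume t: "0 < t" "t \<le> fst x"
    define y where "y = (fst x - t, snd x)"
    have "u (fst x - t, snd x) \<le> u (fst x, snd x)"
    proof (rule mono_onD[of "{0..}" "\<lambda>a. u (a, snd x)"])
      show "mono_on {0..} (\<lambda>a. u (a, snd x))"
        using mono x(3) unfolding monotone_on_quadrant_def by (meson less_imp_le)
    qed (use x t in simp_all)
    then have "u y \<le> u x" by (simp add: y_def)
    moreover have "y \<in> square R" using x t by (simp add: y_def square_def)
    then have "u y \<ge> u x + p \<bullet> (y - x) - \<kappa> * (dist y x)\<^sup>2" using test by blast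
    moreover have "p \<bullet> (y - x) = - (t * fst p)" by (simp add: y_def inner_prod_def)
    moreover have "(dist y x)\<^sup>2 = t\<^sup>2" by (simp add: y_def dist_sq_prod)
    ultimately show "0 \<le> t * fst p + \<kappa> * t\<^sup>2" by simp
  qed
  moreover have "0 \<le> snd p"
  proof (rule nonneg[OF x(3)])
    fix t assume t: "0 < t" "t \<le> snd x"
    define y where "y = (fst x, snd x - t)"
    have "u (fst x, snd x - t) \<le> u (fst x, snd x)"
    proof (rule mono_onD[of "{0..}" "\<lambda>b. u (fst x, b)"])
      show "mono_on {0..} (\<lambda>b. u (fst x, b))"
        using mono x(1) unfolding monotone_on_quadrant_def by (meson less_imp_le)
    qed (use x t in simp_all)
    then have "u y \<le> u x" by (simp add: y_def)
    moreover have "y \<in> square R" using x t by (simp add: y_def square_def)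
    then have "u y \<ge> u x + p \<bullet> (y - x) - \<kappa> * (dist y x)\<^sup>2" using test by blast
    moreover have "p \<bullet> (y - x) = - (t * snd p)" by (simp add: y_def inner_prod_def)
    moreover have "(dist y x)\<^sup>2 = t\<^sup>2" by (simp add: y_def dist_sq_prod)
    ultimately show "0 \<le> t * snd p + \<kappa> * t\<^sup>2" by simp
  qed
  ultimately show "- 0 \<le> fst p \<and> - 0 \<le> snd p \<and> (\<sigma> x)\<^sup>2 \<le> hamiltonian \<mu> x (p + (0, 0))"
    using H by simp
qed

section \<open>One step of the recursion\<close>

lemma scheme_neg: "i < 0 \<or> j < 0 \<Longrightarrow> scheme \<mu> \<mu>\<^sub>s \<sigma> h i j = 0"
  by (subst scheme.simps) auto

lemma root_properties:
  fixes a b m c :: real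
  defines "r \<equiv> (a + b) / 2 + m + sqrt ((a - b)\<^sup>2 + 4 * c\<^sup>2) / 2"
  shows "a + m \<le> r" "b + m \<le> r" "(r - a - m) * (r - b - m) = c\<^sup>2"
proof -
  define s where "s = sqrt ((a - b)\<^sup>2 + 4 * c\<^sup>2)"
  have s2: "s\<^sup>2 = (a - b)\<^sup>2 + 4 * c\<^sup>2" by (simp add: s_def)
  have "\<bar>a - b\<bar> \<le> s" unfolding s_def by (rule real_le_rsqrt) simp
  then show "a + m \<le> r" "b + m \<le> r" unfolding r_def s_def[symmetric] by (auto simp: field_simps)
  have "(r - a - m) * (r - b - m) = (s\<^sup>2 - (a - b)\<^sup>2) / 4"
    unfolding r_def s_def[symmetric] by (simp add: field_simps power2_eq_square)
  then show "(r - a - m) * (r - b - m) = c\<^sup>2" by (simp add: s2)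
qed

lemma scheme_step:
  fixes i j :: int and h :: real and \<mu> \<mu>\<^sub>s \<sigma> :: "real \<times> real \<Rightarrow> real"
  assumes "0 \<le> i" "0 \<le> j"
  defines "m \<equiv> h * (\<mu> (h * of_int i, h * of_int j) + boundary_ext \<mu>\<^sub>s (h * of_int i, h * of_int j))"
  defines "U \<equiv> scheme \<mu> \<mu>\<^sub>s \<sigma> h"
  shows "U (i - 1) j + m \<le> U i j" "U i (j - 1) + m \<le> U i j"
    "(U i j - U (i - 1) j - m) * (U i j - U i (j - 1) - m) = h\<^sup>2 * (\<sigma> (h * of_int i, h * of_int j))\<^sup>2"
proof -
  have eq: "U i j = (U (i - 1) j + U i (j - 1)) / 2 + m
      + sqrt ((U (i - 1) j - U i (j - 1))\<^sup>2 + 4 * (h * \<sigma> (h * of_int i, h * of_int j))\<^sup>2) / 2"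
    unfolding U_def m_def using assms(1,2) by (subst scheme.simps) (simp add: power_mult_distrib)
  show "U (i - 1) j + m \<le> U i j" "U i (j - 1) + m \<le> U i j"
    "(U i j - U (i - 1) j - m) * (U i j - U i (j - 1) - m) = h\<^sup>2 * (\<sigma> (h * of_int i, h * of_int j))\<^sup>2"
    unfolding eq power_mult_distrib[of h, symmetric] by (rule root_properties)+
qed

section \<open>Discrete comparison and barriers near an axis\<close>

lemma discrete_comparison_step:
  fixes u w :: real
  assumes "a \<le> a'" "b \<le> b'" "0 \<le> u - a - m" "0 \<le> u - b - m" "(u - a - m) * (u - b - m) \<le> c"
    "0 \<le> w - a' - m" "0 \<le> w - b' - m" "c \<le> (w - a' - m) * (w - b' - m)"
  shows "u \<le> w"
proof (rule ccontr)
  assume "\<not> u \<le> w"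
  then have "(w - a' - m) * (w - b' - m) < (u - a - m) * (u - b - m)"
    using assms by (intro mult_strict_mono') auto
  then show False using assms by linarith
qed

text \<open>As long as both increments are at least \<open>m\<close>, the product of their excesses is increasing
in the new value and decreasing in the two old ones, so the order passes from the predecessors of a
point to the point.\<close>

lemma discrete_comparison:
  fixes u w :: "nat \<Rightarrow> nat \<Rightarrow> real"
  assumes u: "\<And>i j. i < I \<Longrightarrow> j < J \<Longrightarrow> 0 \<le> u (Suc i) (Suc j) - u i (Suc j) - m i j \<and>
      0 \<le> u (Suc i) (Suc j) - u (Suc i) j - m i j \<and>
      (u (Suc i) (Suc j) - u i (Suc j) - m i j) * (u (Suc i) (Suc j) - u (Suc i) j - m i j) \<le> c i j"
    and w: "\<And>i j. i < I \<Longrightarrow> j < J \<Longrightarrow> 0 \<le> w (Suc i) (Suc j) - w i (Suc j) - m i j \<and>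
      0 \<le> w (Suc i) (Suc j) - w (Suc i) j - m i j \<and>
      c i j \<le> (w (Suc i) (Suc j) - w i (Suc j) - m i j) * (w (Suc i) (Suc j) - w (Suc i) j - m i j)"
    and bd: "\<And>i. i \<le> I \<Longrightarrow> u i 0 \<le> w i 0" "\<And>j. j \<le> J \<Longrightarrow> u 0 j \<le> w 0 j"
  shows "i \<le> I \<Longrightarrow> j \<le> J \<Longrightarrow> u i j \<le> w i j"
proof (induction j arbitrary: i)
  case 0 then show ?case using bd by simp
next
  case (Suc j)
  note outer = Suc
  show ?case using outer(2)
  proof (induction i)
    case 0 then show ?case using bd outer by simp
  next
    case (Suc i)
    have 1: "u i (Suc j) \<le> w i (Suc j)" by (rule Suc.IH) (use Suc.prems in simp)
    have 2: "u (Suc i) j \<le> w (Suc i) j" by (rule outer(1)) (use Suc.prems outer(3) in simp_all)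
    have "i < I" "j < J" using Suc.prems outer(3) by simp_all
    note uw = u[OF this] w[OF this]
    show ?case
      by (rule discrete_comparison_step[OF 1 2, where m = "m i j" and c = "c i j"]) (use uw in blast)+
  qed
qed

text \<open>The barrier has slope \<open>\<theta> + a\<close> along the axis and slope \<open>b\<close> across it. The first increment
exceeds \<open>h m\<close> by at least \<open>h a\<close>, the second by at least \<open>h M\<^sup>2 / a\<close>, so their product is at least \<open>h\<^sup>2 M\<^sup>2\<close>. A small \<open>a\<close>
makes the slope along the axis nearly optimal at the price of a steep slope across it.\<close>

lemma axis_barrier:
  fixes u m :: "nat \<Rightarrow> nat \<Rightarrow> real"
  assumes h: "0 < h" and a: "0 < a" and M: "0 \<le> M" and lam: "0 \<le> \<theta>"
    and b: "M + M\<^sup>2 / a \<le> b"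
    and u: "\<And>i j. i < I \<Longrightarrow> j < J \<Longrightarrow> 0 \<le> u (Suc i) (Suc j) - u i (Suc j) - h * m (Suc i) (Suc j) \<and>
      0 \<le> u (Suc i) (Suc j) - u (Suc i) j - h * m (Suc i) (Suc j) \<and>
      (u (Suc i) (Suc j) - u i (Suc j) - h * m (Suc i) (Suc j)) * (u (Suc i) (Suc j) - u (Suc i) j - h * m (Suc i) (Suc j)) \<le> h\<^sup>2 * M\<^sup>2"
    and m: "\<And>i j. i < I \<Longrightarrow> j < J \<Longrightarrow> m (Suc i) (Suc j) \<le> M \<and> m (Suc i) (Suc j) \<le> m (Suc i) 0 + \<theta>"
    and ax1: "\<And>i. i < I \<Longrightarrow> u i 0 + h * m (Suc i) 0 \<le> u (Suc i) 0"
    and ax2: "\<And>j. j \<le> J \<Longrightarrow> u 0 j \<le> u 0 0 + b * (h * real j)"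
    and ij: "i \<le> I" "j \<le> J"
  shows "u i j \<le> u i 0 + (\<theta> + a) * (h * real i) + b * (h * real j)"
proof -
  define w where "w i j = u i 0 + (\<theta> + a) * (h * real i) + b * (h * real j)" for i j :: nat
  have b0: "0 \<le> b" using b M a by (smt (verit) divide_nonneg_pos zero_le_power2)
  have "u i j \<le> w i j"
  proof (rule discrete_comparison[where m = "\<lambda>i j. h * m (Suc i) (Suc j)" and c = "\<lambda>_ _. h\<^sup>2 * M\<^sup>2", OF u _ _ _ ij])
    fix i j assume ij: "i < I" "j < J"
    define p where "p = w (Suc i) (Suc j) - w i (Suc j) - h * m (Suc i) (Suc j)"
    define q where "q = w (Suc i) (Suc j) - w (Suc i) j - h * m (Suc i) (Suc j)"
    have "h * m (Suc i) (Suc j) \<le> h * (m (Suc i) 0 + \<theta>)" using m[OF ij] h by (intro mult_left_mono) auto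
    moreover have "p = u (Suc i) 0 - u i 0 + (\<theta> + a) * h - h * m (Suc i) (Suc j)"
      by (simp add: p_def w_def algebra_simps)
    ultimately have p: "h * a \<le> p" using ax1[OF ij(1)] by (simp add: algebra_simps)
    have "h * m (Suc i) (Suc j) \<le> h * M" using m[OF ij] h by (intro mult_left_mono) auto
    moreover have "q = b * h - h * m (Suc i) (Suc j)"
      by (simp add: q_def w_def algebra_simps)
    moreover have "h * (M + M\<^sup>2 / a) \<le> h * b" using b h by (intro mult_left_mono) auto
    ultimately have q: "h * (M\<^sup>2 / a) \<le> q" by (simp add: algebra_simps)
    have ha: "0 \<le> h * a" "0 \<le> h * (M\<^sup>2 / a)" using h a by auto
    have "h\<^sup>2 * M\<^sup>2 = (h * a) * (h * (M\<^sup>2 / a))" using a by (simp add: power2_eq_square)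
    also have "\<dots> \<le> p * q" using p q ha by (intro mult_mono) auto
    finally show "0 \<le> w (Suc i) (Suc j) - w i (Suc j) - h * m (Suc i) (Suc j) \<and>
      0 \<le> w (Suc i) (Suc j) - w (Suc i) j - h * m (Suc i) (Suc j) \<and>
      h\<^sup>2 * M\<^sup>2 \<le> (w (Suc i) (Suc j) - w i (Suc j) - h * m (Suc i) (Suc j)) * (w (Suc i) (Suc j) - w (Suc i) j - h * m (Suc i) (Suc j))"
      using p q ha by (simp flip: p_def q_def)
  next
    fix i assume "i \<le> I"
    have "0 \<le> (\<theta> + a) * (h * real i)" using lam a h by simp
    then show "u i 0 \<le> w i 0" by (simp add: w_def)
  next
    fix j assume "j \<le> J"
    then show "u 0 j \<le> w 0 j" using ax2 by (simp add: w_def)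
  qed auto
  then show ?thesis by (simp add: w_def)
qed

section \<open>Convergence along an axis\<close>

text \<open>The excess \<open>E\<close> of \<open>a n\<close> over the sum satisfies \<open>E' (E' - E) \<le> c\<^sup>2\<close>, hence \<open>E'\<^sup>2 \<le> E\<^sup>2 + 2 c\<^sup>2\<close>. With \<open>c\<close> of
order \<open>h\<close> and about \<open>1 / h\<close> steps the excess is of order \<open>\<surd>h\<close>.\<close>

lemma axis_sum_estimate:
  fixes a m c :: "nat \<Rightarrow> real"
  assumes rec: "\<And>n. a n + m (Suc n) \<le> a (Suc n)"
      "\<And>n. (a (Suc n) - a n - m (Suc n)) * (a (Suc n) - m (Suc n)) = (c (Suc n))\<^sup>2"
    and init: "0 \<le> a 0 - m 0" "(a 0 - m 0)\<^sup>2 = (c 0)\<^sup>2" and m: "\<And>n. 0 \<le> m n"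
  shows "sum m {..n} \<le> a n" "(a n - sum m {..n})\<^sup>2 \<le> 2 * (\<Sum>k\<le>n. (c k)\<^sup>2)"
proof -
  have main: "sum m {..n} \<le> a n \<and> (a n - sum m {..n})\<^sup>2 \<le> 2 * (\<Sum>k\<le>n. (c k)\<^sup>2)" for n
  proof (induction n)
    case 0 then show ?case using init by simp
  next
    case (Suc n)
    define E E' where "E = a n - sum m {..n}" and "E' = a (Suc n) - sum m {..Suc n}"
    have d: "E' - E = a (Suc n) - a n - m (Suc n)" by (simp add: E_def E'_def)
    have le: "E' \<le> a (Suc n) - m (Suc n)" using m by (simp add: E'_def sum_nonneg)
    have d0: "0 \<le> E' - E" using d rec(1)[of n] by simp
    have "(E' - E) * E' \<le> (c (Suc n))\<^sup>2"
      using mult_left_mono[OF le d0] rec(2)[of n] d by simp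
    moreover have "E'\<^sup>2 \<le> E\<^sup>2 + 2 * ((E' - E) * E')"
      using zero_le_power2[of "E' - E"] by (simp add: power2_eq_square algebra_simps)
    ultimately have "E'\<^sup>2 \<le> E\<^sup>2 + 2 * (c (Suc n))\<^sup>2" by linarith
    then show ?case using Suc d0 unfolding E_def E'_def by (simp add: algebra_simps)
  qed
  then show "sum m {..n} \<le> a n" "(a n - sum m {..n})\<^sup>2 \<le> 2 * (\<Sum>k\<le>n. (c k)\<^sup>2)" by auto
qed

text \<open>The excess \<open>d\<close> of the step over \<open>m\<close> satisfies \<open>d\<^sup>2 \<le> c\<^sup>2\<close>, because the second factor of the product is
at least \<open>d\<close>. Unlike the preceding bound this one controls single increments and gives a Lipschitz
estimate along the axis.\<close>

lemma axis_increment: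
  fixes a m c :: "nat \<Rightarrow> real"
  assumes rec: "a n + m (Suc n) \<le> a (Suc n)"
      "(a (Suc n) - a n - m (Suc n)) * (a (Suc n) - m (Suc n)) = (c (Suc n))\<^sup>2"
    and "0 \<le> a n" "0 \<le> c (Suc n)"
  shows "a (Suc n) \<le> a n + m (Suc n) + c (Suc n)"
proof -
  define d where "d = a (Suc n) - a n - m (Suc n)"
  have "0 \<le> d" using rec by (simp add: d_def)
  then have "d * d \<le> d * (a (Suc n) - m (Suc n))"
    using assms by (intro mult_left_mono) (auto simp: d_def)
  then have "d\<^sup>2 \<le> (c (Suc n))\<^sup>2" using rec(2) by (simp add: d_def power2_eq_square)
  then have "d \<le> c (Suc n)" using assms(4) by (rule power2_le_imp_le)
  then show ?thesis by (simp add: d_def)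
qed

text \<open>The Riemann sum is the integral of the step function \<open>t \<mapsto> g (h \<lceil>t / h\<rceil>)\<close>, which converges to
\<open>g\<close> off the finite set \<open>D\<close>. By dominated convergence its \<open>L\<^sup>1\<close> distance to \<open>g\<close> on \<open>[0, R]\<close> tends to
zero, and this distance bounds the error for all upper limits \<open>h n \<le> R\<close> at once.\<close>

lemma riemann_sum_uniform:
  fixes g :: "real \<Rightarrow> real"
  assumes B: "\<And>t. \<bar>g t\<bar> \<le> B" and D: "finite D" "\<And>t. t \<notin> D \<Longrightarrow> isCont g t" and e: "0 < e"
  shows "\<forall>\<^sub>F h in at_right 0. \<forall>n::nat. h * real n \<le> R \<longrightarrow>
    \<bar>h * (\<Sum>k=1..n. g (h * real k)) - integral {0..h * real n} g\<bar> \<le> e"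
proof -
  define s where "s h t = g (h * of_int \<lceil>t / h\<rceil>)" for h t
  have B0: "0 \<le> B" using B[of 0] by linarith
  have [measurable]: "g \<in> borel_measurable borel"
    using D by (intro borel_measurable_continuous_countable_exceptions[of D])
      (auto simp: continuous_at_imp_continuous_on countable_finite)
  have [measurable]: "s h \<in> borel_measurable borel" for h
    unfolding s_def by measurable
  have int: "set_integrable lborel {a..b} f" if [measurable]: "f \<in> borel_measurable borel" and "\<And>t. \<bar>f t\<bar> \<le> c"
    for f :: "real \<Rightarrow> real" and a b c
    unfolding set_integrable_def
    by (rule integrableI_bounded_set_indicator[where B = c]) (use that in \<open>auto simp: emeasure_lborel_Icc_eq\<close>)
  have sB: "\<bar>s h t\<bar> \<le> B" for h t using B by (simp add: s_def)
  have sgB: "\<bar>\<bar>s h t - g t\<bar>\<bar> \<le> 2 * B" for h t using sB[of h t] B[of t] by linarith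
  have conv: "((\<lambda>h. s h t) \<longlongrightarrow> g t) (at_right 0)" if "t \<notin> D" for t
  proof -
    have "((\<lambda>h. h * of_int \<lceil>t / h\<rceil>) \<longlongrightarrow> t) (at_right 0)"
    proof (rule tendsto_sandwich)
      show "\<forall>\<^sub>F h in at_right 0. t \<le> h * of_int \<lceil>t / h\<rceil>"
        using eventually_at_right_less[of 0]
      proof eventually_elim
        case (elim h)
        have "h * (t / h) \<le> h * of_int \<lceil>t / h\<rceil>" using elim by (intro mult_left_mono) auto
        then show ?case using elim by simp
      qed
      show "\<forall>\<^sub>F h in at_right 0. h * of_int \<lceil>t / h\<rceil> \<le> t + h"
        using eventually_at_right_less[of 0]
      proof eventually_elim
        case (elim h)
        have "h * of_int \<lceil>t / h\<rceil> \<le> h * (t / h + 1)" using elim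
          by (intro mult_left_mono) linarith+
        then show ?case using elim by (simp add: distrib_left)
      qed
      show "((\<lambda>h. t + h) \<longlongrightarrow> t) (at_right 0)" by (auto intro!: tendsto_eq_intros)
    qed simp
    then show ?thesis unfolding s_def
      by (rule isCont_tendsto_compose[OF D(2)[OF that]])
  qed
  define I where "I h = (LINT t|lborel. indicator {0..R} t * \<bar>s h t - g t\<bar>)" for h
  have "((\<lambda>x. I (inverse x)) \<longlongrightarrow> (LINT t|(lborel :: real measure). 0)) at_top"
    unfolding I_def
  proof (rule integral_dominated_convergence_at_top[where w = "\<lambda>t. indicator {0..R} t * (2 * B)"])
    show "integrable lborel (\<lambda>t. indicator {0..R} t * (2 * B))"
      using int[of "\<lambda>_. 2 * B" "2 * B" 0 R] B0 by (simp add: set_integrable_def)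
    have "AE t in lborel. t \<notin> D"
      by (rule AE_not_in) (simp add: D finite_imp_null_set_lborel)
    then show "AE t in lborel. ((\<lambda>x. indicator {0..R} t * \<bar>s (inverse x) t - g t\<bar>) \<longlongrightarrow> 0) at_top"
    proof eventually_elim
      case (elim t)
      from conv[OF elim] have "((\<lambda>x. s (inverse x) t) \<longlongrightarrow> g t) at_top"
        by (simp add: filterlim_at_right_to_top)
      then have "((\<lambda>x. indicator {0..R} t * \<bar>s (inverse x) t - g t\<bar>) \<longlongrightarrow> indicator {0..R} t * \<bar>g t - g t\<bar>) at_top"
        by (intro tendsto_intros)
      then show ?case by simp
    qed
    show "\<forall>\<^sub>F x in at_top. AE t in lborel. norm (indicator {0..R} t * \<bar>s (inverse x) t - g t\<bar>) \<le> indicator {0..R} t * (2 * B)"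
      using sgB by (intro always_eventually allI AE_I2) (auto simp: indicator_def abs_mult)
  qed auto
  then have "(I \<longlongrightarrow> 0) (at_right 0)" by (simp add: filterlim_at_right_to_top)
  then have "\<forall>\<^sub>F h in at_right 0. I h < e" using e by (rule order_tendstoD)
  then show ?thesis using eventually_at_right_less[of 0]
  proof eventually_elim
    case (elim h)
    show ?case
    proof (intro allI impI)
      fix n :: nat assume n: "h * real n \<le> R"
      have hs: "(s h has_integral h * (\<Sum>k=1..n. g (h * real k))) {0..h * real n}"
      proof (induction n)
        case 0 show ?case using has_integral_refl(2)[of "s h" 0] by simp
      next
        case (Suc n)
        have le: "h * real n \<le> h * real (Suc n)" using elim by simp
        have "((\<lambda>_. g (h * real (Suc n))) has_integral h * g (h * real (Suc n))) {h * real n..h * real (Suc n)}"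
          using has_integral_const_real[of "g (h * real (Suc n))" "h * real n" "h * real (Suc n)"] elim
          by (simp add: algebra_simps)
        then have "(s h has_integral h * g (h * real (Suc n))) {h * real n..h * real (Suc n)}"
        proof (rule has_integral_spike_finite[of "{h * real n}", rotated 2])
          fix t assume t: "t \<in> {h * real n..h * real (Suc n)} - {h * real n}"
          have "\<lceil>t / h\<rceil> = int (Suc n)"
            by (rule ceiling_unique) (use t elim in \<open>auto simp: field_simps\<close>)
          then show "s h t = g (h * real (Suc n))" by (simp add: s_def)
        qed simp
        from has_integral_combine[OF _ le Suc this] show ?case
          using elim by (simp add: distrib_left)
      qed
      have ii: "set_integrable lborel {0..h * real n} (s h)" "set_integrable lborel {0..h * real n} g"
        using sB B by (auto intro!: int)
      have "h * (\<Sum>k=1..n. g (h * real k)) - integral {0..h * real n} g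
          = (LINT t:{0..h * real n}|lborel. s h t) - (LINT t:{0..h * real n}|lborel. g t)"
        using hs ii by (simp add: set_borel_integral_eq_integral integral_unique)
      also have "\<dots> = (LINT t:{0..h * real n}|lborel. s h t - g t)"
        by (rule set_integral_diff(2)[OF ii, symmetric])
      also have "\<bar>\<dots>\<bar> \<le> (LINT t|lborel. \<bar>indicator {0..h * real n} t *\<^sub>R (s h t - g t)\<bar>)"
        unfolding set_lebesgue_integral_def by (rule integral_abs_bound)
      also have "\<dots> \<le> I h"
        unfolding I_def
      proof (rule integral_mono)
        show "integrable lborel (\<lambda>t. \<bar>indicator {0..h * real n} t *\<^sub>R (s h t - g t)\<bar>)"
          using set_integral_diff(1)[OF ii] unfolding set_integrable_def by (rule integrable_abs)
        show "integrable lborel (\<lambda>t. indicator {0..R} t * \<bar>s h t - g t\<bar>)"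
          using int[of "\<lambda>t. \<bar>s h t - g t\<bar>" "2 * B" 0 R] sgB by (simp add: set_integrable_def)
        show "\<bar>indicator {0..h * real n} t *\<^sub>R (s h t - g t)\<bar> \<le> indicator {0..R} t * \<bar>s h t - g t\<bar>" for t
          using n by (auto simp: indicator_def)
      qed
      finally show "\<bar>h * (\<Sum>k=1..n. g (h * real k)) - integral {0..h * real n} g\<bar> \<le> e" using elim by simp
    qed
  qed
qed

text \<open>The recursion starts at index 0 with the value \<open>h (g 0 + s 0)\<close>, so the sum contains one
term more than the Riemann sum; it is of order \<open>h\<close>.\<close>

lemma axis_convergence:
  fixes a :: "real \<Rightarrow> nat \<Rightarrow> real" and g s :: "real \<Rightarrow> real"
  assumes step: "\<And>h n. 0 < h \<Longrightarrow> a h n + h * g (h * real (Suc n)) \<le> a h (Suc n)"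
      "\<And>h n. 0 < h \<Longrightarrow> (a h (Suc n) - a h n - h * g (h * real (Suc n))) *
         (a h (Suc n) - h * g (h * real (Suc n))) = h\<^sup>2 * (s (h * real (Suc n)))\<^sup>2"
    and init: "\<And>h. 0 < h \<Longrightarrow> a h 0 = h * g 0 + h * s 0"
    and g0: "\<And>t. 0 \<le> t \<Longrightarrow> 0 \<le> g t" and gB: "\<And>t. 0 \<le> t \<Longrightarrow> t \<le> R \<Longrightarrow> g t \<le> B"
    and s0: "0 \<le> s 0" and sS: "\<And>t. 0 \<le> t \<Longrightarrow> t \<le> R \<Longrightarrow> (s t)\<^sup>2 \<le> S"
    and D: "finite D" "\<And>t. 0 < t \<Longrightarrow> t < R \<Longrightarrow> t \<notin> D \<Longrightarrow> isCont g t"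
    and R: "0 \<le> R" and e: "0 < e"
  shows "\<forall>\<^sub>F h in at_right 0. \<forall>n. h * real n \<le> R \<longrightarrow> \<bar>a h n - integral {0..h * real n} g\<bar> \<le> e"
proof -
  \<comment> \<open>Cutting \<open>g\<close> off makes it bounded on the whole line; the cut adds the discontinuities \<open>0\<close> and \<open>R\<close>.\<close>
  define g' where "g' t = (if t \<in> {0..R} then g t else 0)" for t
  have B0: "0 \<le> B" using g0[of 0] gB[of 0] R by linarith
  have S0: "0 \<le> S" using sS[of 0] R by (smt (verit) zero_le_power2)
  have cont: "isCont g' t" if "t \<notin> D \<union> {0, R}" for t
  proof (cases "0 < t \<and> t < R")
    case True
    then have "\<forall>\<^sub>F x in nhds t. x \<in> {0<..<R}" by (intro eventually_nhds_in_open) auto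
    then have "\<forall>\<^sub>F x in nhds t. g' x = g x" by eventually_elim (auto simp: g'_def)
    then show ?thesis using D(2)[of t] True that isCont_cong by blast
  next
    case False
    then have "\<forall>\<^sub>F x in nhds t. x \<in> - {0..R}" using that by (intro eventually_nhds_in_open) auto
    then have "\<forall>\<^sub>F x in nhds t. g' x = 0" by eventually_elim (auto simp: g'_def)
    then show ?thesis using isCont_cong[of g' "\<lambda>_. 0" t] by simp
  qed
  have "\<bar>g' t\<bar> \<le> B" for t using g0[of t] gB[of t] B0 by (auto simp: g'_def)
  then have ev1: "\<forall>\<^sub>F h in at_right 0. \<forall>n::nat. h * real n \<le> R \<longrightarrow>
    \<bar>h * (\<Sum>k=1..n. g' (h * real k)) - integral {0..h * real n} g'\<bar> \<le> e / 2"
    by (rule riemann_sum_uniform[where D = "D \<union> {0, R}", OF _ _ cont]) (use D e in auto)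
  have "((\<lambda>h. h * B + sqrt (2 * (h * (R + h)) * S)) \<longlongrightarrow> 0 * B + sqrt (2 * (0 * (R + 0)) * S)) (at_right 0)"
    by (intro tendsto_intros)
  then have "\<forall>\<^sub>F h in at_right 0. h * B + sqrt (2 * (h * (R + h)) * S) < e / 2"
    using e by (intro order_tendstoD(2)) auto
  with ev1 show ?thesis using eventually_at_right_less[of 0]
  proof eventually_elim
    case (elim h)
    then have h: "0 < h" by simp
    show ?case
    proof (intro allI impI)
      fix n :: nat assume n: "h * real n \<le> R"
      define m where "m k = h * g (h * real k)" for k :: nat
      define c where "c k = h * s (h * real k)" for k :: nat
      have in_R: "0 \<le> h * real k \<and> h * real k \<le> R" if "k \<le> n" for k
      proof -
        have "h * real k \<le> h * real n" using that h by (intro mult_left_mono) auto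
        then have "h * real k \<le> R" using n by linarith
        then show ?thesis using h by simp
      qed
      have W: "sum m {..n} \<le> a h n" "(a h n - sum m {..n})\<^sup>2 \<le> 2 * (\<Sum>k\<le>n. (c k)\<^sup>2)"
        using axis_sum_estimate[of "a h" m c n] step[OF h] init[OF h] g0 h s0
        by (simp_all add: m_def c_def power_mult_distrib)
      have "(\<Sum>k\<le>n. (c k)\<^sup>2) \<le> (\<Sum>k\<le>n. h\<^sup>2 * S)"
        using sS in_R by (intro sum_mono) (auto simp: c_def power_mult_distrib intro!: mult_left_mono)
      also have "\<dots> = (h * (h * real n + h)) * S" by (simp add: power2_eq_square algebra_simps)
      also have "\<dots> \<le> (h * (R + h)) * S" using n h S0 by (intro mult_right_mono mult_left_mono) auto
      finally have "(a h n - sum m {..n})\<^sup>2 \<le> 2 * (h * (R + h)) * S" using W(2) by linarith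
      then have 1: "\<bar>a h n - sum m {..n}\<bar> \<le> sqrt (2 * (h * (R + h)) * S)"
        by (rule real_le_rsqrt[of "\<bar>_\<bar>", simplified])
      have 2: "integral {0..h * real n} g' = integral {0..h * real n} g"
        using n by (intro integral_cong) (auto simp: g'_def)
      have "sum m {..n} = m 0 + (\<Sum>k=1..n. m k)"
        by (simp add: atMost_atLeast0 sum.atLeast_Suc_atMost)
      moreover have "(\<Sum>k=1..n. m k) = h * (\<Sum>k=1..n. g' (h * real k))"
        unfolding sum_distrib_left using in_R by (intro sum.cong) (auto simp: m_def g'_def)
      moreover have "0 \<le> m 0" "m 0 \<le> h * B" using g0[of 0] gB[of 0] h R by (auto simp: m_def)
      moreover have "\<bar>h * (\<Sum>k=1..n. g' (h * real k)) - integral {0..h * real n} g'\<bar> \<le> e / 2"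
        using elim n by blast
      ultimately show "\<bar>a h n - integral {0..h * real n} g\<bar> \<le> e"
        using 1 2 elim(2) by linarith
    qed
  qed
qed

lemma integrable_finite_discontinuities:
  fixes g :: "real \<Rightarrow> real"
  assumes B: "\<And>t. 0 \<le> t \<Longrightarrow> t \<le> R \<Longrightarrow> \<bar>g t\<bar> \<le> B"
    and D: "finite D" "\<And>t. 0 < t \<Longrightarrow> t < R \<Longrightarrow> t \<notin> D \<Longrightarrow> isCont g t"
  shows "g integrable_on {0..R}"
proof (cases "0 < R")
  case True
  \<comment> \<open>On \<open>[0, R]\<close> the restriction of \<open>g\<close> to this open set, extended by zero, is measurable and differs
    from \<open>g\<close> in finitely many points only.\<close>
  define A where "A = {0<..<R} - D"
  have "open A" unfolding A_def using D by (intro open_Diff finite_imp_closed) auto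
  have "continuous_on A g" using D by (intro continuous_at_imp_continuous_on) (auto simp: A_def)
  then have "set_borel_measurable borel A g"
    using \<open>open A\<close> by (intro borel_measurable_continuous_on_indicator[of A g, folded set_borel_measurable_def]) auto
  then have [measurable]: "(\<lambda>t. indicator A t *\<^sub>R g t) \<in> borel_measurable borel"
    by (simp add: set_borel_measurable_def)
  have "set_integrable lborel {0..R} (\<lambda>t. indicator A t *\<^sub>R g t)"
    unfolding set_integrable_def
  proof (rule integrableI_bounded_set_indicator[where B = "\<bar>B\<bar>"])
    show "AE x\<in>{0..R} in lborel. norm (indicator A x *\<^sub>R g x) \<le> \<bar>B\<bar>"
      using B by (intro AE_I2) (force simp: indicator_def)
    show "(\<lambda>t. indicator A t *\<^sub>R g t) \<in> borel_measurable lborel" by measurable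
  qed (auto simp: emeasure_lborel_Icc_eq)
  then have "(\<lambda>t. indicator A t *\<^sub>R g t) integrable_on {0..R}"
    by (rule set_borel_integral_eq_integral)
  then show ?thesis
    by (rule integrable_spike_finite[of "D \<union> {0, R}", rotated 2]) (use D in \<open>auto simp: A_def\<close>)
next
  case False
  then show ?thesis by (cases "R = 0") (auto simp: integrable_on_def intro!: exI has_integral_refl)
qed

section \<open>A priori bounds for the scheme\<close>

lemma axis_in_boundary:
  assumes "v \<in> {(1, 0), (0, 1)}" "0 \<le> t"
  shows "t *\<^sub>R v \<in> quadrant_boundary"
  using assms by (auto simp: quadrant_boundary_eq quadrant_def)

lemma boundary_cases:
  assumes "x \<in> quadrant_boundary"
  obtains v t where "v \<in> {(1, 0), (0, 1)}" "0 \<le> t" "x = t *\<^sub>R v"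
proof (cases "snd x = 0")
  case True
  then show thesis using assms by (intro that[of "(1, 0)" "fst x"]) (auto simp: quadrant_boundary_eq quadrant_def prod_eq_iff)
next
  case False
  then show thesis using assms by (intro that[of "(0, 1)" "snd x"]) (auto simp: quadrant_boundary_eq quadrant_def prod_eq_iff)
qed

locale last_passage =
  fixes \<mu> \<sigma> \<mu>\<^sub>s :: "real \<times> real \<Rightarrow> real" and L L' :: real
  assumes \<mu>_nonneg: "x \<in> quadrant \<Longrightarrow> 0 \<le> \<mu> x"
    and \<sigma>_nonneg: "x \<in> quadrant \<Longrightarrow> 0 \<le> \<sigma> x"
    and \<mu>_lipschitz: "L-lipschitz_on quadrant \<mu>"
    and \<sigma>_lipschitz: "L'-lipschitz_on quadrant (\<lambda>x. (\<sigma> x)\<^sup>2)"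
    and \<mu>_eq_0: "x \<in> open_quadrant \<Longrightarrow> \<sigma> x = 0 \<Longrightarrow> \<mu> x = 0"
    and \<mu>\<^sub>s_nonneg: "x \<in> quadrant_boundary \<Longrightarrow> 0 \<le> \<mu>\<^sub>s x"
    and \<mu>\<^sub>s_bounded: "bounded (\<mu>\<^sub>s ` quadrant_boundary)"
    and \<mu>\<^sub>s_disc: "locally_finite_set (discontinuities_on quadrant_boundary \<mu>\<^sub>s)"
begin

text \<open>The deterministic part of the weight in the recursion; along an axis it is also the integrand of the
boundary values.\<close>

definition rate where "rate x = \<mu> x + boundary_ext \<mu>\<^sub>s x"

definition U where "U h i j = scheme \<mu> \<mu>\<^sub>s \<sigma> h (int i) (int j)"

abbreviation \<phi> where "\<phi> \<equiv> boundary_value \<mu> \<mu>\<^sub>s"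

lemma L_nonneg: "0 \<le> L" "0 \<le> L'"
  using \<mu>_lipschitz \<sigma>_lipschitz by (auto simp: lipschitz_on_def)

lemma \<mu>_le_rate: "\<mu> x \<le> rate x"
  by (simp add: rate_def boundary_ext_def \<mu>\<^sub>s_nonneg)

lemma rate_nonneg: "x \<in> quadrant \<Longrightarrow> 0 \<le> rate x"
  using \<mu>_nonneg[of x] \<mu>_le_rate[of x] by linarith

lemma rate_interior: "0 < a \<Longrightarrow> 0 < b \<Longrightarrow> rate (a, b) = \<mu> (a, b)"
  by (simp add: rate_def boundary_ext_def quadrant_boundary_eq)

lemma bounded_on_square:
  obtains M where "0 < M" "\<And>x. x \<in> square R \<Longrightarrow> rate x \<le> M" "\<And>x. x \<in> square R \<Longrightarrow> \<sigma> x \<le> M"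
proof -
  have "continuous_on (square R) \<mu>" "continuous_on (square R) (\<lambda>x. (\<sigma> x)\<^sup>2)"
    using \<mu>_lipschitz \<sigma>_lipschitz square_subset_quadrant
    by (meson continuous_on_subset lipschitz_on_continuous_on)+
  then have "bounded (\<mu> ` square R)" "bounded ((\<lambda>x. (\<sigma> x)\<^sup>2) ` square R)"
    by (simp_all add: compact_imp_bounded compact_continuous_image compact_square)
  then obtain a b where a: "\<And>x. x \<in> square R \<Longrightarrow> \<bar>\<mu> x\<bar> \<le> a"
    and b: "\<And>x. x \<in> square R \<Longrightarrow> \<bar>(\<sigma> x)\<^sup>2\<bar> \<le> b"
    unfolding bounded_iff real_norm_def by blast
  obtain c where c: "\<And>x. x \<in> quadrant_boundary \<Longrightarrow> \<bar>\<mu>\<^sub>s x\<bar> \<le> c"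
    using \<mu>\<^sub>s_bounded unfolding bounded_iff real_norm_def by blast
  have "\<sigma> x \<le> \<bar>b\<bar> + 1" if "x \<in> square R" for x
  proof -
    have "0 \<le> (\<sigma> x - 1)\<^sup>2" by simp
    then have "2 * \<sigma> x \<le> (\<sigma> x)\<^sup>2 + 1" unfolding power2_diff by simp
    then show ?thesis using b[OF that] by linarith
  qed
  moreover have "rate x \<le> \<bar>a\<bar> + \<bar>c\<bar>" if "x \<in> square R" for x
    using a[OF that] c[of x] by (auto simp: rate_def boundary_ext_def)
  ultimately show thesis by (intro that[of "\<bar>a\<bar> + \<bar>b\<bar> + \<bar>c\<bar> + 1"]) force+
qed

lemma U_step:
  assumes "0 < h"
  shows "0 \<le> U h (Suc i) (Suc j) - U h i (Suc j) - h * \<mu> (h * real (Suc i), h * real (Suc j))"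
    "0 \<le> U h (Suc i) (Suc j) - U h (Suc i) j - h * \<mu> (h * real (Suc i), h * real (Suc j))"
    "(U h (Suc i) (Suc j) - U h i (Suc j) - h * \<mu> (h * real (Suc i), h * real (Suc j))) *
     (U h (Suc i) (Suc j) - U h (Suc i) j - h * \<mu> (h * real (Suc i), h * real (Suc j)))
     = h\<^sup>2 * (\<sigma> (h * real (Suc i), h * real (Suc j)))\<^sup>2"
proof -
  have s: "int (Suc n) - 1 = int n" for n by simp
  have r: "\<mu> (h * real (Suc i), h * real (Suc j)) + boundary_ext \<mu>\<^sub>s (h * real (Suc i), h * real (Suc j))
      = \<mu> (h * real (Suc i), h * real (Suc j))"
    using rate_interior[of "h * real (Suc i)" "h * real (Suc j)"] assms by (simp add: rate_def)
  note st = scheme_step[of "int (Suc i)" "int (Suc j)" \<mu> \<mu>\<^sub>s \<sigma> h, unfolded s of_int_of_nat_eq r]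
  show "0 \<le> U h (Suc i) (Suc j) - U h i (Suc j) - h * \<mu> (h * real (Suc i), h * real (Suc j))"
    "0 \<le> U h (Suc i) (Suc j) - U h (Suc i) j - h * \<mu> (h * real (Suc i), h * real (Suc j))"
    using st(1,2) unfolding U_def by linarith+
  show "(U h (Suc i) (Suc j) - U h i (Suc j) - h * \<mu> (h * real (Suc i), h * real (Suc j))) *
     (U h (Suc i) (Suc j) - U h (Suc i) j - h * \<mu> (h * real (Suc i), h * real (Suc j)))
     = h\<^sup>2 * (\<sigma> (h * real (Suc i), h * real (Suc j)))\<^sup>2"
    using st(3) unfolding U_def by linarith
qed

lemma U_axis:
  shows "U h i 0 + h * rate (h * real (Suc i), 0) \<le> U h (Suc i) 0"
    "(U h (Suc i) 0 - U h i 0 - h * rate (h * real (Suc i), 0)) * (U h (Suc i) 0 - h * rate (h * real (Suc i), 0))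
     = h\<^sup>2 * (\<sigma> (h * real (Suc i), 0))\<^sup>2"
    "U h 0 i + h * rate (0, h * real (Suc i)) \<le> U h 0 (Suc i)"
    "(U h 0 (Suc i) - U h 0 i - h * rate (0, h * real (Suc i))) * (U h 0 (Suc i) - h * rate (0, h * real (Suc i)))
     = h\<^sup>2 * (\<sigma> (0, h * real (Suc i)))\<^sup>2"
proof -
  have s: "int (Suc n) - 1 = int n" for n by simp
  have z: "scheme \<mu> \<mu>\<^sub>s \<sigma> h (int (Suc i)) (0 - 1) = 0" "scheme \<mu> \<mu>\<^sub>s \<sigma> h (0 - 1) (int (Suc i)) = 0"
    by (simp_all add: scheme_neg)
  note st = scheme_step[of "int (Suc i)" 0 \<mu> \<mu>\<^sub>s \<sigma> h, unfolded s of_int_of_nat_eq z of_int_0 mult_zero_right, folded rate_def]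
    scheme_step[of 0 "int (Suc i)" \<mu> \<mu>\<^sub>s \<sigma> h, unfolded s of_int_of_nat_eq z of_int_0 mult_zero_right, folded rate_def]
  show "U h i 0 + h * rate (h * real (Suc i), 0) \<le> U h (Suc i) 0"
    "U h 0 i + h * rate (0, h * real (Suc i)) \<le> U h 0 (Suc i)"
    using st(1,5) by (simp_all add: U_def)
  show "(U h (Suc i) 0 - U h i 0 - h * rate (h * real (Suc i), 0)) * (U h (Suc i) 0 - h * rate (h * real (Suc i), 0))
     = h\<^sup>2 * (\<sigma> (h * real (Suc i), 0))\<^sup>2"
    using st(3) unfolding U_def by simp
  show "(U h 0 (Suc i) - U h 0 i - h * rate (0, h * real (Suc i))) * (U h 0 (Suc i) - h * rate (0, h * real (Suc i)))
     = h\<^sup>2 * (\<sigma> (0, h * real (Suc i)))\<^sup>2"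
    using st(6) unfolding U_def by (simp add: mult.commute)
qed

lemma U_origin: "0 < h \<Longrightarrow> U h 0 0 = h * rate (0, 0) + h * \<sigma> (0, 0)"
  using \<sigma>_nonneg[of "(0, 0)"] unfolding U_def
  by (subst scheme.simps) (simp add: scheme_neg rate_def quadrant_def real_sqrt_mult)

lemma grid_in_quadrant: "0 < h \<Longrightarrow> (h * real i, h * real j) \<in> quadrant"
  by (simp add: quadrant_def)

lemma U_mono:
  assumes "0 < h" "i \<le> i'" "j \<le> j'"
  shows "U h i j \<le> U h i' j'"
proof -
  have r: "0 \<le> h * rate (h * real i, h * real j)" "0 \<le> h * \<mu> (h * real i, h * real j)" for i j
    using rate_nonneg \<mu>_nonneg grid_in_quadrant assms(1) by (meson less_imp_le mult_nonneg_nonneg)+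
  have 1: "U h i j \<le> U h (Suc i) j" for i j
  proof (cases j)
    case 0 then show ?thesis using U_axis(1)[of h i] r(1)[of "Suc i" 0] by simp
  next
    case (Suc n) then show ?thesis using U_step(1)[OF assms(1), of i n] r(2)[of "Suc i" "Suc n"] by simp
  qed
  have 2: "U h i j \<le> U h i (Suc j)" for i j
  proof (cases i)
    case 0 then show ?thesis using U_axis(3)[of h j] r(1)[of 0 "Suc j"] by simp
  next
    case (Suc n) then show ?thesis using U_step(2)[OF assms(1), of n j] r(2)[of "Suc n" "Suc j"] by simp
  qed
  have "U h i j \<le> U h i' j" using lift_Suc_mono_le[of "\<lambda>i. U h i j"] 1 assms by blast
  also have "\<dots> \<le> U h i' j'" using lift_Suc_mono_le[of "U h i'"] 2 assms by blast
  finally show ?thesis .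
qed

lemma U_nonneg: "0 < h \<Longrightarrow> 0 \<le> U h i j"
  using U_mono[of h 0 i 0 j] U_origin[of h] rate_nonneg[of "(0, 0)"] \<sigma>_nonneg[of "(0, 0)"]
  by (simp add: quadrant_def) (smt (verit) mult_nonneg_nonneg)

text \<open>Near the first axis \<open>\<mu>\<close> exceeds its axis value by at most \<open>L h j\<close>, and the values on the other axis
grow at most linearly, so the barrier applies; the second bound exchanges the axes. The last two
bounds sum the increments along an axis.\<close>

lemma U_near_axis:
  assumes h: "0 < h" and M: "\<And>x. x \<in> square R \<Longrightarrow> rate x \<le> M" "\<And>x. x \<in> square R \<Longrightarrow> \<sigma> x \<le> M"
    and M0: "0 \<le> M" and a: "0 < a" and R: "h * real i \<le> R" "h * real j \<le> R"
  shows "U h i j \<le> U h i 0 + (L * (h * real j) + a) * (h * real i) + (2 * M + M\<^sup>2 / a) * (h * real j)" (is ?A)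
    and "U h i j \<le> U h 0 j + (L * (h * real i) + a) * (h * real j) + (2 * M + M\<^sup>2 / a) * (h * real i)" (is ?B)
    and "U h i 0 \<le> U h 0 0 + 2 * M * (h * real i)" (is ?C)
    and "U h 0 j \<le> U h 0 0 + 2 * M * (h * real j)" (is ?D)
proof -
  have hm: "h * real k \<le> h * real n" if "k \<le> n" for k n using that h by simp
  have sq: "(h * real k, h * real l) \<in> square R" if "k \<le> i" "l \<le> j" for k l
  proof -
    have "h * real k \<le> R" "h * real l \<le> R" using hm[OF that(1)] hm[OF that(2)] R by linarith+
    then show ?thesis using h by (simp add: square_def)
  qed
  have q: "(h * real k, h * real l) \<in> quadrant" for k l using grid_in_quadrant h by blast
  have \<sigma>M: "h\<^sup>2 * (\<sigma> (h * real k, h * real l))\<^sup>2 \<le> h\<^sup>2 * M\<^sup>2" if "k \<le> i" "l \<le> j" for k l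
    using M(2)[OF sq[OF that]] \<sigma>_nonneg[OF q] by (intro mult_left_mono power_mono) auto
  have \<mu>M: "\<mu> (h * real k, h * real l) \<le> M" if "k \<le> i" "l \<le> j" for k l
    using M(1)[OF sq[OF that]] \<mu>_le_rate order_trans by blast
  have lip1: "\<mu> (h * real k, h * real l) \<le> \<mu> (h * real k, 0) + L * (h * real l)" for k l
  proof -
    have "dist (\<mu> (h * real k, h * real l)) (\<mu> (h * real k, 0)) \<le> L * dist (h * real k, h * real l) (h * real k, 0)"
      using q[of k l] q[of k 0] by (intro lipschitz_onD[OF \<mu>_lipschitz]) auto
    then show ?thesis using h by (simp add: dist_real_def dist_Pair_Pair)
  qed
  have lip2: "\<mu> (h * real k, h * real l) \<le> \<mu> (0, h * real l) + L * (h * real k)" for k l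
  proof -
    have "dist (\<mu> (h * real k, h * real l)) (\<mu> (0, h * real l)) \<le> L * dist (h * real k, h * real l) (0, h * real l)"
      using q[of k l] q[of 0 l] by (intro lipschitz_onD[OF \<mu>_lipschitz]) auto
    then show ?thesis using h by (simp add: dist_real_def dist_Pair_Pair)
  qed
  have inc1: "U h (Suc n) 0 \<le> U h n 0 + 2 * (h * M)" if "n < i" for n
  proof -
    have "U h (Suc n) 0 \<le> U h n 0 + h * rate (h * real (Suc n), 0) + h * \<sigma> (h * real (Suc n), 0)"
      using axis_increment[of "\<lambda>n. U h n 0" n "\<lambda>k. h * rate (h * real k, 0)" "\<lambda>k. h * \<sigma> (h * real k, 0)"]
        U_axis(1,2)[of h n] U_nonneg[OF h, of n 0] \<sigma>_nonneg[OF q[of "Suc n" 0]] h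
      by (simp add: power_mult_distrib del: of_nat_Suc)
    moreover have "h * rate (h * real (Suc n), 0) \<le> h * M" "h * \<sigma> (h * real (Suc n), 0) \<le> h * M"
      using M sq[of "Suc n" 0] that h by (auto intro!: mult_left_mono simp del: of_nat_Suc)
    ultimately show ?thesis by linarith
  qed
  have inc2: "U h 0 (Suc n) \<le> U h 0 n + 2 * (h * M)" if "n < j" for n
  proof -
    have "U h 0 (Suc n) \<le> U h 0 n + h * rate (0, h * real (Suc n)) + h * \<sigma> (0, h * real (Suc n))"
      using axis_increment[of "U h 0" n "\<lambda>k. h * rate (0, h * real k)" "\<lambda>k. h * \<sigma> (0, h * real k)"]
        U_axis(3,4)[of h n] U_nonneg[OF h, of 0 n] \<sigma>_nonneg[OF q[of 0 "Suc n"]] h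
      by (simp add: power_mult_distrib del: of_nat_Suc)
    moreover have "h * rate (0, h * real (Suc n)) \<le> h * M" "h * \<sigma> (0, h * real (Suc n)) \<le> h * M"
      using M sq[of 0 "Suc n"] that h by (auto intro!: mult_left_mono simp del: of_nat_Suc)
    ultimately show ?thesis by linarith
  qed
  have ax1: "U h n 0 \<le> U h 0 0 + 2 * M * (h * real n)" if "n \<le> i" for n
    using that
  proof (induction n)
    case (Suc n) then show ?case using inc1[of n] by (simp add: algebra_simps)
  qed simp
  have ax2: "U h 0 n \<le> U h 0 0 + 2 * M * (h * real n)" if "n \<le> j" for n
    using that
  proof (induction n)
    case (Suc n) then show ?case using inc2[of n] by (simp add: algebra_simps)
  qed simp
  show ?C ?D using ax1[of i] ax2[of j] by simp_all
  have c0: "0 \<le> M\<^sup>2 / a" using a by simp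
  have ax1': "U h n 0 \<le> U h 0 0 + (2 * M + M\<^sup>2 / a) * (h * real n)" if "n \<le> i" for n
    using ax1[OF that] mult_nonneg_nonneg[OF c0, of "h * real n"] h by (simp add: algebra_simps)
  have ax2': "U h 0 n \<le> U h 0 0 + (2 * M + M\<^sup>2 / a) * (h * real n)" if "n \<le> j" for n
    using ax2[OF that] mult_nonneg_nonneg[OF c0, of "h * real n"] h by (simp add: algebra_simps)
  have Lj: "L * (h * real l) \<le> L * (h * real n)" if "l \<le> n" for l n
    by (rule mult_left_mono[OF hm[OF that] L_nonneg(1)])
  have r\<mu>: "h * \<mu> x \<le> h * rate x" for x using \<mu>_le_rate h by (intro mult_left_mono) auto
  show ?A
  proof (rule axis_barrier[where m = "\<lambda>k l. \<mu> (h * real k, h * real l)" and I = i and J = j, OF h a M0])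
    fix k l assume kl: "k < i" "l < j"
    show "\<mu> (h * real (Suc k), h * real (Suc l)) \<le> M \<and>
      \<mu> (h * real (Suc k), h * real (Suc l)) \<le> \<mu> (h * real (Suc k), h * real 0) + L * (h * real j)"
      using \<mu>M[of "Suc k" "Suc l"] lip1[of "Suc k" "Suc l"] Lj[of "Suc l" j] kl by (simp del: of_nat_Suc)
    show "0 \<le> U h (Suc k) (Suc l) - U h k (Suc l) - h * \<mu> (h * real (Suc k), h * real (Suc l)) \<and>
      0 \<le> U h (Suc k) (Suc l) - U h (Suc k) l - h * \<mu> (h * real (Suc k), h * real (Suc l)) \<and>
      (U h (Suc k) (Suc l) - U h k (Suc l) - h * \<mu> (h * real (Suc k), h * real (Suc l))) *
      (U h (Suc k) (Suc l) - U h (Suc k) l - h * \<mu> (h * real (Suc k), h * real (Suc l))) \<le> h\<^sup>2 * M\<^sup>2"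
      using U_step[OF h, of k l] \<sigma>M[of "Suc k" "Suc l"] kl by (simp del: of_nat_Suc)
  next
    fix k
    show "U h k 0 + h * \<mu> (h * real (Suc k), h * real 0) \<le> U h (Suc k) 0"
      using U_axis(1)[of h k] r\<mu>[of "(h * real (Suc k), 0)"] by (simp del: of_nat_Suc)
  qed (use L_nonneg h M0 ax2' in auto)
  show ?B
  proof (rule axis_barrier[where u = "\<lambda>k l. U h l k" and m = "\<lambda>k l. \<mu> (h * real l, h * real k)" and I = j and J = i, OF h a M0])
    fix k l assume kl: "k < j" "l < i"
    show "\<mu> (h * real (Suc l), h * real (Suc k)) \<le> M \<and>
      \<mu> (h * real (Suc l), h * real (Suc k)) \<le> \<mu> (h * real 0, h * real (Suc k)) + L * (h * real i)"
      using \<mu>M[of "Suc l" "Suc k"] lip2[of "Suc l" "Suc k"] Lj[of "Suc l" i] kl by (simp del: of_nat_Suc)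
    show "0 \<le> U h (Suc l) (Suc k) - U h (Suc l) k - h * \<mu> (h * real (Suc l), h * real (Suc k)) \<and>
      0 \<le> U h (Suc l) (Suc k) - U h l (Suc k) - h * \<mu> (h * real (Suc l), h * real (Suc k)) \<and>
      (U h (Suc l) (Suc k) - U h (Suc l) k - h * \<mu> (h * real (Suc l), h * real (Suc k))) *
      (U h (Suc l) (Suc k) - U h l (Suc k) - h * \<mu> (h * real (Suc l), h * real (Suc k))) \<le> h\<^sup>2 * M\<^sup>2"
      using U_step[OF h, of l k] \<sigma>M[of "Suc l" "Suc k"] kl by (simp add: mult.commute del: of_nat_Suc)
  next
    fix k
    show "U h 0 k + h * \<mu> (h * real 0, h * real (Suc k)) \<le> U h 0 (Suc k)"
      using U_axis(3)[of h k] r\<mu>[of "(0, h * real (Suc k))"] by (simp del: of_nat_Suc)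
  qed (use L_nonneg h M0 ax1' in auto)
qed

section \<open>Boundary behaviour of the scheme\<close>

lemma boundary_value_axis:
  assumes v: "v \<in> {(1, 0), (0, 1)}" and t: "0 \<le> t"
  shows "\<phi> (t *\<^sub>R v) = integral {0..t} (\<lambda>s. rate (s *\<^sub>R v))"
proof (cases "t = 0")
  case True then show ?thesis by (simp add: boundary_value_def)
next
  case False
  then have t: "0 < t" using t by simp
  have "(\<lambda>x. x / t) ` {0..t} = {0..1}"
    using t by (auto simp: image_iff field_simps intro!: bexI[of _ "_ * t"])
  then have "integral {0..1} (\<lambda>s. rate ((t * s) *\<^sub>R v)) = (1 / t) * integral {0..t} (\<lambda>s. rate (s *\<^sub>R v))"
    using integral_stretch_real[of t 0 t "\<lambda>s. rate (s *\<^sub>R v)"] t by simp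
  then have "t * integral {0..1} (\<lambda>s. rate ((t * s) *\<^sub>R v)) = integral {0..t} (\<lambda>s. rate (s *\<^sub>R v))"
    using t by simp
  moreover have "fst (t *\<^sub>R v) + snd (t *\<^sub>R v) = t" using v by auto
  ultimately show ?thesis unfolding boundary_value_def rate_def[symmetric] scaleR_scaleR
    by (simp add: mult.commute)
qed

lemma rate_axis_isCont:
  assumes v: "v \<in> {(1, 0), (0, 1)}" and t: "0 < t"
    and "t *\<^sub>R v \<notin> discontinuities_on quadrant_boundary \<mu>\<^sub>s"
  shows "isCont (\<lambda>s. rate (s *\<^sub>R v)) t"
proof -
  have ev: "\<forall>\<^sub>F s in at t. 0 < s"
    using t by (metis eventually_at_topological greaterThan_iff open_greaterThan)
  have ev': "\<forall>\<^sub>F s in at t. s \<noteq> t" by (simp add: eventually_at_filter)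
  have *: "((\<lambda>s. s *\<^sub>R v) \<longlongrightarrow> t *\<^sub>R v) (at t)" by (intro tendsto_intros)
  have l1: "((\<lambda>s. \<mu> (s *\<^sub>R v)) \<longlongrightarrow> \<mu> (t *\<^sub>R v)) (at t)"
  proof (rule continuous_on_tendsto_compose[OF lipschitz_on_continuous_on[OF \<mu>_lipschitz] *])
    show "\<forall>\<^sub>F s in at t. s *\<^sub>R v \<in> quadrant"
      using ev by eventually_elim (use v in \<open>auto simp: quadrant_def\<close>)
  qed (use v t in \<open>auto simp: quadrant_def\<close>)
  have l2: "((\<lambda>s. \<mu>\<^sub>s (s *\<^sub>R v)) \<longlongrightarrow> \<mu>\<^sub>s (t *\<^sub>R v)) (at t)"
  proof -
    have "(\<mu>\<^sub>s \<longlongrightarrow> \<mu>\<^sub>s (t *\<^sub>R v)) (at (t *\<^sub>R v) within quadrant_boundary)"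
      using assms(3) axis_in_boundary[OF v, of t] t
      by (auto simp: discontinuities_on_def continuous_within)
    moreover have "filterlim (\<lambda>s. s *\<^sub>R v) (at (t *\<^sub>R v) within quadrant_boundary) (at t)"
      unfolding filterlim_at
    proof (intro conjI *)
      show "\<forall>\<^sub>F s in at t. s *\<^sub>R v \<in> quadrant_boundary \<and> s *\<^sub>R v \<noteq> t *\<^sub>R v"
        using ev ev'
      proof eventually_elim
        case (elim s)
        then show ?case using axis_in_boundary[OF v, of s] v by (auto simp: zero_prod_def)
      qed
    qed
    ultimately show ?thesis by (rule filterlim_compose)
  qed
  have eq: "\<mu> (s *\<^sub>R v) + \<mu>\<^sub>s (s *\<^sub>R v) = rate (s *\<^sub>R v)" if "0 < s" for s
    using axis_in_boundary[OF v, of s] that by (simp add: rate_def boundary_ext_def)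
  have "\<forall>\<^sub>F s in at t. \<mu> (s *\<^sub>R v) + \<mu>\<^sub>s (s *\<^sub>R v) = rate (s *\<^sub>R v)"
    using ev by eventually_elim (rule eq)
  from Lim_transform_eventually[OF tendsto_add[OF l1 l2] this]
  show ?thesis unfolding isCont_def eq[OF t] .
qed

lemma finite_axis_discontinuities:
  assumes v: "v \<in> {(1, 0), (0, 1)}"
  shows "finite {t. 0 \<le> t \<and> t \<le> R \<and> t *\<^sub>R v \<in> discontinuities_on quadrant_boundary \<mu>\<^sub>s}" (is "finite ?D")
proof (rule finite_imageD)
  have "(\<lambda>t. t *\<^sub>R v) ` ?D \<subseteq> discontinuities_on quadrant_boundary \<mu>\<^sub>s \<inter> square R"
    using v by (auto simp: square_def)
  then show "finite ((\<lambda>t. t *\<^sub>R v) ` ?D)"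
    using finite_locally_finite_compact[OF \<mu>\<^sub>s_disc compact_square] finite_subset by blast
  show "inj_on (\<lambda>t. t *\<^sub>R v) ?D" using v by (auto simp: inj_on_def zero_prod_def)
qed

lemma axis_square: "v \<in> {(1, 0), (0, 1)} \<Longrightarrow> 0 \<le> t \<Longrightarrow> t \<le> R \<Longrightarrow> t *\<^sub>R v \<in> square R"
  by (auto simp: square_def)

lemma axis_quadrant: "v \<in> {(1, 0), (0, 1)} \<Longrightarrow> 0 \<le> t \<Longrightarrow> t *\<^sub>R v \<in> quadrant"
  by (auto simp: quadrant_def)

lemma U_axis_limit:
  assumes R: "0 \<le> R" and e: "0 < e"
  shows "\<forall>\<^sub>F h in at_right 0. \<forall>n. h * real n \<le> R \<longrightarrow>
    \<bar>U h n 0 - \<phi> (h * real n, 0)\<bar> \<le> e \<and> \<bar>U h 0 n - \<phi> (0, h * real n)\<bar> \<le> e"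
proof -
  obtain M where M: "0 < M" "\<And>x. x \<in> square R \<Longrightarrow> rate x \<le> M" "\<And>x. x \<in> square R \<Longrightarrow> \<sigma> x \<le> M"
    using bounded_on_square by blast
  have gen: "\<forall>\<^sub>F h in at_right 0. \<forall>n. h * real n \<le> R \<longrightarrow>
      \<bar>a h n - integral {0..h * real n} (\<lambda>s. rate (s *\<^sub>R v))\<bar> \<le> e"
    if v: "v \<in> {(1, 0), (0, 1)}"
      and "\<And>h n. 0 < h \<Longrightarrow> a h n + h * rate ((h * real (Suc n)) *\<^sub>R v) \<le> a h (Suc n)"
        "\<And>h n. 0 < h \<Longrightarrow> (a h (Suc n) - a h n - h * rate ((h * real (Suc n)) *\<^sub>R v)) *
         (a h (Suc n) - h * rate ((h * real (Suc n)) *\<^sub>R v)) = h\<^sup>2 * (\<sigma> ((h * real (Suc n)) *\<^sub>R v))\<^sup>2"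
        "\<And>h. 0 < h \<Longrightarrow> a h 0 = h * rate (0 *\<^sub>R v) + h * \<sigma> (0 *\<^sub>R v)" for a v
  proof (rule axis_convergence[where g = "\<lambda>t. rate (t *\<^sub>R v)" and s = "\<lambda>t. \<sigma> (t *\<^sub>R v)" and B = M and S = "M\<^sup>2"
        and D = "{t. 0 \<le> t \<and> t \<le> R \<and> t *\<^sub>R v \<in> discontinuities_on quadrant_boundary \<mu>\<^sub>s}", OF that(2-4)])
    fix t :: real assume t: "0 \<le> t"
    show "0 \<le> rate (t *\<^sub>R v)" using rate_nonneg axis_quadrant[OF v t] by simp
    assume "t \<le> R"
    then have sq: "t *\<^sub>R v \<in> square R" by (rule axis_square[OF v t])
    show "rate (t *\<^sub>R v) \<le> M" by (rule M(2)[OF sq])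
    show "(\<sigma> (t *\<^sub>R v))\<^sup>2 \<le> M\<^sup>2"
      by (rule power_mono[OF M(3)[OF sq] \<sigma>_nonneg[OF axis_quadrant[OF v t]]])
  next
    show "0 \<le> \<sigma> (0 *\<^sub>R v)" by (rule \<sigma>_nonneg[OF axis_quadrant[OF v order_refl]])
    show "isCont (\<lambda>t. rate (t *\<^sub>R v)) t" if "0 < t" "t < R"
      "t \<notin> {t. 0 \<le> t \<and> t \<le> R \<and> t *\<^sub>R v \<in> discontinuities_on quadrant_boundary \<mu>\<^sub>s}" for t
      by (rule rate_axis_isCont[OF v that(1)]) (use that in simp)
  qed (assumption | fact R e finite_axis_discontinuities[OF v])+
  have "\<forall>\<^sub>F h in at_right 0. \<forall>n. h * real n \<le> R \<longrightarrow> \<bar>U h n 0 - integral {0..h * real n} (\<lambda>s. rate (s *\<^sub>R (1, 0)))\<bar> \<le> e"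
  proof (rule gen)
    have z: "(h * real (Suc n)) *\<^sub>R (1, 0) = (h * real (Suc n), 0)" "0 *\<^sub>R (1, 0) = (0, 0 :: real)" for h n
      by (simp_all del: of_nat_Suc)
    fix h :: real and n assume "0 < h"
    show "U h n 0 + h * rate ((h * real (Suc n)) *\<^sub>R (1, 0)) \<le> U h (Suc n) 0"
      "(U h (Suc n) 0 - U h n 0 - h * rate ((h * real (Suc n)) *\<^sub>R (1, 0))) *
         (U h (Suc n) 0 - h * rate ((h * real (Suc n)) *\<^sub>R (1, 0))) = h\<^sup>2 * (\<sigma> ((h * real (Suc n)) *\<^sub>R (1, 0)))\<^sup>2"
      "U h 0 0 = h * rate (0 *\<^sub>R (1, 0)) + h * \<sigma> (0 *\<^sub>R (1, 0))"
      unfolding z by (fact U_axis U_origin[OF \<open>0 < h\<close>])+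
  qed simp
  moreover have "\<forall>\<^sub>F h in at_right 0. \<forall>n. h * real n \<le> R \<longrightarrow> \<bar>U h 0 n - integral {0..h * real n} (\<lambda>s. rate (s *\<^sub>R (0, 1)))\<bar> \<le> e"
  proof (rule gen)
    have z: "(h * real (Suc n)) *\<^sub>R (0, 1) = (0, h * real (Suc n))" "0 *\<^sub>R (0, 1) = (0 :: real, 0)" for h n
      by (simp_all del: of_nat_Suc)
    fix h :: real and n assume "0 < h"
    show "U h 0 n + h * rate ((h * real (Suc n)) *\<^sub>R (0, 1)) \<le> U h 0 (Suc n)"
      "(U h 0 (Suc n) - U h 0 n - h * rate ((h * real (Suc n)) *\<^sub>R (0, 1))) *
         (U h 0 (Suc n) - h * rate ((h * real (Suc n)) *\<^sub>R (0, 1))) = h\<^sup>2 * (\<sigma> ((h * real (Suc n)) *\<^sub>R (0, 1)))\<^sup>2"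
      "U h 0 0 = h * rate (0 *\<^sub>R (0, 1)) + h * \<sigma> (0 *\<^sub>R (0, 1))"
      unfolding z by (fact U_axis U_origin[OF \<open>0 < h\<close>])+
  qed simp
  ultimately show ?thesis using eventually_at_right_less[of 0]
  proof eventually_elim
    case (elim h)
    have eq: "\<phi> (h * real n, 0) = integral {0..h * real n} (\<lambda>s. rate (s *\<^sub>R (1, 0)))"
      "\<phi> (0, h * real n) = integral {0..h * real n} (\<lambda>s. rate (s *\<^sub>R (0, 1)))" for n
      using boundary_value_axis[of "(1, 0)" "h * real n"] boundary_value_axis[of "(0, 1)" "h * real n"] elim(3)
      by simp_all
    show ?case unfolding eq using elim(1,2) by blast
  qed
qed

lemma boundary_value_lipschitz:
  assumes M: "\<And>x. x \<in> square R \<Longrightarrow> rate x \<le> M" and v: "v \<in> {(1, 0), (0, 1)}"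
    and t: "0 \<le> s" "s \<le> R" "0 \<le> t" "t \<le> R"
  shows "\<phi> (t *\<^sub>R v) \<le> \<phi> (s *\<^sub>R v) + M * \<bar>t - s\<bar>"
proof -
  let ?g = "\<lambda>s. rate (s *\<^sub>R v)"
  have b: "0 \<le> ?g r" "?g r \<le> M" if "0 \<le> r" "r \<le> R" for r
    using M[OF axis_square[OF v that]] rate_nonneg[OF axis_quadrant[OF v that(1)]] by auto
  have int: "?g integrable_on {0..R}"
  proof (rule integrable_finite_discontinuities[OF _ finite_axis_discontinuities[OF v, of R]])
    show "\<bar>?g r\<bar> \<le> M" if "0 \<le> r" "r \<le> R" for r using b[OF that] by simp
    show "isCont ?g r" if "0 < r" "r < R"
      "r \<notin> {t. 0 \<le> t \<and> t \<le> R \<and> t *\<^sub>R v \<in> discontinuities_on quadrant_boundary \<mu>\<^sub>s}" for r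
      by (rule rate_axis_isCont[OF v that(1)]) (use that in simp)
  qed
  have sub: "?g integrable_on {p..q}" if "0 \<le> p" "q \<le> R" for p q
    using int that by (intro integrable_subinterval_real[OF int]) auto
  show ?thesis
  proof (cases "s \<le> t")
    case True
    have "integral {s..t} ?g \<le> integral {s..t} (\<lambda>_. M)"
      using b t by (intro integral_le sub) auto
    also have "\<dots> = M * \<bar>t - s\<bar>" using True by simp
    finally have "integral {s..t} ?g \<le> M * \<bar>t - s\<bar>" .
    moreover have "integral {0..s} ?g + integral {s..t} ?g = integral {0..t} ?g"
      using True t by (intro Henstock_Kurzweil_Integration.integral_combine sub) auto
    ultimately show ?thesis using boundary_value_axis[OF v] t by simp
  next
    case False
    have "0 \<le> integral {t..s} ?g" using b t by (intro Henstock_Kurzweil_Integration.integral_nonneg sub) auto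
    moreover have "integral {0..t} ?g + integral {t..s} ?g = integral {0..s} ?g"
      using False t by (intro Henstock_Kurzweil_Integration.integral_combine sub) auto
    moreover have "0 \<le> M * \<bar>t - s\<bar>" using b[of 0] t by simp
    ultimately show ?thesis using boundary_value_axis[OF v] t by simp
  qed
qed

definition grid where "grid h R = {x \<in> square R. \<exists>i j. x = (h * real i, h * real j)}"

lemma gridE:
  assumes "x \<in> grid h R"
  obtains i j where "x = (h * real i, h * real j)" "h * real i \<le> R" "h * real j \<le> R"
proof -
  obtain i j where ij: "x = (h * real i, h * real j)" "x \<in> square R" using assms unfolding grid_def by blast
  show thesis by (rule that[OF ij(1)]) (use ij in \<open>simp_all add: square_def\<close>)
qed

lemma finite_grid:
  assumes "0 < h" shows "finite (grid h R)"
proof (rule finite_subset)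
  let ?N = "nat \<lfloor>R / h\<rfloor>"
  have "i \<le> ?N" if "h * real i \<le> R" for i
  proof -
    have "real i \<le> R / h" using that assms by (simp add: field_simps)
    then show ?thesis by (simp add: le_nat_floor)
  qed
  then show "grid h R \<subseteq> (\<lambda>(i, j). (h * real i, h * real j)) ` ({..?N} \<times> {..?N})"
    by (auto simp: grid_def square_def)
qed auto

lemma scheme_ext_grid: "0 < h \<Longrightarrow> scheme_ext \<mu> \<mu>\<^sub>s \<sigma> h (h * real i, h * real j) = U h i j"
  by (simp add: scheme_ext_def U_def flip: mult.assoc)

text \<open>If a point of a close pair lies on an axis, then both points are within \<open>\<rho>\<close> of that axis. Up to
a small error, the first value is at most the boundary value at the projection of its point plus the barrier, the second is at
least the boundary value at the projection by monotonicity, and the boundary values are Lipschitz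
continuous.\<close>

lemma scheme_boundary_gap:
  assumes R: "0 \<le> R" and \<delta>: "0 < \<delta>"
  obtains \<rho> h0 where "0 < \<rho>" "0 < h0"
    "\<And>h k x y. 0 < h \<Longrightarrow> h < h0 \<Longrightarrow> 0 < k \<Longrightarrow> k < h0 \<Longrightarrow> x \<in> grid h R \<Longrightarrow> y \<in> grid k R \<Longrightarrow>
      dist x y \<le> \<rho> \<Longrightarrow> x \<in> quadrant_boundary \<or> y \<in> quadrant_boundary \<Longrightarrow>
      scheme_ext \<mu> \<mu>\<^sub>s \<sigma> h x - scheme_ext \<mu> \<mu>\<^sub>s \<sigma> k y \<le> \<delta>"
proof -
  obtain M where M: "0 < M" "\<And>x. x \<in> square R \<Longrightarrow> rate x \<le> M" "\<And>x. x \<in> square R \<Longrightarrow> \<sigma> x \<le> M"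
    using bounded_on_square by blast
  \<comment> \<open>The barrier slope \<open>a\<close> along the axis is fixed first, so that it contributes at most \<open>\<delta> / 8\<close>
    over the length \<open>R\<close>; the distance \<open>\<rho>\<close> then absorbs the slope \<open>b\<close> across the axis, which depends on \<open>a\<close>.\<close>
  define a where "a = \<delta> / (8 * (R + 1))"
  define b where "b = 2 * M + M\<^sup>2 / a"
  define Q where "Q = L * R + b + M + 1"
  define \<rho> where "\<rho> = \<delta> / (8 * Q)"
  have a: "0 < a" "a * R \<le> \<delta> / 8" using R \<delta> by (auto simp: a_def field_simps)
  have b: "0 < b" using M a by (auto simp: b_def intro!: add_pos_nonneg)
  have Q: "0 < Q" using L_nonneg R b M by (auto simp: Q_def intro!: add_nonneg_pos)
  have \<rho>: "0 < \<rho>" "\<rho> * Q = \<delta> / 8" using Q \<delta> by (auto simp: \<rho>_def)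
  then have \<rho>': "L * \<rho> * R + b * \<rho> + M * \<rho> \<le> \<delta> / 8" by (simp add: Q_def algebra_simps)
  obtain h0 where h0: "0 < h0" "\<And>h n. 0 < h \<Longrightarrow> h < h0 \<Longrightarrow> h * real n \<le> R \<Longrightarrow>
      \<bar>U h n 0 - \<phi> (h * real n, 0)\<bar> \<le> \<delta> / 8 \<and> \<bar>U h 0 n - \<phi> (0, h * real n)\<bar> \<le> \<delta> / 8"
    using U_axis_limit[OF R, of "\<delta> / 8"] \<delta> unfolding eventually_at_right_field by auto
  have ax: "\<phi> (h * real n, 0) \<le> U h n 0 + \<delta> / 8" "U h n 0 \<le> \<phi> (h * real n, 0) + \<delta> / 8"
    "\<phi> (0, h * real n) \<le> U h 0 n + \<delta> / 8" "U h 0 n \<le> \<phi> (0, h * real n) + \<delta> / 8"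
    if "0 < h" "h < h0" "h * real n \<le> R" for h n
    using h0(2)[OF that] unfolding abs_le_iff by linarith+
  have low: "\<phi> (h * real i, 0) \<le> U h i j + \<delta> / 8" "\<phi> (0, h * real j) \<le> U h i j + \<delta> / 8"
    if "0 < h" "h < h0" "h * real i \<le> R" "h * real j \<le> R" for h i j
    using ax(1)[OF that(1-3)] ax(3)[OF that(1,2,4)] U_mono[of h i i 0 j] U_mono[of h 0 i j j] that(1) by auto
  have up: "h * real j \<le> \<rho> \<Longrightarrow> U h i j \<le> \<phi> (h * real i, 0) + \<delta> / 4 + L * \<rho> * R + b * \<rho>"
    "h * real i \<le> \<rho> \<Longrightarrow> U h i j \<le> \<phi> (0, h * real j) + \<delta> / 4 + L * \<rho> * R + b * \<rho>"
    if h: "0 < h" "h < h0" "h * real i \<le> R" "h * real j \<le> R" for h i j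
  proof -
    have e: "(L * p + a) * q + b * p \<le> \<delta> / 8 + L * \<rho> * R + b * \<rho>" if "0 \<le> p" "p \<le> \<rho>" "0 \<le> q" "q \<le> R" for p q
    proof -
      have "(L * p + a) * q \<le> (L * \<rho> + a) * R"
        using that L_nonneg a by (intro mult_mono add_mono mult_left_mono) auto
      moreover have "b * p \<le> b * \<rho>" using that b by (intro mult_left_mono) auto
      ultimately show ?thesis using a by (simp add: algebra_simps)
    qed
    note na = U_near_axis(1,2)[OF h(1) M(2,3) less_imp_le[OF M(1)] a(1) h(3,4), folded b_def]
    have nn: "0 \<le> h * real i" "0 \<le> h * real j" using h by auto
    show "U h i j \<le> \<phi> (h * real i, 0) + \<delta> / 4 + L * \<rho> * R + b * \<rho>" if "h * real j \<le> \<rho>"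
      using na(1) e[OF nn(2) that nn(1) h(3)] ax(2)[OF h(1-3)] by linarith
    show "U h i j \<le> \<phi> (0, h * real j) + \<delta> / 4 + L * \<rho> * R + b * \<rho>" if "h * real i \<le> \<rho>"
      using na(2) e[OF nn(1) that nn(2) h(4)] ax(4)[OF h(1,2,4)] by linarith
  qed
  show thesis
  proof (rule that[OF \<rho>(1) h0(1)])
    fix h k x y
    assume h: "0 < h" "h < h0" and k: "0 < k" "k < h0" and x: "x \<in> grid h R" and y: "y \<in> grid k R"
      and d: "dist x y \<le> \<rho>" and bd: "x \<in> quadrant_boundary \<or> y \<in> quadrant_boundary"
    obtain i j where ij: "x = (h * real i, h * real j)" "h * real i \<le> R" "h * real j \<le> R"
      by (rule gridE[OF x])
    obtain p q where pq: "y = (k * real p, k * real q)" "k * real p \<le> R" "k * real q \<le> R"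
      by (rule gridE[OF y])
    have close: "\<bar>h * real i - k * real p\<bar> \<le> \<rho>" "\<bar>h * real j - k * real q\<bar> \<le> \<rho>"
      using coord_le_dist[of x y] d ij pq by auto
    have nn: "0 \<le> h * real i" "0 \<le> h * real j" "0 \<le> k * real p" "0 \<le> k * real q" using h k by auto
    have M\<rho>: "M * \<bar>h * real i - k * real p\<bar> \<le> M * \<rho>" "M * \<bar>h * real j - k * real q\<bar> \<le> M * \<rho>"
      using close M by (auto intro!: mult_left_mono)
    have lip: "\<phi> (h * real i, 0) \<le> \<phi> (k * real p, 0) + M * \<rho>" "\<phi> (0, h * real j) \<le> \<phi> (0, k * real q) + M * \<rho>"
    proof -
      have "\<phi> ((h * real i) *\<^sub>R (1, 0)) \<le> \<phi> ((k * real p) *\<^sub>R (1, 0)) + M * \<bar>h * real i - k * real p\<bar>"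
        by (rule boundary_value_lipschitz[OF M(2)]) (use nn ij(2) pq(2) in simp_all)
      then show "\<phi> (h * real i, 0) \<le> \<phi> (k * real p, 0) + M * \<rho>" using M\<rho>(1) by simp
      have "\<phi> ((h * real j) *\<^sub>R (0, 1)) \<le> \<phi> ((k * real q) *\<^sub>R (0, 1)) + M * \<bar>h * real j - k * real q\<bar>"
        by (rule boundary_value_lipschitz[OF M(2)]) (use nn ij(3) pq(3) in simp_all)
      then show "\<phi> (0, h * real j) \<le> \<phi> (0, k * real q) + M * \<rho>" using M\<rho>(2) by simp
    qed
    consider "h * real j = 0 \<or> k * real q = 0" | "h * real i = 0 \<or> k * real p = 0"
      using bd by (auto simp: quadrant_boundary_eq ij pq)
    then have "U h i j - U k p q \<le> \<delta>"
    proof cases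
      case 1
      then have "h * real j \<le> \<rho>" using close(2) nn \<rho>(1) by linarith
      then show ?thesis
        using up(1)[OF h ij(2,3)] low(1)[OF k pq(2,3)] lip(1) \<rho>' \<delta> by linarith
    next
      case 2
      then have "h * real i \<le> \<rho>" using close(1) nn \<rho>(1) by linarith
      then show ?thesis
        using up(2)[OF h ij(2,3)] low(2)[OF k pq(2,3)] lip(2) \<rho>' \<delta> by linarith
    qed
    then show "scheme_ext \<mu> \<mu>\<^sub>s \<sigma> h x - scheme_ext \<mu> \<mu>\<^sub>s \<sigma> k y \<le> \<delta>"
      using h k by (simp add: ij pq scheme_ext_grid)
  qed
qed

section \<open>Comparison of two mesh sizes\<close>

abbreviation S where "S \<equiv> scheme_ext \<mu> \<mu>\<^sub>s \<sigma>"

lemma grid_predecessors: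
  assumes h: "0 < h" and x: "(h * real (Suc i), h * real (Suc j)) \<in> grid h R"
  shows "(h * real i, h * real (Suc j)) \<in> grid h R" "(h * real (Suc i), h * real j) \<in> grid h R"
proof -
  have "h * real n \<le> R" if "h * real (Suc n) \<le> R" for n
    using order_trans[OF mult_left_mono[of "real n" "real (Suc n)" h] that] h by simp
  then show "(h * real i, h * real (Suc j)) \<in> grid h R" "(h * real (Suc i), h * real j) \<in> grid h R"
    using x h unfolding grid_def square_def mem_Collect_eq mem_Times_iff fst_conv snd_conv atLeastAtMost_iff
    by (blast intro: mult_nonneg_nonneg of_nat_0_le_iff less_imp_le)+
qed

text \<open>The increments minus \<open>h \<mu>\<close> are nonnegative and have the product \<open>h\<^sup>2 \<sigma>\<^sup>2\<close>, so lower bounds for them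
turn into an upper bound for the Hamiltonian.\<close>

lemma scheme_hamiltonian_le:
  fixes i j :: nat and p :: "real \<times> real"
  assumes h: "0 < h"
    and D: "h * (fst p - \<eta>) \<le> U h (Suc i) (Suc j) - U h i (Suc j)"
      "h * (snd p - \<eta>) \<le> U h (Suc i) (Suc j) - U h (Suc i) j"
  defines "x \<equiv> (h * real (Suc i), h * real (Suc j))"
  shows "hamiltonian \<mu> x (p - (\<eta>, \<eta>)) \<le> (\<sigma> x)\<^sup>2"
proof -
  define a where "a = U h (Suc i) (Suc j) - U h i (Suc j) - h * \<mu> x"
  define b where "b = U h (Suc i) (Suc j) - U h (Suc i) j - h * \<mu> x"
  have ab: "0 \<le> a" "0 \<le> b" "a * b = h\<^sup>2 * (\<sigma> x)\<^sup>2"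
    using U_step[OF h, of i j] by (simp_all only: a_def b_def x_def)
  have "h * (fst p - \<eta> - \<mu> x) \<le> a" "h * (snd p - \<eta> - \<mu> x) \<le> b"
    using D by (simp_all add: a_def b_def algebra_simps)
  then have "h * max (fst p - \<eta> - \<mu> x) 0 \<le> a" "h * max (snd p - \<eta> - \<mu> x) 0 \<le> b"
    using ab by (auto simp: max_def)
  then have "(h * max (fst p - \<eta> - \<mu> x) 0) * (h * max (snd p - \<eta> - \<mu> x) 0) \<le> a * b"
    using ab h by (intro mult_mono) auto
  then have "h\<^sup>2 * hamiltonian \<mu> x (p - (\<eta>, \<eta>)) \<le> h\<^sup>2 * (\<sigma> x)\<^sup>2"
    by (simp add: ab hamiltonian_def power2_eq_square algebra_simps)
  then show ?thesis using h by simp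
qed

text \<open>The increments are at least \<open>h \<mu> \<ge> 0\<close>, so upper bounds for them also force the gradient to be
nonnegative up to \<open>\<eta>\<close>.\<close>

lemma scheme_hamiltonian_ge:
  fixes i j :: nat and p :: "real \<times> real"
  assumes h: "0 < h"
    and D: "U h (Suc i) (Suc j) - U h i (Suc j) \<le> h * (fst p + \<eta>)"
      "U h (Suc i) (Suc j) - U h (Suc i) j \<le> h * (snd p + \<eta>)"
  defines "x \<equiv> (h * real (Suc i), h * real (Suc j))"
  shows "- \<eta> \<le> fst p \<and> - \<eta> \<le> snd p \<and> (\<sigma> x)\<^sup>2 \<le> hamiltonian \<mu> x (p + (\<eta>, \<eta>))"
proof -
  define a where "a = U h (Suc i) (Suc j) - U h i (Suc j) - h * \<mu> x"
  define b where "b = U h (Suc i) (Suc j) - U h (Suc i) j - h * \<mu> x"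
  have ab: "0 \<le> a" "0 \<le> b" "a * b = h\<^sup>2 * (\<sigma> x)\<^sup>2"
    using U_step[OF h, of i j] by (simp_all only: a_def b_def x_def)
  have "0 \<le> \<mu> x" using \<mu>_nonneg h by (simp add: x_def quadrant_def)
  have c: "a \<le> h * (fst p + \<eta> - \<mu> x)" "b \<le> h * (snd p + \<eta> - \<mu> x)"
    using D by (simp_all add: a_def b_def algebra_simps)
  then have "0 \<le> h * (fst p + \<eta> - \<mu> x)" "0 \<le> h * (snd p + \<eta> - \<mu> x)" using ab by linarith+
  then have c0: "0 \<le> fst p + \<eta> - \<mu> x" "0 \<le> snd p + \<eta> - \<mu> x" using h by (simp_all add: zero_le_mult_iff)
  have "a * b \<le> (h * (fst p + \<eta> - \<mu> x)) * (h * (snd p + \<eta> - \<mu> x))"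
    using ab c by (intro mult_mono) auto
  then have "h\<^sup>2 * (\<sigma> x)\<^sup>2 \<le> h\<^sup>2 * hamiltonian \<mu> x (p + (\<eta>, \<eta>))"
  proof -
    have "hamiltonian \<mu> x (p + (\<eta>, \<eta>)) = (fst p + \<eta> - \<mu> x) * (snd p + \<eta> - \<mu> x)"
      using c0 by (simp add: hamiltonian_def max_absorb1)
    with \<open>a * b \<le> _\<close> show ?thesis by (simp add: ab power2_eq_square mult.assoc mult.left_commute)
  qed
  then show ?thesis using h c0 \<open>0 \<le> \<mu> x\<close> by simp
qed

lemma grid_interiorE:
  assumes "x \<in> grid h R" "0 < fst x" "0 < snd x"
  obtains i j where "x = (h * real (Suc i), h * real (Suc j))"
  using gridE[OF assms(1)] assms(2,3)
  by (metis fst_conv snd_conv mult_zero_right of_nat_0 less_irrefl not0_implies_Suc)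

lemma scheme_subsolution:
  assumes h: "0 < h" and \<eta>: "\<kappa> * h \<le> \<eta>"
  shows "subsolution_on \<mu> \<sigma> R' \<kappa> \<eta> (grid h R) (S h)"
  unfolding subsolution_on_def
proof (intro ballI allI impI, elim conjE)
  fix x p
  assume x: "x \<in> grid h R" and pos: "0 < fst x" "0 < snd x"
    and test: "\<forall>y\<in>grid h R. S h y \<le> S h x + p \<bullet> (y - x) + \<kappa> * (dist y x)\<^sup>2"
  obtain i j where ij: "x = (h * real (Suc i), h * real (Suc j))"
    using grid_interiorE[OF x pos] .
  define y1 where "y1 = (h * real i, h * real (Suc j))"
  define y2 where "y2 = (h * real (Suc i), h * real j)"
  have "y1 \<in> grid h R" "y2 \<in> grid h R"
    using grid_predecessors[OF h x[unfolded ij]] unfolding y1_def y2_def by blast+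
  then have "S h y1 \<le> S h x - h * fst p + \<kappa> * h\<^sup>2" "S h y2 \<le> S h x - h * snd p + \<kappa> * h\<^sup>2"
    using test h by (auto simp: ij y1_def y2_def inner_prod_def dist_sq_prod algebra_simps)
  then have D: "h * (fst p - \<kappa> * h) \<le> U h (Suc i) (Suc j) - U h i (Suc j)"
    "h * (snd p - \<kappa> * h) \<le> U h (Suc i) (Suc j) - U h (Suc i) j"
    using h by (simp_all add: ij y1_def y2_def scheme_ext_grid power2_eq_square algebra_simps del: of_nat_Suc)
  have "h * \<kappa> * h \<le> h * \<eta>" using mult_left_mono[OF \<eta>, of h] h by (simp add: mult.assoc)
  then have "h * (fst p - \<eta>) \<le> U h (Suc i) (Suc j) - U h i (Suc j)"
    "h * (snd p - \<eta>) \<le> U h (Suc i) (Suc j) - U h (Suc i) j"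
    using D by (simp_all add: algebra_simps)
  then show "hamiltonian \<mu> x (p - (\<eta>, \<eta>)) \<le> (\<sigma> x)\<^sup>2"
    unfolding ij by (rule scheme_hamiltonian_le[OF h])
qed

lemma scheme_supersolution:
  assumes h: "0 < h" and \<eta>: "\<kappa> * h \<le> \<eta>"
  shows "supersolution_on \<mu> \<sigma> R' \<kappa> \<eta> (grid h R) (S h)"
  unfolding supersolution_on_def
proof (intro ballI allI impI, elim conjE)
  fix x p
  assume x: "x \<in> grid h R" and pos: "0 < fst x" "0 < snd x"
    and test: "\<forall>y\<in>grid h R. S h y \<ge> S h x + p \<bullet> (y - x) - \<kappa> * (dist y x)\<^sup>2"
  obtain i j where ij: "x = (h * real (Suc i), h * real (Suc j))"
    using grid_interiorE[OF x pos] .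
  define y1 where "y1 = (h * real i, h * real (Suc j))"
  define y2 where "y2 = (h * real (Suc i), h * real j)"
  have "y1 \<in> grid h R" "y2 \<in> grid h R"
    using grid_predecessors[OF h x[unfolded ij]] unfolding y1_def y2_def by blast+
  then have "S h y1 \<ge> S h x - h * fst p - \<kappa> * h\<^sup>2" "S h y2 \<ge> S h x - h * snd p - \<kappa> * h\<^sup>2"
    using test h by (auto simp: ij y1_def y2_def inner_prod_def dist_sq_prod algebra_simps)
  then have D: "U h (Suc i) (Suc j) - U h i (Suc j) \<le> h * (fst p + \<kappa> * h)"
    "U h (Suc i) (Suc j) - U h (Suc i) j \<le> h * (snd p + \<kappa> * h)"
    using h by (simp_all add: ij y1_def y2_def scheme_ext_grid power2_eq_square algebra_simps del: of_nat_Suc)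
  have "h * \<kappa> * h \<le> h * \<eta>" using mult_left_mono[OF \<eta>, of h] h by (simp add: mult.assoc)
  then have "U h (Suc i) (Suc j) - U h i (Suc j) \<le> h * (fst p + \<eta>)"
    "U h (Suc i) (Suc j) - U h (Suc i) j \<le> h * (snd p + \<eta>)"
    using D by (simp_all add: algebra_simps)
  then show "- \<eta> \<le> fst p \<and> - \<eta> \<le> snd p \<and> (\<sigma> x)\<^sup>2 \<le> hamiltonian \<mu> x (p + (\<eta>, \<eta>))"
    unfolding ij by (rule scheme_hamiltonian_ge[OF h])
qed

lemma scheme_bounded:
  assumes R: "0 \<le> R"
  obtains C where "0 < C" "\<And>h x. 0 < h \<Longrightarrow> h \<le> 1 \<Longrightarrow> x \<in> grid h R \<Longrightarrow> S h x \<le> C"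
proof -
  obtain M where M: "0 < M" "\<And>x. x \<in> square R \<Longrightarrow> rate x \<le> M" "\<And>x. x \<in> square R \<Longrightarrow> \<sigma> x \<le> M"
    using bounded_on_square by blast
  define C where "C = 2 * M + 2 * M * R + (L * R + 1) * R + (2 * M + M\<^sup>2) * R"
  have "0 < C" using M R L_nonneg by (auto simp: C_def intro!: add_pos_nonneg)
  moreover have "S h x \<le> C" if h: "0 < h" "h \<le> 1" and x: "x \<in> grid h R" for h x
  proof -
    obtain i j where ij: "x = (h * real i, h * real j)" "h * real i \<le> R" "h * real j \<le> R"
      using gridE[OF x] .
    note na = U_near_axis(1,3)[OF h(1) M(2,3) less_imp_le[OF M(1)] zero_less_one ij(2,3)]
    have "(0, 0) \<in> square R" using R by (simp add: square_def)
    then have "h * rate (0, 0) \<le> 1 * M" "h * \<sigma> (0, 0) \<le> 1 * M"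
      using M(2,3)[of "(0, 0)"] M(1) h rate_nonneg[of "(0, 0)"] \<sigma>_nonneg[of "(0, 0)"]
      by (intro mult_mono; simp add: quadrant_def)+
    then have "U h 0 0 \<le> 2 * M" using U_origin[OF h(1)] by simp
    moreover have "2 * M * (h * real i) \<le> 2 * M * R" "(2 * M + M\<^sup>2) * (h * real j) \<le> (2 * M + M\<^sup>2) * R"
      using M ij by (auto intro!: mult_left_mono)
    moreover have "(L * (h * real j) + 1) * (h * real i) \<le> (L * R + 1) * R"
      using L_nonneg R ij h by (intro mult_mono add_mono mult_left_mono) auto
    ultimately have "U h i j \<le> C" using na by (simp add: C_def)
    then show ?thesis using h by (simp add: ij scheme_ext_grid)
  qed
  ultimately show thesis by (rule that)
qed

text \<open>The estimate for the scheme is applied with \<open>\<kappa> = 2\<^sup>N + C\<close>, so the bound \<open>h0\<close> on the mesh sizes, which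
must ensure \<open>\<kappa> h \<le> \<eta>\<close>, is chosen after \<open>N\<close>.\<close>

lemma scheme_doubling:
  assumes T: "0 \<le> T" and \<epsilon>: "0 < \<epsilon>"
  obtains A h0 where "0 \<le> A" "0 < h0"
    "\<And>h k x y. 0 < h \<Longrightarrow> h < h0 \<Longrightarrow> 0 < k \<Longrightarrow> k < h0 \<Longrightarrow> x \<in> grid h (T + 2) \<Longrightarrow> y \<in> grid k (T + 2) \<Longrightarrow>
      y \<in> square T \<Longrightarrow> S h x - S k y \<le> \<epsilon> + A * (dist x y)\<^sup>2"
proof -
  have T2: "0 \<le> T + 2" using T by simp
  obtain C where C: "0 < C" "\<And>h x. 0 < h \<Longrightarrow> h \<le> 1 \<Longrightarrow> x \<in> grid h (T + 2) \<Longrightarrow> S h x \<le> C"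
    using scheme_bounded[OF T2] by blast
  obtain \<rho> h1 where \<rho>: "0 < \<rho>" "0 < h1"
    "\<And>h k x y. 0 < h \<Longrightarrow> h < h1 \<Longrightarrow> 0 < k \<Longrightarrow> k < h1 \<Longrightarrow> x \<in> grid h (T + 2) \<Longrightarrow> y \<in> grid k (T + 2) \<Longrightarrow>
      dist x y \<le> \<rho> \<Longrightarrow> x \<in> quadrant_boundary \<or> y \<in> quadrant_boundary \<Longrightarrow> S h x - S k y \<le> \<epsilon> / 2"
    using scheme_boundary_gap[OF T2 half_gt_zero[OF \<epsilon>]] by blast
  obtain e s N where e: "0 < e" "2 * e * T \<le> \<epsilon> / 2" and s: "0 < s" "s \<le> 1" "s \<le> \<rho>"
    and sL: "(L' + 4 * L) * s \<le> e\<^sup>2 / 4" and N: "2 * C \<le> real N * s\<^sup>2"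
    by (rule doubling_constants[OF L_nonneg T C(1) \<epsilon> \<rho>(1)])
  define K where "K = 2 ^ N + C"
  define Q where "Q = 8 * 2 ^ N + 4 + 2 * L"
  have KQ: "0 < K" "0 < Q"
    using C(1) L_nonneg zero_less_power[of "2::real" N] unfolding K_def Q_def by linarith+
  define \<eta> where "\<eta> = min 1 (e\<^sup>2 / 4 / Q)"
  have \<eta>: "0 < \<eta>" "\<eta> \<le> 1" "\<eta> \<le> e\<^sup>2 / 4 / Q" using KQ(2) e(1) by (simp_all add: \<eta>_def)
  have \<eta>Q: "\<eta> * Q \<le> e\<^sup>2 / 4" using \<eta>(3) KQ(2) by (simp only: pos_le_divide_eq)
  define h0 where "h0 = min 1 (min h1 (\<eta> / K))"
  have h0: "0 < h0" using \<rho>(2) \<eta>(1) KQ(1) by (simp add: h0_def)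
  have hh: "h \<le> 1" "h < h1" "K * h \<le> \<eta>" if "0 < h" "h < h0" for h
  proof -
    show "h \<le> 1" "h < h1" using that(2) by (simp_all add: h0_def)
    have "h \<le> \<eta> / K" using that(2) by (simp add: h0_def)
    then show "K * h \<le> \<eta>" using KQ(1) by (simp only: pos_le_divide_eq mult.commute)
  qed
  show thesis
  proof (rule that[of "2 ^ N" h0])
    fix h k x y
    assume h: "0 < h" "h < h0" and k: "0 < k" "k < h0" and x: "x \<in> grid h (T + 2)" and y: "y \<in> grid k (T + 2)" "y \<in> square T"
    have "S h x - S k y \<le> \<epsilon> / 2 + 2 * e * T + 2 ^ N * (dist x y)\<^sup>2"
    proof (rule doubling_estimate[OF \<mu>_lipschitz \<sigma>_lipschitz _ _ T C(1) e(1) _ _ _ s(1), where K = K and \<eta> = \<eta> and X = "grid h (T + 2)" and Y = "grid k (T + 2)"])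
      show "subsolution_on \<mu> \<sigma> (T + 2) K \<eta> (grid h (T + 2)) (S h)"
        by (rule scheme_subsolution[OF h(1) hh(3)[OF h]])
      show "supersolution_on \<mu> \<sigma> (T + 2) K \<eta> (grid k (T + 2)) (S k)"
        by (rule scheme_supersolution[OF k(1) hh(3)[OF k]])
      show "compact (grid h (T + 2))" "compact (grid k (T + 2))" "continuous_on (grid h (T + 2)) (S h)"
          "continuous_on (grid k (T + 2)) (S k)"
        using finite_grid h k by (auto intro: finite_imp_compact continuous_on_finite)
      show "grid h (T + 2) \<subseteq> square (T + 2)" "grid k (T + 2) \<subseteq> square (T + 2)" by (auto simp: grid_def)
      show "S h x - S k y \<le> C" if "x \<in> grid h (T + 2)" "y \<in> grid k (T + 2)" for x y
      proof -
        have "S h x \<le> C" by (rule C(2)[OF h(1) hh(1)[OF h] that(1)])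
        moreover have "0 \<le> S k y"
          using gridE[OF that(2)] U_nonneg[OF k(1)] scheme_ext_grid[OF k(1)] by metis
        ultimately show ?thesis by linarith
      qed
      show "S h x - S k y \<le> \<epsilon> / 2" if "x \<in> grid h (T + 2)" "y \<in> grid k (T + 2)" "dist x y \<le> s"
        "x \<in> quadrant_boundary \<or> y \<in> quadrant_boundary" for x y
        using \<rho>(3)[OF h(1) hh(2)[OF h] k(1) hh(2)[OF k] that(1,2) _ that(4)] that(3) s(3) by simp
      show "\<forall>x\<in>quadrant. 0 \<le> \<mu> x" using \<mu>_nonneg by blast
      show "\<forall>x\<in>open_quadrant. \<sigma> x = 0 \<longrightarrow> \<mu> x = 0" using \<mu>_eq_0 by blast
      show "0 \<le> \<epsilon> / 2" "0 \<le> \<eta>" "2 ^ N + C \<le> K" using \<epsilon> \<eta>(1) by (simp_all add: K_def)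
      show "\<eta> * (8 * 2 ^ N + 4 + 2 * L) \<le> e\<^sup>2 / 4" using \<eta>Q by (simp only: Q_def)
    qed (fact N s sL \<eta> x y)+
    then show "S h x - S k y \<le> \<epsilon> + 2 ^ N * (dist x y)\<^sup>2" using e(2) by linarith
  qed (use h0 in auto)
qed

lemma scheme_ext_floor:
  assumes h: "0 < h" and x: "x \<in> quadrant"
  obtains i j where "S h x = U h i j" "h * real i \<le> fst x" "fst x < h * real i + h" "h * real j \<le> snd x"
    "snd x < h * real j + h" "i = nat \<lfloor>inverse h * fst x\<rfloor>" "j = nat \<lfloor>inverse h * snd x\<rfloor>"
proof -
  have nn: "0 \<le> inverse h * fst x" "0 \<le> inverse h * snd x" using h x by (auto simp: quadrant_def)
  define i where "i = nat \<lfloor>inverse h * fst x\<rfloor>"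
  define j where "j = nat \<lfloor>inverse h * snd x\<rfloor>"
  have i: "int i = \<lfloor>inverse h * fst x\<rfloor>" "int j = \<lfloor>inverse h * snd x\<rfloor>" using nn by (auto simp: i_def j_def)
  have b: "h * real n \<le> t \<and> t < h * real n + h" if "int n = \<lfloor>inverse h * t\<rfloor>" for n t
  proof -
    have "real n \<le> inverse h * t" "inverse h * t < real n + 1"
      using that by (metis of_int_floor_le of_int_of_nat_eq) (metis floor_correct of_int_add of_int_1 of_int_of_nat_eq that)
    then show ?thesis using h by (simp add: field_simps)
  qed
  show thesis
  proof (rule that[of i j])
    show "S h x = U h i j" by (simp add: scheme_ext_def U_def i)
  qed (use b[OF i(1)] b[OF i(2)] in \<open>auto simp: i_def j_def\<close>)
qed

lemma scheme_ext_on_grid: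
  assumes h: "0 < h" and x: "x \<in> square T"
  obtains z where "z \<in> grid h T" "S h z = S h x" "dist z x \<le> 2 * h"
proof -
  have "x \<in> quadrant" using x square_subset_quadrant by blast
  then obtain i j where ij: "S h x = U h i j" "h * real i \<le> fst x" "fst x < h * real i + h" "h * real j \<le> snd x"
    "snd x < h * real j + h" using scheme_ext_floor[OF h] by metis
  have "dist (h * real i, h * real j) x \<le> \<bar>h * real i - fst x\<bar> + \<bar>h * real j - snd x\<bar>"
    using sqrt_sum_squares_le_sum_abs[of "h * real i - fst x" "h * real j - snd x"]
    by (simp add: dist_prod_def dist_real_def)
  also have "\<dots> \<le> 2 * h" using ij by linarith
  finally show thesis
    using ij x h by (intro that[of "(h * real i, h * real j)"]) (auto simp: grid_def square_def scheme_ext_grid)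
qed

text \<open>The piecewise constant extension differs from the grid function only by moving each point by at
most \<open>2 h\<close> in distance. For \<open>x = y\<close> the estimate says that the schemes are Cauchy, for \<open>h = k\<close> tending
to zero it gives a modulus of continuity of the limit.\<close>

lemma scheme_close:
  assumes T: "0 \<le> T" and \<epsilon>: "0 < \<epsilon>"
  obtains A h0 where "0 \<le> A" "0 < h0"
    "\<And>h k x y. 0 < h \<Longrightarrow> h < h0 \<Longrightarrow> 0 < k \<Longrightarrow> k < h0 \<Longrightarrow> x \<in> square T \<Longrightarrow> y \<in> square T \<Longrightarrow>
       S h x - S k y \<le> \<epsilon> + A * (dist x y + 2 * h + 2 * k)\<^sup>2"
proof -
  obtain A h0 where A: "0 \<le> A" "0 < h0"
    "\<And>h k x y. 0 < h \<Longrightarrow> h < h0 \<Longrightarrow> 0 < k \<Longrightarrow> k < h0 \<Longrightarrow> x \<in> grid h (T + 2) \<Longrightarrow> y \<in> grid k (T + 2) \<Longrightarrow>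
      y \<in> square T \<Longrightarrow> S h x - S k y \<le> \<epsilon> + A * (dist x y)\<^sup>2"
    using scheme_doubling[OF T \<epsilon>] by blast
  have sub: "grid h T \<subseteq> grid h (T + 2)" "grid h T \<subseteq> square T" for h by (auto simp: grid_def square_def)
  show thesis
  proof (rule that[OF A(1,2)])
    fix h k x y
    assume h: "0 < h" "h < h0" and k: "0 < k" "k < h0" and x: "x \<in> square T" and y: "y \<in> square T"
    obtain x' where x': "x' \<in> grid h T" "S h x' = S h x" "dist x' x \<le> 2 * h" using scheme_ext_on_grid[OF h(1) x] .
    obtain y' where y': "y' \<in> grid k T" "S k y' = S k y" "dist y' y \<le> 2 * k" using scheme_ext_on_grid[OF k(1) y] .
    have "S h x' - S k y' \<le> \<epsilon> + A * (dist x' y')\<^sup>2"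
      using A(3)[OF h k] x'(1) y'(1) sub by blast
    also have "dist x' y' \<le> dist x y + 2 * h + 2 * k"
      using dist_triangle[of x' y' x] dist_triangle[of x y' y] x' y' by (simp add: dist_commute)
    then have "A * (dist x' y')\<^sup>2 \<le> A * (dist x y + 2 * h + 2 * k)\<^sup>2"
      using A(1) by (intro mult_left_mono power_mono) auto
    finally show "S h x - S k y \<le> \<epsilon> + A * (dist x y + 2 * h + 2 * k)\<^sup>2"
      using x' y' by simp
  qed
qed

section \<open>The limit function\<close>

lemma scheme_cauchy:
  assumes T: "0 \<le> T" and \<epsilon>: "0 < \<epsilon>"
  obtains h0 where "0 < h0"
    "\<And>h k x. 0 < h \<Longrightarrow> h < h0 \<Longrightarrow> 0 < k \<Longrightarrow> k < h0 \<Longrightarrow> x \<in> square T \<Longrightarrow> \<bar>S h x - S k x\<bar> \<le> \<epsilon>"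
proof -
  obtain A h1 where A: "0 \<le> A" "0 < h1"
    "\<And>h k x y. 0 < h \<Longrightarrow> h < h1 \<Longrightarrow> 0 < k \<Longrightarrow> k < h1 \<Longrightarrow> x \<in> square T \<Longrightarrow> y \<in> square T \<Longrightarrow>
       S h x - S k y \<le> \<epsilon> / 2 + A * (dist x y + 2 * h + 2 * k)\<^sup>2"
    using scheme_close[OF T half_gt_zero[OF \<epsilon>]] by blast
  define h0 where "h0 = min h1 (min 1 (\<epsilon> / (32 * (A + 1))))"
  have A1: "0 < 32 * (A + 1)" using A(1) by simp
  have "0 < \<epsilon> / (32 * (A + 1))" using \<epsilon> A1 by (rule divide_pos_pos)
  then have h0: "0 < h0" using A(2) by (simp add: h0_def)
  have bound: "A * (0 + 2 * h + 2 * k)\<^sup>2 \<le> \<epsilon> / 2" if h: "0 < h" "h < h0" and k: "0 < k" "k < h0" for h k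
  proof -
    have "h0 \<le> 1" "h0 \<le> \<epsilon> / (32 * (A + 1))" by (simp_all add: h0_def)
    then have h0': "h0 * (32 * (A + 1)) \<le> \<epsilon>" using pos_le_divide_eq[OF A1] by blast
    have "(0 + 2 * h + 2 * k)\<^sup>2 \<le> (4 * h0)\<^sup>2" using h k by (intro power_mono) auto
    also have "\<dots> = 16 * (h0 * h0)" by (simp add: power2_eq_square)
    also have "\<dots> \<le> 16 * (h0 * 1)" using h0 \<open>h0 \<le> 1\<close> by (intro mult_left_mono) auto
    finally have "A * (0 + 2 * h + 2 * k)\<^sup>2 \<le> A * (16 * h0)" using A(1) by (intro mult_left_mono) auto
    then show ?thesis using h0' h0 by (simp add: algebra_simps)
  qed
  show thesis
  proof (rule that[OF h0])
    fix h k x assume h: "0 < h" "h < h0" and k: "0 < k" "k < h0" and x: "x \<in> square T"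
    have lt: "h < h1" "k < h1" using h k by (simp_all add: h0_def)
    have "S h x - S k x \<le> \<epsilon> / 2 + A * (dist x x + 2 * h + 2 * k)\<^sup>2"
      "S k x - S h x \<le> \<epsilon> / 2 + A * (dist x x + 2 * k + 2 * h)\<^sup>2"
      by (rule A(3); fact)+
    then show "\<bar>S h x - S k x\<bar> \<le> \<epsilon>" using bound[OF h k] bound[OF k h] by simp
  qed
qed

text \<open>The limit along one particular sequence of mesh sizes, which by the Cauchy property is the limit
along all of them.\<close>

definition V where "V x = lim (\<lambda>n. S (inverse (real (Suc n))) x)"

lemma scheme_limit:
  assumes T: "0 \<le> T" and \<epsilon>: "0 < \<epsilon>"
  obtains h0 where "0 < h0" "\<And>h x. 0 < h \<Longrightarrow> h < h0 \<Longrightarrow> x \<in> square T \<Longrightarrow> \<bar>S h x - V x\<bar> \<le> \<epsilon>"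
proof -
  define X where "X x n = S (inverse (real (Suc n))) x" for x n
  have ev: "\<forall>\<^sub>F n in sequentially. 0 < inverse (real (Suc n)) \<and> inverse (real (Suc n)) < h0" if "0 < h0" for h0
  proof -
    have "\<forall>\<^sub>F n in sequentially. inverse (real (Suc n)) < h0"
      using order_tendstoD(2)[OF LIMSEQ_inverse_real_of_nat that] .
    then show ?thesis by eventually_elim simp
  qed
  have conv: "X x \<longlonglongrightarrow> V x" if x: "x \<in> square T" for x
  proof -
    have "Cauchy (X x)"
    proof (rule metric_CauchyI)
      fix e :: real assume "0 < e"
      then obtain h0 where h0: "0 < h0" "\<And>h k. 0 < h \<Longrightarrow> h < h0 \<Longrightarrow> 0 < k \<Longrightarrow> k < h0 \<Longrightarrow> \<bar>S h x - S k x\<bar> \<le> e / 2"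
        using scheme_cauchy[OF T half_gt_zero[OF \<open>0 < e\<close>]] x by metis
      from ev[OF h0(1)] obtain N where N: "\<And>n. N \<le> n \<Longrightarrow> 0 < inverse (real (Suc n)) \<and> inverse (real (Suc n)) < h0"
        unfolding eventually_sequentially by blast
      have "dist (X x m) (X x n) < e" if "N \<le> m" "N \<le> n" for m n
        using h0(2)[of "inverse (real (Suc m))" "inverse (real (Suc n))"] N[OF that(1)] N[OF that(2)] \<open>0 < e\<close>
        unfolding X_def dist_real_def by linarith
      then show "\<exists>M. \<forall>m\<ge>M. \<forall>n\<ge>M. dist (X x m) (X x n) < e" by blast
    qed
    then show ?thesis
      unfolding V_def X_def by (simp add: Cauchy_convergent_iff convergent_LIMSEQ_iff)
  qed
  obtain h0 where h0: "0 < h0"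
    "\<And>h k x. 0 < h \<Longrightarrow> h < h0 \<Longrightarrow> 0 < k \<Longrightarrow> k < h0 \<Longrightarrow> x \<in> square T \<Longrightarrow> \<bar>S h x - S k x\<bar> \<le> \<epsilon>"
    using scheme_cauchy[OF T \<epsilon>] by blast
  show thesis
  proof (rule that[OF h0(1)])
    fix h x assume h: "0 < h" "h < h0" and x: "x \<in> square T"
    show "\<bar>S h x - V x\<bar> \<le> \<epsilon>"
    proof (rule tendsto_upperbound)
      show "(\<lambda>n. \<bar>S h x - X x n\<bar>) \<longlonglongrightarrow> \<bar>S h x - V x\<bar>"
        by (intro tendsto_intros conv[OF x])
      show "\<forall>\<^sub>F n in sequentially. \<bar>S h x - X x n\<bar> \<le> \<epsilon>"
        using ev[OF h0(1)] by eventually_elim (use h0(2)[OF h _ _ x] in \<open>simp add: X_def\<close>)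
    qed simp
  qed
qed

lemma quadrant_square: "x \<in> quadrant \<Longrightarrow> 0 \<le> fst x + snd x \<and> x \<in> square (fst x + snd x)"
  by (auto simp: quadrant_def square_def)

lemma scheme_tendsto:
  assumes x: "x \<in> quadrant"
  shows "((\<lambda>h. S h x) \<longlongrightarrow> V x) (at_right 0)"
proof (rule tendstoI)
  fix e :: real assume "0 < e"
  obtain h0 where "0 < h0" "\<And>h y. 0 < h \<Longrightarrow> h < h0 \<Longrightarrow> y \<in> square (fst x + snd x) \<Longrightarrow> \<bar>S h y - V y\<bar> \<le> e / 2"
    using scheme_limit[of "fst x + snd x" "e / 2"] quadrant_square[OF x] half_gt_zero[OF \<open>0 < e\<close>] by blast
  then show "\<forall>\<^sub>F h in at_right 0. dist (S h x) (V x) < e"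
    using quadrant_square[OF x] \<open>0 < e\<close> unfolding eventually_at_right_field dist_real_def
    by (intro exI[of _ h0]) fastforce
qed

lemma limit_continuous: "continuous_on quadrant V"
  unfolding continuous_on_iff
proof (intro ballI allI impI)
  fix x and e :: real assume x: "x \<in> quadrant" and e: "0 < e"
  define T where "T = fst x + snd x + 1"
  have T: "0 \<le> T" using quadrant_square[OF x] by (simp add: T_def)
  have "0 < e / 4" using e by simp
  then obtain A h0 where A: "0 \<le> A" "0 < h0"
    "\<And>h k y z. 0 < h \<Longrightarrow> h < h0 \<Longrightarrow> 0 < k \<Longrightarrow> k < h0 \<Longrightarrow> y \<in> square T \<Longrightarrow> z \<in> square T \<Longrightarrow>
       S h y - S k z \<le> e / 4 + A * (dist y z + 2 * h + 2 * k)\<^sup>2"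
    using scheme_close[OF T] by blast
  have mod: "V y - V z \<le> e / 4 + A * (dist y z)\<^sup>2" if yz: "y \<in> square T" "z \<in> square T" for y z
  proof -
    have q: "y \<in> quadrant" "z \<in> quadrant" using yz square_subset_quadrant by auto
    have "((\<lambda>h. e / 4 + A * (dist y z + 2 * h + 2 * h)\<^sup>2) \<longlongrightarrow> e / 4 + A * (dist y z + 2 * 0 + 2 * 0)\<^sup>2) (at_right 0)"
      by (intro tendsto_intros)
    moreover have "((\<lambda>h. S h y - S h z) \<longlongrightarrow> V y - V z) (at_right 0)"
      by (intro tendsto_diff scheme_tendsto q)
    moreover have "\<forall>\<^sub>F h in at_right 0. S h y - S h z \<le> e / 4 + A * (dist y z + 2 * h + 2 * h)\<^sup>2"
      unfolding eventually_at_right_field using A yz by blast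
    ultimately have "V y - V z \<le> e / 4 + A * (dist y z + 2 * 0 + 2 * 0)\<^sup>2"
      by (intro tendsto_le[of "at_right 0"]) auto
    then show ?thesis by simp
  qed
  define d where "d = min 1 (e / (4 * (A + 1)))"
  have A1: "0 < 4 * (A + 1)" using A(1) by simp
  have "0 < e / (4 * (A + 1))" using e A1 by (rule divide_pos_pos)
  then have d: "0 < d" "d \<le> 1" "d \<le> e / (4 * (A + 1))" by (simp_all add: d_def)
  have dA: "d * (4 * (A + 1)) \<le> e" using d(3) pos_le_divide_eq[OF A1] by blast
  show "\<exists>d>0. \<forall>y\<in>quadrant. dist y x < d \<longrightarrow> dist (V y) (V x) < e"
  proof (intro exI[of _ d] conjI ballI impI d(1))
    fix y assume y: "y \<in> quadrant" and yx: "dist y x < d"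
    have sq: "x \<in> square T" "y \<in> square T"
      using coord_le_dist[of y x] x y yx d(2) by (auto simp: T_def square_def quadrant_def)
    have "dist y x * dist y x \<le> d * 1"
      by (rule mult_mono) (use yx d(1,2) in simp_all)
    then have "(dist y x)\<^sup>2 \<le> d" by (simp add: power2_eq_square)
    then have "A * (dist y x)\<^sup>2 \<le> A * d" using A(1) by (intro mult_left_mono) auto
    then have Ad: "A * (dist y x)\<^sup>2 \<le> e / 4" using dA d(1) by (simp add: algebra_simps)
    have "V y - V x \<le> e / 4 + A * (dist y x)\<^sup>2" "V x - V y \<le> e / 4 + A * (dist y x)\<^sup>2"
      using mod[OF sq(2,1)] mod[OF sq] by (simp_all add: dist_commute)
    then show "dist (V y) (V x) < e" using Ad e unfolding dist_real_def by linarith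
  qed
qed

lemma limit_mono:
  assumes x: "x \<in> quadrant" and y: "y \<in> quadrant" and le: "fst x \<le> fst y" "snd x \<le> snd y"
  shows "V x \<le> V y"
proof (rule tendsto_le[OF _ scheme_tendsto[OF y] scheme_tendsto[OF x]])
  show "\<forall>\<^sub>F h in at_right 0. S h x \<le> S h y"
    using eventually_at_right_less[of 0]
  proof eventually_elim
    case (elim h)
    obtain i j where ij: "S h x = U h i j" "i = nat \<lfloor>inverse h * fst x\<rfloor>" "j = nat \<lfloor>inverse h * snd x\<rfloor>"
      using scheme_ext_floor[OF elim x] by metis
    obtain i' j' where ij': "S h y = U h i' j'" "i' = nat \<lfloor>inverse h * fst y\<rfloor>" "j' = nat \<lfloor>inverse h * snd y\<rfloor>"
      using scheme_ext_floor[OF elim y] by metis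
    have "i \<le> i'" "j \<le> j'"
      unfolding ij ij' using elim le by (auto intro!: nat_mono floor_mono mult_left_mono)
    then show ?case unfolding ij(1) ij'(1) by (rule U_mono[OF elim])
  qed
qed simp

text \<open>The value at \<open>x\<close> is that of the axis grid point just before \<open>x\<close>, where the scheme is close to the
boundary value, and the boundary values are Lipschitz continuous.\<close>

lemma limit_boundary:
  assumes x: "x \<in> quadrant_boundary"
  shows "V x = \<phi> x"
proof -
  have xq: "x \<in> quadrant" using x by (simp add: quadrant_boundary_eq)
  obtain v t where v: "v \<in> {(1, 0), (0, 1)}" and t: "0 \<le> t" "x = t *\<^sub>R v" using boundary_cases[OF x] .
  define R where "R = t + 1"
  have R: "0 \<le> R" using t by (simp add: R_def)
  obtain M where M: "0 < M" "\<And>x. x \<in> square R \<Longrightarrow> rate x \<le> M" "\<And>x. x \<in> square R \<Longrightarrow> \<sigma> x \<le> M"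
    using bounded_on_square by blast
  have close: "\<bar>V x - \<phi> x\<bar> \<le> e" if e: "0 < e" for e
  proof -
    have "0 < e / 2" using e by simp
    note ev = U_axis_limit[OF R this]
    have ev2: "\<forall>\<^sub>F h in at_right 0. h < min 1 (e / 2 / M)"
      using e M(1) by (intro eventually_at_right_less order_tendstoD(2)[OF tendsto_ident_at]) simp
    have "\<forall>\<^sub>F h in at_right 0. \<bar>S h x - \<phi> x\<bar> \<le> e"
      using ev ev2 eventually_at_right_less[of 0]
    proof eventually_elim
      case (elim h)
      obtain i j where ij: "S h x = U h i j" "h * real i \<le> fst x" "fst x < h * real i + h" "h * real j \<le> snd x"
        "snd x < h * real j + h" using scheme_ext_floor[OF elim(3) xq] by metis
      have zero: "n = 0" if "h * real n \<le> 0" for n using that elim(3) by (simp add: mult_le_0_iff)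
      obtain n where n: "h * real n \<le> t" "t < h * real n + h" "\<bar>S h x - \<phi> ((h * real n) *\<^sub>R v)\<bar> \<le> e / 2"
      proof (cases "v = (1, 0)")
        case True
        then have "j = 0" "h * real i \<le> t" "t < h * real i + h" using ij zero[of j] t by auto
        moreover have "h * real i \<le> R" using \<open>h * real i \<le> t\<close> by (simp add: R_def)
        ultimately show thesis using elim(1) ij(1) True by (intro that[of i]) auto
      next
        case False
        then have v: "v = (0, 1)" using v by simp
        then have "i = 0" "h * real j \<le> t" "t < h * real j + h" using ij zero[of i] t by auto
        moreover have "h * real j \<le> R" using \<open>h * real j \<le> t\<close> by (simp add: R_def)
        ultimately show thesis using elim(1) ij(1) v by (intro that[of j]) auto
      qed
      have hn: "0 \<le> h * real n" "h * real n \<le> R" "t \<le> R" using elim(3) n(1) by (simp_all add: R_def)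
      have "\<bar>h * real n - t\<bar> \<le> h" using n by linarith
      then have "M * \<bar>h * real n - t\<bar> \<le> M * h" using M(1) by (intro mult_left_mono) auto
      also have "h \<le> e / 2 / M" using elim(2) by simp
      then have "M * h \<le> e / 2" unfolding pos_le_divide_eq[OF M(1)] by (simp only: mult.commute)
      finally have "M * \<bar>h * real n - t\<bar> \<le> e / 2" .
      moreover have "\<phi> ((h * real n) *\<^sub>R v) \<le> \<phi> x + M * \<bar>h * real n - t\<bar>"
        unfolding t(2) by (rule boundary_value_lipschitz[OF M(2) v t(1) hn(3) hn(1,2)])
      moreover have "\<phi> x \<le> \<phi> ((h * real n) *\<^sub>R v) + M * \<bar>h * real n - t\<bar>"
        unfolding t(2) abs_minus_commute[of "h * real n"]
        by (rule boundary_value_lipschitz[OF M(2) v hn(1,2) t(1) hn(3)])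
      ultimately have "\<bar>\<phi> ((h * real n) *\<^sub>R v) - \<phi> x\<bar> \<le> e / 2" by linarith
      then show ?case using n(3) by linarith
    qed
    moreover have "((\<lambda>h. \<bar>S h x - \<phi> x\<bar>) \<longlongrightarrow> \<bar>V x - \<phi> x\<bar>) (at_right 0)"
      by (intro tendsto_intros scheme_tendsto xq)
    ultimately show ?thesis by (intro tendsto_upperbound) auto
  qed
  have "\<bar>V x - \<phi> x\<bar> \<le> 0" by (rule field_le_epsilon, subst add_0, rule close)
  then show ?thesis by simp
qed

end

section \<open>Stability under uniform convergence\<close>

text \<open>The bound for \<open>F\<close> contains the cone \<open>\<delta> |y - x|\<close>; a second copy of it makes the maximum at \<open>x\<close> strict.
On the outer half of the ball this copy outweighs the distance \<open>e\<close> between \<open>f\<close> and \<open>F\<close>, so a maximiser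
over the points of \<open>G\<close> in the ball lies in the inner half. The cones are not differentiable at \<open>x\<close>, but
only finite differences of the test function enter, and there they cost the slope \<open>2 \<delta>\<close>.\<close>

lemma perturbed_maximum:
  fixes f F :: "'a::real_inner \<Rightarrow> real"
  assumes G: "finite G" "z \<in> G" and r: "dist z x \<le> r" and \<delta>: "0 < \<delta>"
    and F: "\<And>y. dist y x \<le> r \<Longrightarrow> F y \<le> F x + p \<bullet> (y - x) + \<delta> * dist y x"
    and fF: "\<And>y. y \<in> G \<Longrightarrow> dist y x \<le> r \<Longrightarrow> \<bar>f y - F y\<bar> \<le> e" "\<bar>f z - F x\<bar> \<le> e"
    and small: "2 * e + (norm p + 2 * \<delta>) * dist z x < \<delta> * r / 2"
  obtains y where "y \<in> G" "dist y x < r / 2"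
    "\<And>w. w \<in> G \<Longrightarrow> dist w x \<le> r \<Longrightarrow> f w \<le> f y + p \<bullet> (w - y) + 2 * \<delta> * dist w y"
proof -
  define G' where "G' = {y \<in> G. dist y x \<le> r}"
  define g where "g w = f w - p \<bullet> (w - x) - 2 * \<delta> * dist w x" for w
  have G': "finite G'" "z \<in> G'" using G r by (auto simp: G'_def)
  then have "\<exists>y\<in>G'. \<forall>w\<in>G'. g w \<le> g y"
    by (intro continuous_attains_sup finite_imp_compact continuous_on_finite) auto
  then obtain y where y: "y \<in> G'" "\<And>w. w \<in> G' \<Longrightarrow> g w \<le> g y" by blast
  have "p \<bullet> (z - x) \<le> norm p * dist z x" by (simp add: dist_norm norm_cauchy_schwarz)
  moreover have "F x - e \<le> f z" using fF(2) by linarith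
  ultimately have "F x - e - (norm p + 2 * \<delta>) * dist z x \<le> g z"
    by (simp add: g_def algebra_simps)
  moreover have "g y \<le> F x + e - \<delta> * dist y x"
    using F[of y] fF(1)[of y] y(1) by (simp add: g_def G'_def)
  moreover have "g z \<le> g y" using y(2) G'(2) by blast
  ultimately have "\<delta> * dist y x < \<delta> * (r / 2)" using small by simp
  then have "dist y x < r / 2" using \<delta> by simp
  moreover have "f w \<le> f y + p \<bullet> (w - y) + 2 * \<delta> * dist w y" if "w \<in> G" "dist w x \<le> r" for w
  proof -
    have "g w \<le> g y" using y(2) that by (simp add: G'_def)
    moreover have "2 * \<delta> * dist w x \<le> 2 * \<delta> * (dist w y + dist y x)"
      using \<delta> dist_triangle[of w x y] by (intro mult_left_mono) auto
    ultimately show ?thesis by (simp add: g_def inner_diff_right algebra_simps)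
  qed
  ultimately show thesis using y(1) by (intro that[of y]) (auto simp: G'_def)
qed

context last_passage
begin

text \<open>The sign \<open>s\<close> treats touching from above and from below together: for \<open>s = -1\<close> the functions are
negated. The radius \<open>r\<close> keeps the ball inside the open quadrant, so the touching grid point has both
predecessors, and \<open>h \<le> r / 2\<close> keeps them inside the ball.\<close>

lemma scheme_touching:
  fixes s :: real
  assumes x: "x \<in> open_quadrant" and s: "s = 1 \<or> s = -1" and \<delta>: "0 < \<delta>"
    and test: "\<forall>\<^sub>F y in at x. s * V y \<le> s * V x + (s *\<^sub>R p) \<bullet> (y - x) + \<delta> * dist y x"
  obtains h i j where "0 < h" "dist (h * real (Suc i), h * real (Suc j)) x < \<delta>"
    "s * (h * fst p) - 2 * \<delta> * h \<le> s * (U h (Suc i) (Suc j) - U h i (Suc j))"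
    "s * (h * snd p) - 2 * \<delta> * h \<le> s * (U h (Suc i) (Suc j) - U h (Suc i) j)"
proof -
  obtain d where d: "0 < d" "\<And>y. dist y x < d \<Longrightarrow> s * V y \<le> s * V x + (s *\<^sub>R p) \<bullet> (y - x) + \<delta> * dist y x"
  proof -
    obtain d where "0 < d" "\<And>y. y \<noteq> x \<Longrightarrow> dist y x < d \<Longrightarrow> s * V y \<le> s * V x + (s *\<^sub>R p) \<bullet> (y - x) + \<delta> * dist y x"
      using test unfolding eventually_at by blast
    then show thesis by (intro that[of d]) (metis add.right_neutral diff_self dist_self inner_zero_right mult_zero_right order_refl)+
  qed
  define r where "r = min (min (d / 2) \<delta>) (min (fst x / 2) (snd x / 2))"
  have xp: "0 < fst x" "0 < snd x" using x by (simp_all add: open_quadrant_def mem_Times_iff)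
  have r: "0 < r" "r < d" "r \<le> \<delta>" "r < fst x" "r < snd x"
    using d(1) \<delta> xp by (auto simp: r_def min_def)
  define T where "T = fst x + snd x + r"
  have T: "0 \<le> T" using xp r by (simp add: T_def)
  have near: "y \<in> square T" "0 < fst y" "0 < snd y" if "dist y x \<le> r" for y
    using coord_le_dist[of y x] that r xp by (auto simp: T_def square_def mem_Times_iff)
  define P where "P = norm (s *\<^sub>R p) + 2 * \<delta>"
  have P: "0 < P" using \<delta> by (simp add: P_def add_nonneg_pos)
  define e where "e = \<delta> * r / 8"
  have e: "0 < e" using \<delta> r by (simp add: e_def)
  obtain h0 where h0: "0 < h0" "\<And>h y. 0 < h \<Longrightarrow> h < h0 \<Longrightarrow> y \<in> square T \<Longrightarrow> \<bar>S h y - V y\<bar> \<le> e"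
    using scheme_limit[OF T e] by blast
  define h where "h = min (h0 / 2) (min (r / 2) (\<delta> * r / 16 / P))"
  have h: "0 < h" "h < h0" "h \<le> r / 2" "h * P \<le> \<delta> * r / 16"
  proof -
    have "0 < \<delta> * r / 16 / P" using \<delta> r(1) P by simp
    then show "0 < h" "h < h0" "h \<le> r / 2" using h0(1) r(1) by (auto simp: h_def min_def)
    have "h \<le> \<delta> * r / 16 / P" by (simp add: h_def)
    then show "h * P \<le> \<delta> * r / 16" using pos_le_divide_eq[OF P] by blast
  qed
  have xs: "x \<in> square T" using near[of x] r by simp
  obtain z where z: "z \<in> grid h T" "S h z = S h x" "dist z x \<le> 2 * h" using scheme_ext_on_grid[OF h(1) xs] .
  have abs_s: "\<bar>s * a - s * b\<bar> = \<bar>a - b\<bar>" for a b using s by auto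
  obtain y where y: "y \<in> grid h T" "dist y x < r / 2"
    "\<And>w. w \<in> grid h T \<Longrightarrow> dist w x \<le> r \<Longrightarrow> s * S h w \<le> s * S h y + (s *\<^sub>R p) \<bullet> (w - y) + 2 * \<delta> * dist w y"
  proof (rule perturbed_maximum[where f = "\<lambda>y. s * S h y" and F = "\<lambda>y. s * V y" and r = r and e = e, OF finite_grid[OF h(1)] z(1) _ \<delta>])
    show "dist z x \<le> r" using z(3) h(3) by linarith
    show "s * V y \<le> s * V x + (s *\<^sub>R p) \<bullet> (y - x) + \<delta> * dist y x" if "dist y x \<le> r" for y
      using d(2)[of y] that r(2) by linarith
    show "\<bar>s * S h y - s * V y\<bar> \<le> e" if "dist y x \<le> r" for y
      unfolding abs_s using h0(2)[OF h(1,2) near(1)[OF that]] .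
    show "\<bar>s * S h z - s * V x\<bar> \<le> e"
      unfolding abs_s z(2) using h0(2)[OF h(1,2) xs] .
    have "P * dist z x \<le> P * (2 * h)" using P z(3) by (intro mult_left_mono) auto
    then have "P * dist z x \<le> \<delta> * r / 8" using h(4) by (simp add: mult.commute)
    then show "2 * e + (norm (s *\<^sub>R p) + 2 * \<delta>) * dist z x < \<delta> * r / 2"
      using mult_pos_pos[OF \<delta> r(1)] unfolding P_def[symmetric] e_def by linarith
  qed blast
  have yr: "dist y x \<le> r" using y(2) r(1) by simp
  obtain i j where ij: "y = (h * real (Suc i), h * real (Suc j))"
    using grid_interiorE[OF y(1) near(2,3)[OF yr]] .
  define w1 where "w1 = (h * real i, h * real (Suc j))"
  define w2 where "w2 = (h * real (Suc i), h * real j)"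
  have w: "w1 \<in> grid h T" "w2 \<in> grid h T"
    using grid_predecessors[OF h(1) y(1)[unfolded ij]] unfolding w1_def w2_def by blast+
  have dw: "dist w1 y = h" "dist w2 y = h"
    using h(1) by (simp_all add: w1_def w2_def ij dist_Pair_Pair dist_real_def algebra_simps)
  have wx: "dist w1 x \<le> r" "dist w2 x \<le> r"
    using dist_triangle[of w1 x y] dist_triangle[of w2 x y] dw y(2) h(3) by linarith+
  have ip: "(s *\<^sub>R p) \<bullet> (w1 - y) = - (s * (h * fst p))" "(s *\<^sub>R p) \<bullet> (w2 - y) = - (s * (h * snd p))"
    by (simp_all add: w1_def w2_def ij inner_prod_def algebra_simps)
  have Sw: "S h w1 = U h i (Suc j)" "S h w2 = U h (Suc i) j" "S h y = U h (Suc i) (Suc j)"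
    unfolding w1_def w2_def ij by (rule scheme_ext_grid[OF h(1)])+
  show thesis
  proof (rule that[OF h(1)])
    show "dist (h * real (Suc i), h * real (Suc j)) x < \<delta>" using y(2) r(1,3) unfolding ij by linarith
    show "s * (h * fst p) - 2 * \<delta> * h \<le> s * (U h (Suc i) (Suc j) - U h i (Suc j))"
      using y(3)[OF w(1) wx(1)] unfolding ip dw Sw right_diff_distrib by linarith
    show "s * (h * snd p) - 2 * \<delta> * h \<le> s * (U h (Suc i) (Suc j) - U h (Suc i) j)"
      using y(3)[OF w(2) wx(2)] unfolding ip dw Sw right_diff_distrib by linarith
  qed
qed

lemma hamiltonian_limit:
  assumes x: "x \<in> open_quadrant" and c: "c \<longlonglongrightarrow> 0" and y: "y \<longlonglongrightarrow> x" "\<And>n. y n \<in> quadrant"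
  shows "(\<lambda>n. hamiltonian \<mu> (y n) (p + (c n, c n))) \<longlonglongrightarrow> hamiltonian \<mu> x p"
    and "(\<lambda>n. (\<sigma> (y n))\<^sup>2) \<longlonglongrightarrow> (\<sigma> x)\<^sup>2"
proof -
  have xq: "x \<in> quadrant" using x by (auto simp: open_quadrant_def quadrant_def)
  have \<mu>: "(\<lambda>n. \<mu> (y n)) \<longlonglongrightarrow> \<mu> x"
    by (rule continuous_on_tendsto_compose[OF lipschitz_on_continuous_on[OF \<mu>_lipschitz] y(1) xq]) (simp add: y)
  show "(\<lambda>n. (\<sigma> (y n))\<^sup>2) \<longlonglongrightarrow> (\<sigma> x)\<^sup>2"
    by (rule continuous_on_tendsto_compose[OF lipschitz_on_continuous_on[OF \<sigma>_lipschitz] y(1) xq]) (simp add: y)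
  have "(\<lambda>n. max (fst p + c n - \<mu> (y n)) 0 * max (snd p + c n - \<mu> (y n)) 0)
      \<longlonglongrightarrow> max (fst p + 0 - \<mu> x) 0 * max (snd p + 0 - \<mu> x) 0"
    by (intro tendsto_intros c \<mu>)
  then show "(\<lambda>n. hamiltonian \<mu> (y n) (p + (c n, c n))) \<longlonglongrightarrow> hamiltonian \<mu> x p"
    by (simp add: hamiltonian_def)
qed

text \<open>For every \<open>\<delta>\<close> there is a point within \<open>\<delta>\<close> of \<open>x\<close> at which the scheme satisfies the inequality with
\<open>p\<close> shifted by \<open>2 \<delta>\<close>; the Hamiltonian and \<open>\<sigma>\<^sup>2\<close> are continuous.\<close>

lemma limit_viscosity: "viscosity_solution \<mu> \<sigma> V"
  unfolding viscosity_solution_def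
proof (intro conjI limit_continuous ballI)
  fix x p assume x: "x \<in> open_quadrant"
  define \<delta> where "\<delta> n = inverse (real (Suc n))" for n
  have \<delta>: "0 < \<delta> n" for n by (simp add: \<delta>_def)
  have \<delta>0: "\<delta> \<longlonglongrightarrow> 0" unfolding \<delta>_def by (rule LIMSEQ_inverse_real_of_nat)
  have small: "\<forall>\<^sub>F y in at x. \<bar>r y\<bar> \<le> c * dist y x" if "r \<in> o[at x](\<lambda>y. norm (x - y))" "0 < c" for r and c :: real
    using landau_o.smallD[OF that] by eventually_elim (simp add: dist_norm norm_minus_commute)
  have to_x: "y \<longlonglongrightarrow> x" if "\<And>n. dist (y n) x < \<delta> n" for y :: "nat \<Rightarrow> real \<times> real"
  proof (rule metric_tendsto_imp_tendsto[OF \<delta>0])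
    show "\<forall>\<^sub>F n in sequentially. dist (y n) x \<le> dist (\<delta> n) 0"
      using that \<delta> by (auto intro!: always_eventually less_imp_le simp: dist_real_def abs_of_pos)
  qed
  {
    assume "p \<in> superdifferential V x"
    then obtain r where r: "r \<in> o[at x](\<lambda>y. norm (x - y))" "\<forall>\<^sub>F y in at x. V y \<le> V x + p \<bullet> (y - x) + r y"
      unfolding superdifferential_def by blast
    have "\<exists>y. y \<in> quadrant \<and> dist y x < \<delta> n \<and> hamiltonian \<mu> y (p + (- 2 * \<delta> n, - 2 * \<delta> n)) \<le> (\<sigma> y)\<^sup>2" for n
    proof -
      have "\<forall>\<^sub>F y in at x. 1 * V y \<le> 1 * V x + (1 *\<^sub>R p) \<bullet> (y - x) + \<delta> n * dist y x"
        using r(2) small[OF r(1) \<delta>[of n]] by eventually_elim simp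
      then obtain h i j where h: "0 < h" "dist (h * real (Suc i), h * real (Suc j)) x < \<delta> n"
        "1 * (h * fst p) - 2 * \<delta> n * h \<le> 1 * (U h (Suc i) (Suc j) - U h i (Suc j))"
        "1 * (h * snd p) - 2 * \<delta> n * h \<le> 1 * (U h (Suc i) (Suc j) - U h (Suc i) j)"
        using scheme_touching[OF x disjI1[OF refl] \<delta>] by blast
      have "h * (fst p - 2 * \<delta> n) \<le> U h (Suc i) (Suc j) - U h i (Suc j)"
        "h * (snd p - 2 * \<delta> n) \<le> U h (Suc i) (Suc j) - U h (Suc i) j"
        using h(3,4) by (simp_all add: algebra_simps)
      note H = scheme_hamiltonian_le[OF h(1) this]
      have "p - (2 * \<delta> n, 2 * \<delta> n) = p + (- 2 * \<delta> n, - 2 * \<delta> n)" by (simp add: prod_eq_iff)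
      note H = H[unfolded this]
      show ?thesis
        by (intro exI[of _ "(h * real (Suc i), h * real (Suc j))"] conjI grid_in_quadrant h(1,2) H)
    qed
    then obtain y where y: "\<And>n. y n \<in> quadrant" "\<And>n. dist (y n) x < \<delta> n"
      "\<And>n. hamiltonian \<mu> (y n) (p + (- 2 * \<delta> n, - 2 * \<delta> n)) \<le> (\<sigma> (y n))\<^sup>2" by metis
    have "(\<lambda>n. - 2 * \<delta> n) \<longlonglongrightarrow> 0" using tendsto_mult_right_zero[OF \<delta>0] .
    note lim = hamiltonian_limit[OF x this to_x[OF y(2)] y(1)]
    show "hamiltonian \<mu> x p \<le> (\<sigma> x)\<^sup>2"
      by (rule LIMSEQ_le[OF lim]) (use y(3) in blast)
  next
    assume "p \<in> subdifferential V x"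
    then obtain r where r: "r \<in> o[at x](\<lambda>y. norm (x - y))" "\<forall>\<^sub>F y in at x. V y \<ge> V x + p \<bullet> (y - x) + r y"
      unfolding subdifferential_def by blast
    have "\<exists>y. y \<in> quadrant \<and> dist y x < \<delta> n \<and> (\<sigma> y)\<^sup>2 \<le> hamiltonian \<mu> y (p + (2 * \<delta> n, 2 * \<delta> n))" for n
    proof -
      have "\<forall>\<^sub>F y in at x. - 1 * V y \<le> - 1 * V x + (- 1 *\<^sub>R p) \<bullet> (y - x) + \<delta> n * dist y x"
        using r(2) small[OF r(1) \<delta>[of n]] by eventually_elim (simp add: abs_le_iff)
      then obtain h i j where h: "0 < h" "dist (h * real (Suc i), h * real (Suc j)) x < \<delta> n"
        "- 1 * (h * fst p) - 2 * \<delta> n * h \<le> - 1 * (U h (Suc i) (Suc j) - U h i (Suc j))"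
        "- 1 * (h * snd p) - 2 * \<delta> n * h \<le> - 1 * (U h (Suc i) (Suc j) - U h (Suc i) j)"
        using scheme_touching[OF x disjI2[OF refl] \<delta>] by blast
      have "U h (Suc i) (Suc j) - U h i (Suc j) \<le> h * (fst p + 2 * \<delta> n)"
        "U h (Suc i) (Suc j) - U h (Suc i) j \<le> h * (snd p + 2 * \<delta> n)"
        using h(3,4) by (simp_all add: algebra_simps)
      note H = scheme_hamiltonian_ge[OF h(1) this]
      show ?thesis
        by (intro exI[of _ "(h * real (Suc i), h * real (Suc j))"] conjI grid_in_quadrant h(1,2)
            H[THEN conjunct2, THEN conjunct2])
    qed
    then obtain y where y: "\<And>n. y n \<in> quadrant" "\<And>n. dist (y n) x < \<delta> n"
      "\<And>n. (\<sigma> (y n))\<^sup>2 \<le> hamiltonian \<mu> (y n) (p + (2 * \<delta> n, 2 * \<delta> n))" by metis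
    have "(\<lambda>n. 2 * \<delta> n) \<longlonglongrightarrow> 0" using tendsto_mult_right_zero[OF \<delta>0] .
    note lim = hamiltonian_limit[OF x this to_x[OF y(2)] y(1)]
    show "hamiltonian \<mu> x p \<ge> (\<sigma> x)\<^sup>2"
      by (rule LIMSEQ_le[OF lim(2,1)]) (use y(3) in blast)
  }
qed

lemma limit_monotone_solution: "monotone_solution \<mu> \<sigma> \<phi> V"
  unfolding monotone_solution_def
proof (intro conjI limit_viscosity ballI limit_boundary)
  show "monotone_on_quadrant V"
    unfolding monotone_on_quadrant_def
    by (intro conjI allI impI mono_onI; rule limit_mono) (auto simp: quadrant_def)
qed

lemma scheme_locally_uniform: "locally_uniform_limit quadrant S V (at_right 0)"
  unfolding locally_uniform_limit_def
proof (intro allI impI, elim conjE)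
  fix K :: "(real \<times> real) set" assume K: "compact K" "K \<subseteq> quadrant"
  obtain T where T: "\<And>x. x \<in> K \<Longrightarrow> norm x \<le> T"
    using compact_imp_bounded[OF K(1)] unfolding bounded_iff by blast
  have sub: "K \<subseteq> square \<bar>T\<bar>"
  proof
    fix x assume x: "x \<in> K"
    then have "\<bar>fst x\<bar> \<le> \<bar>T\<bar>" "\<bar>snd x\<bar> \<le> \<bar>T\<bar>"
      using T[OF x] norm_fst_le[of "fst x" "snd x"] norm_snd_le[of "snd x" "fst x"] by (simp_all)
    then show "x \<in> square \<bar>T\<bar>" using x K(2) by (auto simp: square_def quadrant_def)
  qed
  show "uniform_limit K S V (at_right 0)"
  proof (rule uniform_limitI)
    fix e :: real assume e: "0 < e"
    obtain h0 where "0 < h0" "\<And>h x. 0 < h \<Longrightarrow> h < h0 \<Longrightarrow> x \<in> square \<bar>T\<bar> \<Longrightarrow> \<bar>S h x - V x\<bar> \<le> e / 2"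
      using scheme_limit[OF abs_ge_zero half_gt_zero[OF e]] by blast
    then show "\<forall>\<^sub>F h in at_right 0. \<forall>x\<in>K. dist (S h x) (V x) < e"
      using sub e unfolding eventually_at_right_field dist_real_def
      by (intro exI[of _ h0]) fastforce
  qed
qed

section \<open>Uniqueness and convergence\<close>

text \<open>The doubling estimate on a square, with both functions on the same set and no error \<open>\<eta>\<close>. The
boundary hypothesis follows from uniform continuity, as the functions agree on the boundary.\<close>

lemma monotone_solution_le:
  assumes u: "monotone_solution \<mu> \<sigma> \<psi> u" and v: "monotone_solution \<mu> \<sigma> \<psi> v" and x: "x \<in> quadrant"
  shows "u x \<le> v x"
proof (rule field_le_epsilon)
  fix \<epsilon> :: real assume \<epsilon>: "0 < \<epsilon>"
  define T where "T = fst x + snd x"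
  have T: "0 \<le> T" "x \<in> square T" using x by (auto simp: T_def quadrant_def square_def)
  let ?X = "square (T + 2)"
  have q: "continuous_on quadrant u" "continuous_on quadrant v"
    using u v by (simp_all add: monotone_solution_def viscosity_solution_def)
  have cont: "continuous_on ?X u" "continuous_on ?X v"
    by (rule continuous_on_subset[OF q(1) square_subset_quadrant] continuous_on_subset[OF q(2) square_subset_quadrant])+
  have "bounded (u ` ?X)" "bounded (v ` ?X)"
    using cont by (simp_all add: compact_imp_bounded compact_continuous_image compact_square)
  then obtain a b where ab: "\<And>x. x \<in> ?X \<Longrightarrow> \<bar>u x\<bar> \<le> a" "\<And>x. x \<in> ?X \<Longrightarrow> \<bar>v x\<bar> \<le> b"
    unfolding bounded_iff real_norm_def by blast
  define C where "C = \<bar>a\<bar> + \<bar>b\<bar> + 1"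
  have C0: "0 < C" unfolding C_def by linarith
  have C: "u x - v y \<le> C" if "x \<in> ?X" "y \<in> ?X" for x y
    using ab(1)[OF that(1)] ab(2)[OF that(2)] unfolding C_def by linarith
  obtain d1 where d1: "0 < d1" "\<And>x y. x \<in> ?X \<Longrightarrow> y \<in> ?X \<Longrightarrow> dist y x < d1 \<Longrightarrow> dist (u y) (u x) < \<epsilon> / 2"
    using compact_uniformly_continuous[OF cont(1) compact_square] half_gt_zero[OF \<epsilon>]
    unfolding uniformly_continuous_on_def by meson
  obtain d2 where d2: "0 < d2" "\<And>x y. x \<in> ?X \<Longrightarrow> y \<in> ?X \<Longrightarrow> dist y x < d2 \<Longrightarrow> dist (v y) (v x) < \<epsilon> / 2"
    using compact_uniformly_continuous[OF cont(2) compact_square] half_gt_zero[OF \<epsilon>]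
    unfolding uniformly_continuous_on_def by meson
  define \<rho> where "\<rho> = min d1 d2 / 2"
  have \<rho>: "0 < \<rho>" "\<rho> < d1" "\<rho> < d2" using d1(1) d2(1) by (simp_all add: \<rho>_def)
  obtain e s N where e: "0 < e" "2 * e * T \<le> \<epsilon> / 2" and s: "0 < s" "s \<le> 1" "s \<le> \<rho>"
    and sL: "(L' + 4 * L) * s \<le> e\<^sup>2 / 4" and N: "2 * C \<le> real N * s\<^sup>2"
    by (rule doubling_constants[OF L_nonneg T(1) C0 \<epsilon> \<rho>(1)])
  have "u x - v x \<le> \<epsilon> / 2 + 2 * e * T + 2 ^ N * (dist x x)\<^sup>2"
  proof (rule doubling_estimate[OF \<mu>_lipschitz \<sigma>_lipschitz _ _ T(1) C0 e(1) _ _ _ s(1), where K = "2 ^ N + C" and \<eta> = 0 and X = ?X and Y = ?X])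
    show "subsolution_on \<mu> \<sigma> (T + 2) (2 ^ N + C) 0 ?X u"
      using u by (intro viscosity_subsolution_on) (simp add: monotone_solution_def)
    show "supersolution_on \<mu> \<sigma> (T + 2) (2 ^ N + C) 0 ?X v"
      using v C0 by (intro viscosity_supersolution_on) (simp_all add: monotone_solution_def)
    show "u x - v y \<le> \<epsilon> / 2" if xy: "x \<in> ?X" "y \<in> ?X" "dist x y \<le> s"
      and bd: "x \<in> quadrant_boundary \<or> y \<in> quadrant_boundary" for x y
      using bd
    proof
      assume "x \<in> quadrant_boundary"
      then have "u x = v x" using u v by (simp add: monotone_solution_def)
      moreover have "dist (v x) (v y) < \<epsilon> / 2" using d2(2)[OF xy(2,1)] xy(3) s(3) \<rho>(3) by simp
      ultimately show ?thesis unfolding dist_real_def by linarith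
    next
      assume "y \<in> quadrant_boundary"
      then have "u y = v y" using u v by (simp add: monotone_solution_def)
      moreover have "dist (u x) (u y) < \<epsilon> / 2" using d1(2)[OF xy(2,1)] xy(3) s(3) \<rho>(2) by simp
      ultimately show ?thesis unfolding dist_real_def by linarith
    qed
    show "\<forall>x\<in>quadrant. 0 \<le> \<mu> x" using \<mu>_nonneg by blast
    show "\<forall>x\<in>open_quadrant. \<sigma> x = 0 \<longrightarrow> \<mu> x = 0" using \<mu>_eq_0 by blast
    show "x \<in> ?X" "x \<in> ?X" using T by (auto simp: square_def)
    show "0 \<le> \<epsilon> / 2" "(0::real) \<le> 1" "0 * (8 * 2 ^ N + 4 + 2 * L) \<le> e\<^sup>2 / 4" using \<epsilon> by simp_all
  qed (fact order_refl compact_square cont N s sL T C)+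
  then show "u x \<le> v x + \<epsilon>" using e(2) by simp
qed

end

theorem theorem8:
  fixes \<mu> \<sigma> \<mu>\<^sub>s :: "real \<times> real \<Rightarrow> real"
  assumes \<mu>_nonneg: "\<forall>x\<in>quadrant. 0 \<le> \<mu> x"
    and \<sigma>_nonneg: "\<forall>x\<in>quadrant. 0 \<le> \<sigma> x"
    and \<mu>_lipschitz: "\<exists>L. L-lipschitz_on quadrant \<mu>"
    and \<sigma>_lipschitz: "\<exists>L. L-lipschitz_on quadrant (\<lambda>x. (\<sigma> x)\<^sup>2)"
    and zeros: "{x \<in> open_quadrant. \<mu> x = 0} \<supseteq> {x \<in> open_quadrant. \<sigma> x = 0}"
    and \<mu>\<^sub>s_nonneg: "\<forall>x\<in>quadrant_boundary. 0 \<le> \<mu>\<^sub>s x"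
    and \<mu>\<^sub>s_bounded: "bounded (\<mu>\<^sub>s ` quadrant_boundary)"
    and \<mu>\<^sub>s_usc: "upper_semicontinuous_on quadrant_boundary \<mu>\<^sub>s"
    and \<mu>\<^sub>s_disc: "locally_finite_set (discontinuities_on quadrant_boundary \<mu>\<^sub>s)"
  shows "\<exists>U. monotone_solution \<mu> \<sigma> (boundary_value \<mu> \<mu>\<^sub>s) U
    \<and> (\<forall>V. monotone_solution \<mu> \<sigma> (boundary_value \<mu> \<mu>\<^sub>s) V \<longrightarrow> (\<forall>x\<in>quadrant. V x = U x))
    \<and> locally_uniform_limit quadrant (scheme_ext \<mu> \<mu>\<^sub>s \<sigma>) U (at_right 0)"
proof -
  obtain L L' where "L-lipschitz_on quadrant \<mu>" "L'-lipschitz_on quadrant (\<lambda>x. (\<sigma> x)\<^sup>2)"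
    using \<mu>_lipschitz \<sigma>_lipschitz by blast
  then interpret last_passage \<mu> \<sigma> \<mu>\<^sub>s L L'
    using \<mu>_nonneg \<sigma>_nonneg zeros \<mu>\<^sub>s_nonneg \<mu>\<^sub>s_bounded \<mu>\<^sub>s_disc by unfold_locales blast+
  show ?thesis
  proof (intro exI[of _ V] conjI allI impI ballI)
    fix W x assume "monotone_solution \<mu> \<sigma> (boundary_value \<mu> \<mu>\<^sub>s) W" "x \<in> quadrant"
    then show "W x = V x"
      using monotone_solution_le limit_monotone_solution by (meson order_antisym)
  qed (fact limit_monotone_solution scheme_locally_uniform)+
qed

end
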